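(* Let $\mathfrak a=\bigoplus_{i\in\mathbb Z}\mathfrak a(i)$ be a finite-dimensional $\mathbb Z$-graded Lie superalgebra over $\mathbb C$, let $\mathfrak m=\bigoplus_{i\le-1}\mathfrak a(i)$, $\mathfrak m(i)=\mathfrak m\cap\mathfrak a(i)$, and let $\varphi:\mathfrak m\to\mathbb C$ be a character. Let $\{u_1,\dots,u_m\}$ be a basis of $\mathfrak m$ consisting of elements homogeneous with respect to the $\mathbb Z$-grading, with $u_1,\dots,u_{m'}\in\mathfrak m_{\bar0}$ and $u_{m'+1},\dots,u_m\in\mathfrak m_{\bar1}$, and put $d_s:=-\deg(u_s)>0$. Let $x_1,\dots,x_{m'}\in\mathfrak a_{\bar0}$ and $x_{m'+1},\dots,x_m\in\mathfrak a_{\bar1}$ be elements homogeneous with respect to the $\mathbb Z$-grading with $\deg(x_s)=-1+d_s$ for $1\le s\le m$. Suppose that: (1) for any $1\le i\le m$, $[u_i,x_i]\in\mathfrak m(-1)$ and $\varphi([u_i,x_i])=1$; (2) for any $1\le i\ne j\le m$, if $[u_i,x_j]\in\mathfrak m(-1)$ then $\varphi([u_i,x_j])=0$; (3) $\varphi$ vanishes on $\bigoplus_{i\le-2}\mathfrak a(i)$. Then the Whittaker functor $\mathrm{Wh}_\varphi(\_):\mathfrak a\text{-}\mathrm{WMod}^\varphi\to\mathcal W_\varphi\text{-}\mathrm{Mod}$ is an equivalence of categories with quasi-inverse $Q_\varphi\otimes_{\mathcal W_\varphi}(\_):\mathcal W_\varphi\text{-}\mathrm{Mod}\to\mathfrak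 a\text{-}\mathrm{WMod}^\varphi$.
   Context: Modules are $\mathbb Z_2$-graded; subscripts $\bar0,\bar1$ denote even and odd parts; for $x\in\mathfrak a(i)$ write $\deg(x)=i$. A character of $\mathfrak m$ is a Lie superalgebra homomorphism $\mathfrak m\to\mathbb C$ (so it vanishes on $\mathfrak m_{\bar1}$ and $[\mathfrak m,\mathfrak m]$); $\mathbb C_\varphi$ is the corresponding one-dimensional $\mathfrak m$-module. $Q_\varphi:=U(\mathfrak a)\otimes_{U(\mathfrak m)}\mathbb C_\varphi\cong U(\mathfrak a)/I_\varphi$, where $I_\varphi$ is the left ideal of $U(\mathfrak a)$ generated by $x-\varphi(x)$, $x\in\mathfrak m$; $\mathrm{pr}:U(\mathfrak a)\to U(\mathfrak a)/I_\varphi$ is the projection. $\mathcal W_\varphi:=\{\mathrm{pr}(y)\in U(\mathfrak a)/I_\varphi\mid (x-\varphi(x))y\in I_\varphi\ \forall x\in\mathfrak m\}$, an associative superalgebra with product $\mathrm{pr}(y_1)\mathrm{pr}(y_2)=\mathrm{pr}(y_1y_2)$; it is identified with $\mathrm{End}_{U(\mathfrak a)}(Q_\varphi)^{\mathrm{op}}$, so that $Q_\varphi$ is a $(U(\mathfrak a),\mathcal W_\varphi)$-bimodule. $\mathfrak a\text{-}\mathrm{WMod}^\varphi$ is the category of all $\mathfrak a$-modules on which $x-\varphi(x)$ acts locally nilpotently for all $x\in\mathfrak m$, and $\mathcal W_\varphi\text{-}\mathrm{Mod}$ is the category of all $\mathcal W_\varphi$-modules. $\mathrm{Wh}_\varphi(M):=\{v\in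 M\mid xv=\varphi(x)v\ \forall x\in\mathfrak m\}$, with $\mathcal W_\varphi$-action $\mathrm{pr}(y)v=yv$. *)

theory Defs
  imports Complex_Main "HOL-Library.Poly_Mapping" "HOL-Library.Z2" "HOL-Algebra.QuotRing" "HOL-Algebra.Module"
begin

section \<open>Graded Lie superalgebras\<close>

text \<open>
  Parities are elements of \<^typ>\<open>bit\<close>, the field with two elements (\<open>0\<close> even, \<open>1\<close> odd).
  A Lie superalgebra lives on a whole type; modules and associative algebras (below) have explicit
  carriers, since subspaces and quotients of them are needed.
\<close>

definition koszul_sign :: "bit \<Rightarrow> bit \<Rightarrow> complex" where
  "koszul_sign i j = (if i = 1 \<and> j = 1 then -1 else 1)"

record 'a lie_super =
  lscale :: "complex \<Rightarrow> 'a \<Rightarrow> 'a"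
  bracket :: "'a \<Rightarrow> 'a \<Rightarrow> 'a"
  lparity :: "bit \<Rightarrow> 'a set"

abbreviation lspan :: "'a::ab_group_add lie_super \<Rightarrow> 'a set \<Rightarrow> 'a set" where
  "lspan L \<equiv> module.span (lscale L)"

locale lie_superalgebra =
  fixes L :: "'a::ab_group_add lie_super"
  assumes vector_space: "vector_space (lscale L)"
    and parity_subspace: "module.subspace (lscale L) (lparity L i)"
    and parity_decomposition:
      "\<exists>!p. fst p \<in> lparity L 0 \<and> snd p \<in> lparity L 1 \<and> z = fst p + snd p"
    and bracket_add_left: "bracket L (y + y') z = bracket L y z + bracket L y' z"
    and bracket_add_right: "bracket L y (z + z') = bracket L y z + bracket L y z'"
    and bracket_scale_left: "bracket L (lscale L c y) z = lscale L c (bracket L y z)"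
    and bracket_scale_right: "bracket L y (lscale L c z) = lscale L c (bracket L y z)"
    and bracket_parity:
      "y \<in> lparity L i \<Longrightarrow> z \<in> lparity L j \<Longrightarrow> bracket L y z \<in> lparity L (i + j)"
    and super_skew_symmetry:
      "y \<in> lparity L i \<Longrightarrow> z \<in> lparity L j \<Longrightarrow>
        bracket L y z = - lscale L (koszul_sign i j) (bracket L z y)"
    and super_jacobi:
      "y \<in> lparity L i \<Longrightarrow> z \<in> lparity L j \<Longrightarrow>
        bracket L y (bracket L z w) =
          bracket L (bracket L y z) w + lscale L (koszul_sign i j) (bracket L z (bracket L y w))"

definition finite_dimensional :: "'a::ab_group_add lie_super \<Rightarrow> bool" where
  "finite_dimensional L \<longleftrightarrow> (\<exists>B. finite B \<and> lspan L B = UNIV)"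

locale Z_graded_lie_superalgebra = lie_superalgebra L
  for L :: "'a::ab_group_add lie_super" +
  fixes gr :: "int \<Rightarrow> 'a set"
  assumes gr_subspace: "module.subspace (lscale L) (gr k)"
    and gr_super:
      "z \<in> gr k \<Longrightarrow> \<exists>z0\<in>gr k \<inter> lparity L 0. \<exists>z1\<in>gr k \<inter> lparity L 1. z = z0 + z1"
    and gr_decomposition:
      "\<exists>!c. (\<forall>k. c k \<in> gr k) \<and> finite {k. c k \<noteq> 0} \<and> z = (\<Sum>k\<in>{k. c k \<noteq> 0}. c k)"
    and gr_bracket: "y \<in> gr k \<Longrightarrow> z \<in> gr l \<Longrightarrow> bracket L y z \<in> gr (k + l)"

definition gr_upto :: "'a::ab_group_add lie_super \<Rightarrow> (int \<Rightarrow> 'a set) \<Rightarrow> int \<Rightarrow> 'a set" where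
  "gr_upto L gr k = lspan L (\<Union>i\<in>{..k}. gr i)"

text \<open>
  A homomorphism of Lie superalgebras from a subalgebra \<open>\<mm>\<close> to \<open>\<complex>\<close>, where \<open>\<complex>\<close> is purely even with
  zero bracket.  Only the values of \<open>\<phi>\<close> on \<open>\<mm>\<close> are relevant, here and in everything below.
\<close>

definition lie_character :: "'a::ab_group_add lie_super \<Rightarrow> 'a set \<Rightarrow> ('a \<Rightarrow> complex) \<Rightarrow> bool" where
  "lie_character L \<mm> \<phi> \<longleftrightarrow>
     (\<forall>y\<in>\<mm>. \<forall>z\<in>\<mm>. \<phi> (y + z) = \<phi> y + \<phi> z) \<and>
     (\<forall>c. \<forall>y\<in>\<mm>. \<phi> (lscale L c y) = c * \<phi> y) \<and>
     (\<forall>y\<in>\<mm>. \<forall>z\<in>\<mm>. \<phi> (bracket L y z) = 0) \<and>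
     (\<forall>y\<in>\<mm> \<inter> lparity L 1. \<phi> y = 0)"


section \<open>Superspaces, supermodules and their quotients\<close>

definition complex_ring :: "complex ring" where
  "complex_ring = \<lparr>carrier = UNIV, mult = (*), one = 1, zero = 0, add = (+)\<rparr>"

text \<open>
  The \<open>mult\<close> and \<open>one\<close> components inherited from \<^typ>\<open>'m ring\<close> are meaningful for associative
  superalgebras and ignored for mere superspaces and modules.
\<close>

record 'm superspace = "(complex, 'm) module" +
  parity :: "bit \<Rightarrow> 'm set"

record ('s, 'm) supermodule = "'m superspace" +
  action :: "'s \<Rightarrow> 'm \<Rightarrow> 'm"

definition with_action :: "'m superspace \<Rightarrow> ('s \<Rightarrow> 'm \<Rightarrow> 'm) \<Rightarrow> ('s, 'm) supermodule" where
  "with_action V act =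
     \<lparr>carrier = carrier V, mult = mult V, one = one V, zero = zero V, add = add V,
      smult = smult V, parity = parity V, action = act\<rparr>"

definition super_vector_space :: "('m, 'z) superspace_scheme \<Rightarrow> bool" where
  "super_vector_space V \<longleftrightarrow>
     module complex_ring V \<and>
     (\<forall>i. submodule (parity V i) complex_ring V) \<and>
     (\<forall>v\<in>carrier V. \<exists>!p. fst p \<in> parity V 0 \<and> snd p \<in> parity V 1 \<and> v = fst p \<oplus>\<^bsub>V\<^esub> snd p)"

definition generated_subspace :: "('m, 'z) superspace_scheme \<Rightarrow> 'm set \<Rightarrow> 'm set" where
  "generated_subspace V S = \<Inter>{K. submodule K complex_ring V \<and> S \<subseteq> K}"

text \<open>
  The map on cosets modulo \<open>K\<close> induced by \<open>h\<close>, in the style of \<^const>\<open>rcoset_mult\<close>: when \<open>h\<close>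
  respects the cosets, all sets in the union coincide.
\<close>

definition coset_map :: "('n, 'z) ring_scheme \<Rightarrow> 'n set \<Rightarrow> ('m \<Rightarrow> 'n) \<Rightarrow> 'm set \<Rightarrow> 'n set" where
  "coset_map V K h C = (\<Union>v\<in>C. K +>\<^bsub>V\<^esub> h v)"

text \<open>
  If \<open>K\<close> is a two-sided ideal of a superalgebra \<open>V\<close> this is the quotient superalgebra.  If \<open>K\<close> is
  just a subspace, it is the quotient superspace, and the \<open>mult\<close> component is still
  \<open>(K + a, K + b) \<mapsto> K + ab\<close> wherever this does not depend on the representatives.
\<close>

definition quotient_superspace :: "('m, 'z) superspace_scheme \<Rightarrow> 'm set \<Rightarrow> 'm set superspace" where
  "quotient_superspace V K =
     \<lparr>carrier = carrier (V Quot K), mult = mult (V Quot K), one = one (V Quot K),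
      zero = zero (V Quot K), add = add (V Quot K),
      smult = (\<lambda>c. coset_map V K (smult V c)),
      parity = (\<lambda>i. (\<lambda>v. K +>\<^bsub>V\<^esub> v) ` parity V i)\<rparr>"

definition lie_module :: "'a::ab_group_add lie_super \<Rightarrow> ('a, 'm) supermodule \<Rightarrow> bool" where
  "lie_module L M \<longleftrightarrow>
     super_vector_space M \<and>
     (\<forall>x. \<forall>v\<in>carrier M. action M x v \<in> carrier M) \<and>
     (\<forall>x y. \<forall>v\<in>carrier M. action M (x + y) v = action M x v \<oplus>\<^bsub>M\<^esub> action M y v) \<and>
     (\<forall>c x. \<forall>v\<in>carrier M. action M (lscale L c x) v = c \<odot>\<^bsub>M\<^esub> action M x v) \<and>
     (\<forall>x. \<forall>v\<in>carrier M. \<forall>w\<in>carrier M. action M x (v \<oplus>\<^bsub>M\<^esub> w) = action M x v \<oplus>\<^bsub>M\<^esub> action M x w) \<and>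
     (\<forall>c x. \<forall>v\<in>carrier M. action M x (c \<odot>\<^bsub>M\<^esub> v) = c \<odot>\<^bsub>M\<^esub> action M x v) \<and>
     (\<forall>i j. \<forall>x\<in>lparity L i. \<forall>v\<in>parity M j. action M x v \<in> parity M (i + j)) \<and>
     (\<forall>i j. \<forall>x\<in>lparity L i. \<forall>y\<in>lparity L j. \<forall>v\<in>carrier M.
        action M (bracket L x y) v =
          action M x (action M y v) \<ominus>\<^bsub>M\<^esub> koszul_sign i j \<odot>\<^bsub>M\<^esub> action M y (action M x v))"

definition superalgebra_module ::
    "('w, 'z) superspace_scheme \<Rightarrow> ('w, 'm) supermodule \<Rightarrow> bool" where
  "superalgebra_module A N \<longleftrightarrow>
     super_vector_space N \<and>
     (\<forall>a\<in>carrier A. \<forall>v\<in>carrier N. action N a v \<in> carrier N) \<and>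
     (\<forall>a\<in>carrier A. \<forall>b\<in>carrier A. \<forall>v\<in>carrier N.
        action N (a \<oplus>\<^bsub>A\<^esub> b) v = action N a v \<oplus>\<^bsub>N\<^esub> action N b v) \<and>
     (\<forall>c. \<forall>a\<in>carrier A. \<forall>v\<in>carrier N. action N (c \<odot>\<^bsub>A\<^esub> a) v = c \<odot>\<^bsub>N\<^esub> action N a v) \<and>
     (\<forall>a\<in>carrier A. \<forall>v\<in>carrier N. \<forall>w\<in>carrier N.
        action N a (v \<oplus>\<^bsub>N\<^esub> w) = action N a v \<oplus>\<^bsub>N\<^esub> action N a w) \<and>
     (\<forall>c. \<forall>a\<in>carrier A. \<forall>v\<in>carrier N. action N a (c \<odot>\<^bsub>N\<^esub> v) = c \<odot>\<^bsub>N\<^esub> action N a v) \<and>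
     (\<forall>i j. \<forall>a\<in>parity A i. \<forall>v\<in>parity N j. action N a v \<in> parity N (i + j)) \<and>
     (\<forall>v\<in>carrier N. action N \<one>\<^bsub>A\<^esub> v = v) \<and>
     (\<forall>a\<in>carrier A. \<forall>b\<in>carrier A. \<forall>v\<in>carrier N.
        action N (a \<otimes>\<^bsub>A\<^esub> b) v = action N a (action N b v))"

text \<open>
  Morphisms are the parity-preserving homomorphisms; they are taken extensional, so that equality
  of morphisms is equality of functions.  \<open>S\<close> is the set of acting elements.
\<close>

definition supermodule_hom ::
    "'s set \<Rightarrow> ('s, 'm) supermodule \<Rightarrow> ('s, 'n) supermodule \<Rightarrow> ('m \<Rightarrow> 'n) set" where
  "supermodule_hom S M N =
     {f \<in> carrier M \<rightarrow>\<^sub>E carrier N.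
        (\<forall>v\<in>carrier M. \<forall>w\<in>carrier M. f (v \<oplus>\<^bsub>M\<^esub> w) = f v \<oplus>\<^bsub>N\<^esub> f w) \<and>
        (\<forall>c. \<forall>v\<in>carrier M. f (c \<odot>\<^bsub>M\<^esub> v) = c \<odot>\<^bsub>N\<^esub> f v) \<and>
        (\<forall>i. f ` parity M i \<subseteq> parity N i) \<and>
        (\<forall>s\<in>S. \<forall>v\<in>carrier M. f (action M s v) = action N s (f v))}"

definition supermodule_iso ::
    "'s set \<Rightarrow> ('s, 'm) supermodule \<Rightarrow> ('s, 'n) supermodule \<Rightarrow> ('m \<Rightarrow> 'n) set" where
  "supermodule_iso S M N = {f \<in> supermodule_hom S M N. bij_betw f (carrier M) (carrier N)}"


section \<open>Functors between categories of supermodules\<close>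

text \<open>
  A category of supermodules over \<open>S\<close> is given by the predicate \<open>\<A>\<close> describing its objects, with
  all morphisms of \<^const>\<open>supermodule_hom\<close>.  A functor is an object map \<open>F\<close> with a morphism map \<open>F'\<close>
  taking source and target of the morphism as its first two arguments.
\<close>

definition supermodule_functor ::
    "(('s, 'm) supermodule \<Rightarrow> bool) \<Rightarrow> 's set \<Rightarrow> (('t, 'n) supermodule \<Rightarrow> bool) \<Rightarrow> 't set \<Rightarrow>
     (('s, 'm) supermodule \<Rightarrow> ('t, 'n) supermodule) \<Rightarrow>
     (('s, 'm) supermodule \<Rightarrow> ('s, 'm) supermodule \<Rightarrow> ('m \<Rightarrow> 'm) \<Rightarrow> 'n \<Rightarrow> 'n) \<Rightarrow> bool" where
  "supermodule_functor \<A> S \<B> T F F' \<longleftrightarrow>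
     (\<forall>M. \<A> M \<longrightarrow> \<B> (F M)) \<and>
     (\<forall>M N. \<A> M \<longrightarrow> \<A> N \<longrightarrow>
        (\<forall>f\<in>supermodule_hom S M N. F' M N f \<in> supermodule_hom T (F M) (F N))) \<and>
     (\<forall>M. \<A> M \<longrightarrow> F' M M (\<lambda>v\<in>carrier M. v) = (\<lambda>v\<in>carrier (F M). v)) \<and>
     (\<forall>M N P. \<A> M \<longrightarrow> \<A> N \<longrightarrow> \<A> P \<longrightarrow>
        (\<forall>f\<in>supermodule_hom S M N. \<forall>g\<in>supermodule_hom S N P.
           F' M P (compose (carrier M) g f) = compose (carrier (F M)) (F' N P g) (F' M N f)))"

text \<open>
  \<open>F\<close> is naturally isomorphic to the identity of the category \<open>\<A>\<close>.  The type of elements of \<open>F M\<close>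
  may differ from that of \<open>M\<close>.
\<close>

definition nat_iso_identity ::
    "(('s, 'm) supermodule \<Rightarrow> bool) \<Rightarrow> 's set \<Rightarrow>
     (('s, 'm) supermodule \<Rightarrow> ('s, 'n) supermodule) \<Rightarrow>
     (('s, 'm) supermodule \<Rightarrow> ('s, 'm) supermodule \<Rightarrow> ('m \<Rightarrow> 'm) \<Rightarrow> 'n \<Rightarrow> 'n) \<Rightarrow> bool" where
  "nat_iso_identity \<A> S F F' \<longleftrightarrow>
     (\<exists>\<eta>. (\<forall>M. \<A> M \<longrightarrow> \<eta> M \<in> supermodule_iso S M (F M)) \<and>
          (\<forall>M N. \<A> M \<longrightarrow> \<A> N \<longrightarrow>
             (\<forall>f\<in>supermodule_hom S M N.
                compose (carrier M) (\<eta> N) f = compose (carrier M) (F' M N f) (\<eta> M))))"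


section \<open>The universal enveloping algebra\<close>

text \<open>
  \<open>U(\<aa>)\<close> is the free associative algebra on the set \<open>\<aa>\<close> (finitely supported functions on words,
  with convolution) modulo linearity of \<open>\<aa> \<rightarrow> U(\<aa>)\<close>, which makes it a quotient of the tensor algebra,
  and the supercommutator relations.
\<close>

datatype 'a word = Word (letters: "'a list")

instantiation word :: (type) monoid_add
begin

definition zero_word :: "'a word" where "zero_word = Word []"

definition plus_word :: "'a word \<Rightarrow> 'a word \<Rightarrow> 'a word" where
  "plus_word v w = Word (letters v @ letters w)"

instance by standard (simp_all add: zero_word_def plus_word_def)

end

type_synonym 'a free_elem = "'a word \<Rightarrow>\<^sub>0 complex"
type_synonym 'a env_elem = "'a free_elem set"

definition scale_pm :: "complex \<Rightarrow> ('k \<Rightarrow>\<^sub>0 complex) \<Rightarrow> ('k \<Rightarrow>\<^sub>0 complex)" where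
  "scale_pm c = Poly_Mapping.map ((*) c)"

definition letter :: "'a \<Rightarrow> 'a free_elem" where
  "letter x = Poly_Mapping.single (Word [x]) 1"

definition word_parity :: "'a lie_super \<Rightarrow> bit \<Rightarrow> 'a word set" where
  "word_parity L i =
     {w. \<exists>js. list_all2 (\<lambda>x j. x \<in> lparity L j) (letters w) js \<and> sum_list js = i}"

definition free_superalgebra :: "'a lie_super \<Rightarrow> 'a free_elem superspace" where
  "free_superalgebra L =
     \<lparr>carrier = UNIV, mult = (*), one = 1, zero = 0, add = (+), smult = scale_pm,
      parity = (\<lambda>i. {f. Poly_Mapping.keys f \<subseteq> word_parity L i})\<rparr>"

definition enveloping_relations :: "'a::ab_group_add lie_super \<Rightarrow> 'a free_elem set" where
  "enveloping_relations L =
     {letter (x + y) - letter x - letter y | x y. True} \<union>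
     {letter (lscale L c x) - scale_pm c (letter x) | c x. True} \<union>
     {letter x * letter y - scale_pm (koszul_sign i j) (letter y * letter x) - letter (bracket L x y)
        | x y i j. x \<in> lparity L i \<and> y \<in> lparity L j}"

definition enveloping_ideal :: "'a::ab_group_add lie_super \<Rightarrow> 'a free_elem set" where
  "enveloping_ideal L = Idl\<^bsub>free_superalgebra L\<^esub> (enveloping_relations L)"

definition enveloping_algebra :: "'a::ab_group_add lie_super \<Rightarrow> 'a env_elem superspace" where
  "enveloping_algebra L = quotient_superspace (free_superalgebra L) (enveloping_ideal L)"

definition env_embed :: "'a::ab_group_add lie_super \<Rightarrow> 'a \<Rightarrow> 'a env_elem" where
  "env_embed L x = enveloping_ideal L +>\<^bsub>free_superalgebra L\<^esub> letter x"

text \<open>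
  The action of \<open>U(\<aa>)\<close> on an \<open>\<aa>\<close>-module: a word acts letter by letter, and all representatives of an
  element of \<open>U(\<aa>)\<close> act in the same way.
\<close>

definition free_action :: "('a, 'm) supermodule \<Rightarrow> 'a free_elem \<Rightarrow> 'm \<Rightarrow> 'm" where
  "free_action M f v =
     (\<Oplus>\<^bsub>M\<^esub>w\<in>Poly_Mapping.keys f. Poly_Mapping.lookup f w \<odot>\<^bsub>M\<^esub> foldr (action M) (letters w) v)"

definition env_action :: "('a, 'm) supermodule \<Rightarrow> 'a env_elem \<Rightarrow> 'm \<Rightarrow> 'm" where
  "env_action M y v = the_elem ((\<lambda>f. free_action M f v) ` y)"


section \<open>The module Q and the algebra W\<close>

definition left_ideal :: "'m set \<Rightarrow> ('m, 'z) ring_scheme \<Rightarrow> bool" where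
  "left_ideal I R \<longleftrightarrow>
     additive_subgroup I R \<and> (\<forall>a\<in>carrier R. \<forall>b\<in>I. a \<otimes>\<^bsub>R\<^esub> b \<in> I)"

text \<open>\<open>shifted\<close> is the element \<open>x - \<phi>(x)\<close> of \<open>U(\<aa>)\<close>.\<close>

definition shifted :: "'a::ab_group_add lie_super \<Rightarrow> ('a \<Rightarrow> complex) \<Rightarrow> 'a \<Rightarrow> 'a env_elem" where
  "shifted L \<phi> x =
     (let U = enveloping_algebra L in env_embed L x \<ominus>\<^bsub>U\<^esub> \<phi> x \<odot>\<^bsub>U\<^esub> \<one>\<^bsub>U\<^esub>)"

definition whittaker_ideal ::
    "'a::ab_group_add lie_super \<Rightarrow> 'a set \<Rightarrow> ('a \<Rightarrow> complex) \<Rightarrow> 'a env_elem set" where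
  "whittaker_ideal L \<mm> \<phi> =
     \<Inter>{I. left_ideal I (enveloping_algebra L) \<and> shifted L \<phi> ` \<mm> \<subseteq> I}"

definition Q_space ::
    "'a::ab_group_add lie_super \<Rightarrow> 'a set \<Rightarrow> ('a \<Rightarrow> complex) \<Rightarrow> 'a env_elem set superspace" where
  "Q_space L \<mm> \<phi> = quotient_superspace (enveloping_algebra L) (whittaker_ideal L \<mm> \<phi>)"

definition pr ::
    "'a::ab_group_add lie_super \<Rightarrow> 'a set \<Rightarrow> ('a \<Rightarrow> complex) \<Rightarrow> 'a env_elem \<Rightarrow> 'a env_elem set" where
  "pr L \<mm> \<phi> y = whittaker_ideal L \<mm> \<phi> +>\<^bsub>enveloping_algebra L\<^esub> y"

definition Q_module ::
    "'a::ab_group_add lie_super \<Rightarrow> 'a set \<Rightarrow> ('a \<Rightarrow> complex) \<Rightarrow>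
     ('a, 'a env_elem set) supermodule" where
  "Q_module L \<mm> \<phi> =
     (let U = enveloping_algebra L in
      with_action (Q_space L \<mm> \<phi>)
        (\<lambda>x. coset_map U (whittaker_ideal L \<mm> \<phi>) (\<lambda>y. env_embed L x \<otimes>\<^bsub>U\<^esub> y)))"

text \<open>
  The product of \<open>W\<close> is \<open>pr y1 \<cdot> pr y2 = pr (y1 y2)\<close>, the \<open>mult\<close> component of \<^const>\<open>Q_space\<close> (see the
  remark at \<^const>\<open>quotient_superspace\<close>).  The same component, with left factor in \<open>Q\<close> and right
  factor in \<open>W\<close>, is the right \<open>W\<close>-action on \<open>Q\<close>.
\<close>

definition W_algebra ::
    "'a::ab_group_add lie_super \<Rightarrow> 'a set \<Rightarrow> ('a \<Rightarrow> complex) \<Rightarrow> 'a env_elem set superspace" where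
  "W_algebra L \<mm> \<phi> =
     (let U = enveloping_algebra L; Q = Q_space L \<mm> \<phi>;
          C = {pr L \<mm> \<phi> y | y. y \<in> carrier U \<and>
                 (\<forall>x\<in>\<mm>. shifted L \<phi> x \<otimes>\<^bsub>U\<^esub> y \<in> whittaker_ideal L \<mm> \<phi>)}
      in Q\<lparr>carrier := C, parity := (\<lambda>i. parity Q i \<inter> C)\<rparr>)"


section \<open>The Whittaker functor\<close>

definition WMod ::
    "'a::ab_group_add lie_super \<Rightarrow> 'a set \<Rightarrow> ('a \<Rightarrow> complex) \<Rightarrow> ('a, 'm) supermodule \<Rightarrow> bool" where
  "WMod L \<mm> \<phi> M \<longleftrightarrow>
     lie_module L M \<and>
     (\<forall>x\<in>\<mm>. \<forall>v\<in>carrier M. \<exists>n::nat.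
        ((\<lambda>w. action M x w \<ominus>\<^bsub>M\<^esub> \<phi> x \<odot>\<^bsub>M\<^esub> w) ^^ n) v = \<zero>\<^bsub>M\<^esub>)"

definition whittaker_vectors ::
    "'a set \<Rightarrow> ('a \<Rightarrow> complex) \<Rightarrow> ('a, 'm) supermodule \<Rightarrow> 'm set" where
  "whittaker_vectors \<mm> \<phi> M = {v \<in> carrier M. \<forall>x\<in>\<mm>. action M x v = \<phi> x \<odot>\<^bsub>M\<^esub> v}"

text \<open>
  \<open>W\<close> acts on Whittaker vectors by \<open>pr y \<cdot> v = y v\<close>, which does not depend on \<open>y\<close> because the
  Whittaker ideal annihilates these vectors.
\<close>

definition Wh ::
    "'a set \<Rightarrow> ('a \<Rightarrow> complex) \<Rightarrow> ('a, 'm) supermodule \<Rightarrow> ('a env_elem set, 'm) supermodule" where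
  "Wh \<mm> \<phi> M =
     \<lparr>carrier = whittaker_vectors \<mm> \<phi> M, mult = mult M, one = one M, zero = zero M, add = add M,
      smult = smult M, parity = (\<lambda>i. parity M i \<inter> whittaker_vectors \<mm> \<phi> M),
      action = (\<lambda>p v. the_elem ((\<lambda>y. env_action M y v) ` p))\<rparr>"

definition Wh_map ::
    "'a set \<Rightarrow> ('a \<Rightarrow> complex) \<Rightarrow> ('a, 'm) supermodule \<Rightarrow> ('a, 'm) supermodule \<Rightarrow>
     ('m \<Rightarrow> 'm) \<Rightarrow> 'm \<Rightarrow> 'm" where
  "Wh_map \<mm> \<phi> M N f = restrict f (whittaker_vectors \<mm> \<phi> M)"


section \<open>The tensor product functor\<close>

definition free_superspace ::
    "('p, 'z) superspace_scheme \<Rightarrow> ('n, 'y) superspace_scheme \<Rightarrow> ('p \<times> 'n \<Rightarrow>\<^sub>0 complex) superspace" where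
  "free_superspace P N =
     \<lparr>carrier = {f. Poly_Mapping.keys f \<subseteq> carrier P \<times> carrier N}, mult = undefined, one = undefined,
      zero = 0, add = (+), smult = scale_pm,
      parity = (\<lambda>i. {f. Poly_Mapping.keys f \<subseteq> (\<Union>j. parity P j \<times> parity N (i - j))})\<rparr>"

text \<open>
  The tensor product over \<open>A\<close> of a right \<open>A\<close>-module \<open>P\<close>, with right action \<open>r\<close>, and a left \<open>A\<close>-module
  \<open>N\<close> is the free space on pairs modulo the following relations.
\<close>

definition tensor_relations ::
    "('w, 'x) superspace_scheme \<Rightarrow> ('p, 'z) superspace_scheme \<Rightarrow> ('p \<Rightarrow> 'w \<Rightarrow> 'p) \<Rightarrow>
     ('w, 'n) supermodule \<Rightarrow> ('p \<times> 'n \<Rightarrow>\<^sub>0 complex) set" where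
  "tensor_relations A P r N =
     (let t = (\<lambda>p n. Poly_Mapping.single (p, n) 1) in
      {t (p \<oplus>\<^bsub>P\<^esub> p') n - t p n - t p' n | p p' n.
         p \<in> carrier P \<and> p' \<in> carrier P \<and> n \<in> carrier N} \<union>
      {t p (n \<oplus>\<^bsub>N\<^esub> n') - t p n - t p n' | p n n'.
         p \<in> carrier P \<and> n \<in> carrier N \<and> n' \<in> carrier N} \<union>
      {t (c \<odot>\<^bsub>P\<^esub> p) n - scale_pm c (t p n) | c p n. p \<in> carrier P \<and> n \<in> carrier N} \<union>
      {t p (c \<odot>\<^bsub>N\<^esub> n) - scale_pm c (t p n) | c p n. p \<in> carrier P \<and> n \<in> carrier N} \<union>
      {t (r p a) n - t p (action N a n) | p a n.
         p \<in> carrier P \<and> a \<in> carrier A \<and> n \<in> carrier N})"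

definition push_forward :: "('k \<Rightarrow> 'l) \<Rightarrow> ('k \<Rightarrow>\<^sub>0 complex) \<Rightarrow> ('l \<Rightarrow>\<^sub>0 complex)" where
  "push_forward h f = (\<Sum>k\<in>Poly_Mapping.keys f. Poly_Mapping.single (h k) (Poly_Mapping.lookup f k))"

type_synonym ('a, 'n) Q_tensor_elem = "('a env_elem set \<times> 'n \<Rightarrow>\<^sub>0 complex) set"

definition Q_tensor_kernel ::
    "'a::ab_group_add lie_super \<Rightarrow> 'a set \<Rightarrow> ('a \<Rightarrow> complex) \<Rightarrow>
     ('a env_elem set, 'n) supermodule \<Rightarrow> ('a, 'n) Q_tensor_elem" where
  "Q_tensor_kernel L \<mm> \<phi> N =
     (let Q = Q_space L \<mm> \<phi> in
      generated_subspace (free_superspace Q N)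
        (tensor_relations (W_algebra L \<mm> \<phi>) Q (mult Q) N))"

definition Q_tensor ::
    "'a::ab_group_add lie_super \<Rightarrow> 'a set \<Rightarrow> ('a \<Rightarrow> complex) \<Rightarrow>
     ('a env_elem set, 'n) supermodule \<Rightarrow> ('a, ('a, 'n) Q_tensor_elem) supermodule" where
  "Q_tensor L \<mm> \<phi> N =
     (let F = free_superspace (Q_space L \<mm> \<phi>) N; K = Q_tensor_kernel L \<mm> \<phi> N in
      with_action (quotient_superspace F K)
        (\<lambda>x. coset_map F K (push_forward (\<lambda>(q, n). (action (Q_module L \<mm> \<phi>) x q, n)))))"

definition Q_tensor_map ::
    "'a::ab_group_add lie_super \<Rightarrow> 'a set \<Rightarrow> ('a \<Rightarrow> complex) \<Rightarrow>
     ('a env_elem set, 'n) supermodule \<Rightarrow> ('a env_elem set, 'n) supermodule \<Rightarrow> ('n \<Rightarrow> 'n) \<Rightarrow>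
     ('a, 'n) Q_tensor_elem \<Rightarrow> ('a, 'n) Q_tensor_elem" where
  "Q_tensor_map L \<mm> \<phi> N N' g =
     restrict
       (coset_map (free_superspace (Q_space L \<mm> \<phi>) N') (Q_tensor_kernel L \<mm> \<phi> N')
          (push_forward (\<lambda>(q, n). (q, g n))))
       (carrier (Q_tensor L \<mm> \<phi> N))"

end

theory Submission
  imports Defs
begin

text \<open>Let \<open>D i = u i - \<phi>(u i)\<close> act on a module \<open>M\<close> of \<open>\<aa>-WMod\<close>.  Give \<open>D i\<close> the
weight \<open>d i\<close> and let \<open>Fil n\<close> be the space of vectors killed by all words in the \<open>D i\<close> of weight
greater than \<open>n\<close>.  Then \<open>Fil 0 = Wh(M)\<close>; the union of the \<open>Fil n\<close> is \<open>M\<close>, because the \<open>D i\<close> are locally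
nilpotent and span a nilpotent Lie superalgebra (\<open>Fil_exhaustive\<close>); and an element of \<open>\<aa>(k)\<close> maps
\<open>Fil n\<close> to \<open>Fil (n + k + 1)\<close> (\<open>act_gr\<close>).  In particular \<open>x i\<close> raises the filtration by \<open>d i\<close>.
Modulo lower terms, the hypotheses on \<open>\<phi>([u i, x j])\<close> say that \<open>D i\<close> and \<open>x j\<close> satisfy the relations
of a Weyl superalgebra whenever \<open>d j \<le> d i\<close> (\<open>D_X_commute\<close>).

For \<open>d i < d j\<close> the supercommutator of \<open>D i\<close> and \<open>x j\<close> is a new operator without lower filtration degree.
This is harmless if the pairs \<open>(D k, x k)\<close> are treated one after the other in the order of decreasing \<open>d\<close>.
On the classes in the associated graded space that are killed by the earlier \<open>D j\<close>, the current pair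
generates a Weyl algebra, or a Clifford algebra if \<open>k\<close> is odd, and \<open>D k\<close> is nilpotent.  Such a module is the
space of polynomials in \<open>x k\<close> over the kernel of \<open>D k\<close>.  Iterating this, every \<open>M\<close> is the direct sum of the
spaces \<open>x\<^sup>a Wh(M)\<close> over the ordered monomials \<open>x\<^sup>a\<close>, in which the odd \<open>x k\<close> occur at most once
(\<open>ordf_exhausts\<close>, \<open>ordf_independent\<close>).  The rest of the proof uses this in the form
\<open>M = Wh(M) \<oplus> M\<^sub>+\<close> with \<open>M\<^sub>+\<close> spanned by the \<open>x\<^sup>a v\<close>, \<open>a \<noteq> 0\<close>, \<open>v \<in> Wh(M)\<close> (\<open>Whit_decomposition\<close>,
\<open>Whit_Pos_disjoint\<close>).

The module \<open>Q\<close> lies in the category and \<open>Wh(Q) = W\<close>, so \<open>Q = W \<oplus> Q\<^sub>+\<close>, and the projection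
\<open>Q \<rightarrow> W\<close> along \<open>Q\<^sub>+\<close> is right \<open>W\<close>-linear.  It induces a left inverse of \<open>n \<mapsto> 1 \<otimes> n\<close>, which is therefore
injective (\<open>unit_injective\<close>).  Moreover \<open>Q \<otimes> N\<close> is the sum of \<open>1 \<otimes> N\<close>, which consists of Whittaker vectors,
and of \<open>Q\<^sub>+ \<otimes> N\<close>, which is contained in \<open>(Q \<otimes> N)\<^sub>+\<close>.  Since \<open>Wh(Q \<otimes> N)\<close> meets \<open>(Q \<otimes> N)\<^sub>+\<close> only in \<open>0\<close>,
it equals \<open>1 \<otimes> N\<close> (\<open>unit_surjective\<close>).

The map \<open>Q \<otimes> Wh(M) \<rightarrow> M\<close>, \<open>pr(y) \<otimes> v \<mapsto> yv\<close>, is onto because its image is a submodule that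
contains \<open>Wh(M)\<close>, hence also \<open>M\<^sub>+\<close>.  Its kernel contains no Whittaker vector except \<open>0\<close>, because
\<open>Wh(Q \<otimes> Wh(M)) = 1 \<otimes> Wh(M)\<close> is mapped identically to \<open>Wh(M)\<close>; and a nonzero submodule of an object of the
category contains a nonzero Whittaker vector, namely any nonzero vector in the lowest step of the filtration that it
meets (\<open>submodule_meets_Whit\<close>).

The algebras and modules are quotients of spaces of finitely supported functions, and their elements are
handled through representatives: elements of \<open>Q\<close> through the free algebra, elements of \<open>Q \<otimes> N\<close> through formal
combinations of pairs, and elements of an arbitrary module \<open>M\<close> through formal combinations of elements of
\<open>M\<close>.  The parity decomposition of a quotient comes from the parity involution, whose eigenspaces it consists of
(\<open>quotient_super\<close>).\<close>

section \<open>Whittaker data\<close>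

lemma koszul_sign_simps [simp]:
  "koszul_sign 0 j = 1" "koszul_sign j 0 = 1" "koszul_sign 1 1 = -1"
  by (simp_all add: koszul_sign_def)

context lie_superalgebra begin
sublocale lie: vector_space "lscale L" by (rule vector_space)
end

text \<open>The algebra \<open>W\<close>, the module \<open>Q\<close>, the functor \<open>Wh\<close> and the tensor product are constructed from these data alone.\<close>

locale whittaker_character = lie_superalgebra L
  for L :: "'a::ab_group_add lie_super" +
  fixes \<mm> :: "'a set" and \<phi> :: "'a \<Rightarrow> complex"
  assumes character: "lie_character L \<mm> \<phi>"
    and m_subspace: "lie.subspace \<mm>"
    and m_super: "z \<in> \<mm> \<Longrightarrow> \<exists>a\<in>\<mm> \<inter> lparity L 0. \<exists>b\<in>\<mm> \<inter> lparity L 1. z = a + b"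
begin

lemma phi_add: "y \<in> \<mm> \<Longrightarrow> z \<in> \<mm> \<Longrightarrow> \<phi> (y + z) = \<phi> y + \<phi> z"
  and phi_scale: "y \<in> \<mm> \<Longrightarrow> \<phi> (lscale L c y) = c * \<phi> y"
  and phi_bracket: "y \<in> \<mm> \<Longrightarrow> z \<in> \<mm> \<Longrightarrow> \<phi> (bracket L y z) = 0"
  and phi_odd: "y \<in> \<mm> \<Longrightarrow> y \<in> lparity L 1 \<Longrightarrow> \<phi> y = 0"
  using character unfolding lie_character_def by blast+

lemma phi_zero: "\<phi> 0 = 0"
  using phi_scale[of 0 0] m_subspace by (simp add: lie.subspace_def)

end

text \<open>The indices are listed by decreasing \<open>d\<close>, the order in which the variables \<open>x i\<close> are split off later.  The
degrees of \<open>u i\<close> and \<open>x j\<close> make \<open>[u i, x j]\<close> an element of degree \<open>d j - d i - 1\<close>; it lies in degree \<open>-1\<close>,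
where \<open>\<phi>\<close> can be nonzero, exactly for \<open>d i = d j\<close>.\<close>

locale whittaker_datum = Z_graded_lie_superalgebra L gr + whittaker_character L \<mm> \<phi>
  for L :: "'a::ab_group_add lie_super" and gr and \<mm> :: "'a set" and \<phi> :: "'a \<Rightarrow> complex" +
  fixes order :: "nat list"
    and u x :: "nat \<Rightarrow> 'a" and d :: "nat \<Rightarrow> int" and par :: "nat \<Rightarrow> bit"
  assumes m_span: "\<mm> = lspan L (u ` set order)"
    and order_distinct: "distinct order"
    and order_sorted: "sorted_wrt (\<lambda>i j. d j \<le> d i) order"
    and d_pos: "i \<in> set order \<Longrightarrow> 1 \<le> d i"
    and u_gr: "i \<in> set order \<Longrightarrow> u i \<in> gr (- d i)"
    and x_gr: "i \<in> set order \<Longrightarrow> x i \<in> gr (d i - 1)"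
    and u_par: "i \<in> set order \<Longrightarrow> u i \<in> lparity L (par i)"
    and x_par: "i \<in> set order \<Longrightarrow> x i \<in> lparity L (par i)"
    and u_span: "1 \<le> e \<Longrightarrow> z \<in> gr (- e) \<Longrightarrow> z \<in> lspan L (u ` {i \<in> set order. d i = e})"
    and phi_low: "2 \<le> e \<Longrightarrow> z \<in> gr (- e) \<Longrightarrow> \<phi> z = 0"
    and phi_pairing: "i \<in> set order \<Longrightarrow> j \<in> set order \<Longrightarrow> d i = d j \<Longrightarrow>
          \<phi> (bracket L (u i) (x j)) = (if i = j then 1 else 0)"
begin

lemma u_in_m: "i \<in> set order \<Longrightarrow> u i \<in> \<mm>"
  unfolding m_span by (simp add: lie.span_base)

text \<open>A sign occurs only if \<open>u i\<close> is odd, and then \<open>\<phi>\<close> vanishes on it.\<close>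

lemma phi_sign: "i \<in> set order \<Longrightarrow> koszul_sign (par i) j * \<phi> (u i) = \<phi> (u i)"
  using phi_odd[OF u_in_m, of i] u_par[of i] by (cases "par i"; cases j) auto

end

section \<open>The weight filtration\<close>

text \<open>A representation of \<open>\<aa>\<close> on \<open>V / K\<close>, described on representatives: the operators are linear on \<open>V\<close>, all other
axioms hold modulo \<open>K\<close>.  This keeps the linear algebra on a type \<open>'v\<close>, although the modules of the theorem
have explicit carriers.\<close>

locale action_mod = whittaker_datum L gr \<mm> \<phi> order u x d par + V: vector_space sc
  for L :: "'a::ab_group_add lie_super" and gr \<mm> \<phi> order u x d par
    and sc :: "complex \<Rightarrow> 'v::ab_group_add \<Rightarrow> 'v" +
  fixes act :: "'a \<Rightarrow> 'v \<Rightarrow> 'v" and K :: "'v set"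
  assumes K_subspace: "V.subspace K"
    and act_add: "act y (v + w) = act y v + act y w"
    and act_scale: "act y (sc c v) = sc c (act y v)"
    and act_K: "v \<in> K \<Longrightarrow> act y v \<in> K"
    and act_add_left: "act (y + z) v - (act y v + act z v) \<in> K"
    and act_scale_left: "act (lscale L c y) v - sc c (act y v) \<in> K"
    and act_bracket: "y \<in> lparity L i \<Longrightarrow> z \<in> lparity L j \<Longrightarrow>
          act (bracket L y z) v - (act y (act z v) - sc (koszul_sign i j) (act z (act y v))) \<in> K"
begin

definition shift :: "'a \<Rightarrow> 'v \<Rightarrow> 'v" where
  "shift z v = act z v - sc (\<phi> z) v"

abbreviation D :: "nat \<Rightarrow> 'v \<Rightarrow> 'v" where "D i \<equiv> shift (u i)"
abbreviation X :: "nat \<Rightarrow> 'v \<Rightarrow> 'v" where "X i \<equiv> act (x i)"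

definition wt :: "nat list \<Rightarrow> int" where "wt w = sum_list (map d w)"

lemma wt_simps [simp]: "wt [] = 0" "wt (i # w) = d i + wt w" "wt (v @ w) = wt v + wt w"
  "wt (replicate r i) = int r * d i"
  by (simp_all add: wt_def sum_list_replicate)

lemma wt_ge_length: "w \<in> lists (set order) \<Longrightarrow> int (length w) \<le> wt w"
  using d_pos by (induction w) force+

lemma wt_nonneg: "w \<in> lists (set order) \<Longrightarrow> 0 \<le> wt w"
  using wt_ge_length[of w] by linarith

lemma act_zero [simp]: "act y 0 = 0"
  using act_scale[of y 0 0] by simp

lemma act_minus: "act y (- v) = - act y v"
  using act_scale[of y "-1" v] by simp

lemma act_diff: "act y (v - w) = act y v - act y w"
  using act_add[of y v "- w"] by (simp add: act_minus)

lemma shift_add: "shift z (v + w) = shift z v + shift z w"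
  by (simp add: shift_def act_add V.scale_right_distrib)

lemma shift_scale: "shift z (sc c v) = sc c (shift z v)"
  by (simp add: shift_def act_scale V.scale_right_diff_distrib V.scale_left_commute)

lemma shift_diff: "shift z (v - w) = shift z v - shift z w"
  by (simp add: shift_def act_diff V.scale_right_diff_distrib)

lemmas K_rules = V.subspace_0[OF K_subspace] V.subspace_add[OF K_subspace]
  V.subspace_diff[OF K_subspace] V.subspace_scale[OF K_subspace] V.subspace_neg[OF K_subspace]

lemma shift_K: "v \<in> K \<Longrightarrow> shift z v \<in> K"
  by (simp add: shift_def act_K K_rules)

lemma act_zero_left: "act 0 v \<in> K"
  using act_scale_left[of 0 0 v] by simp

lemma shift_span:
  assumes "S \<subseteq> set order" "z \<in> lspan L (u ` S)" "V.subspace T" "K \<subseteq> T"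
    and "\<And>i. i \<in> S \<Longrightarrow> D i v \<in> T"
  shows "shift z v \<in> T"
proof -
  note T = V.subspace_0[OF assms(3)] V.subspace_add[OF assms(3)] V.subspace_scale[OF assms(3)]
  have sub: "lie.subspace {z. z \<in> \<mm> \<and> shift z v \<in> T}"
  proof (rule lie.subspaceI)
    show "0 \<in> {z. z \<in> \<mm> \<and> shift z v \<in> T}"
      using act_zero_left[of v] assms(4) phi_zero lie.subspace_0[OF m_subspace]
      by (auto simp: shift_def)
  next
    fix y z assume a: "y \<in> {z. z \<in> \<mm> \<and> shift z v \<in> T}" "z \<in> {z. z \<in> \<mm> \<and> shift z v \<in> T}"
    have "shift (y + z) v = (act (y + z) v - (act y v + act z v)) + shift y v + shift z v"
      using a by (simp add: shift_def phi_add V.scale_left_distrib algebra_simps)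
    then show "y + z \<in> {z. z \<in> \<mm> \<and> shift z v \<in> T}"
      using a T act_add_left[of y z v] assms(4) lie.subspace_add[OF m_subspace] by auto
  next
    fix c y assume a: "y \<in> {z. z \<in> \<mm> \<and> shift z v \<in> T}"
    have "shift (lscale L c y) v = (act (lscale L c y) v - sc c (act y v)) + sc c (shift y v)"
      using a by (simp add: shift_def phi_scale V.scale_right_diff_distrib algebra_simps)
    then show "lscale L c y \<in> {z. z \<in> \<mm> \<and> shift z v \<in> T}"
      using a T act_scale_left[of c y v] assms(4) lie.subspace_scale[OF m_subspace] by auto
  qed
  have "z \<in> {z. z \<in> \<mm> \<and> shift z v \<in> T}"
    by (rule lie.span_subspace_induct[OF assms(2) sub]) (use assms u_in_m in auto)
  then show ?thesis by simp
qed

text \<open>\<open>D i\<close> differs from the action of \<open>u i\<close> by a scalar, which commutes with everything; the Koszul sign does not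
affect this scalar by \<open>phi_sign\<close>.\<close>

lemma D_act_commute:
  assumes "i \<in> set order" "y \<in> lparity L j"
  shows "D i (act y v) - (sc (koszul_sign (par i) j) (act y (D i v)) + act (bracket L (u i) y) v) \<in> K"
proof -
  let ?s = "koszul_sign (par i) j"
  have eq: "D i (act y v) - (sc ?s (act y (D i v)) + act (bracket L (u i) y) v) =
     - (act (bracket L (u i) y) v - (act (u i) (act y v) - sc ?s (act y (act (u i) v))))"
    using phi_sign[OF assms(1), of j]
    by (simp add: shift_def act_diff act_scale V.scale_right_diff_distrib algebra_simps)
  show ?thesis unfolding eq by (rule K_rules(5)[OF act_bracket[OF u_par[OF assms(1)] assms(2)]])
qed

lemma D_D_commute:
  assumes "i \<in> set order" "j \<in> set order"
  shows "D i (D j v) - (sc (koszul_sign (par i) (par j)) (D j (D i v)) + shift (bracket L (u i) (u j)) v) \<in> K"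
proof -
  let ?s = "koszul_sign (par i) (par j)"
  have e: "?s * \<phi> (u j) = \<phi> (u j)"
    using phi_sign[OF assms(2), of "par i"] by (simp add: koszul_sign_def conj_commute)
  have "D i (D j v) - (sc ?s (D j (D i v)) + shift (bracket L (u i) (u j)) v) =
    D i (act (u j) v) - (sc ?s (act (u j) (D i v)) + act (bracket L (u i) (u j)) v)"
  proof (cases "\<phi> (u j) = 0")
    case True
    then show ?thesis using phi_bracket[OF u_in_m u_in_m, OF assms]
      by (simp add: shift_def act_diff act_scale V.scale_right_diff_distrib algebra_simps)
  next
    case False
    then have "?s = 1" using e by simp
    then show ?thesis using phi_bracket[OF u_in_m u_in_m, OF assms]
      by (simp add: shift_def act_diff act_scale V.scale_right_diff_distrib V.scale_left_commute algebra_simps)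
  qed
  then show ?thesis using D_act_commute[OF assms(1) u_par[OF assms(2)], of v] by simp
qed

text \<open>Negative steps of the filtration are \<open>K\<close>, that is, zero in \<open>V / K\<close>, and step \<open>0\<close> consists of the Whittaker
vectors.\<close>

definition Fil :: "int \<Rightarrow> 'v set" where
  "Fil n = {v. \<forall>w \<in> lists (set order). n < wt w \<longrightarrow> foldr D w v \<in> K}"

lemma foldr_D_K: "v \<in> K \<Longrightarrow> foldr D w v \<in> K"
  by (induction w) (auto intro: shift_K)

lemma foldr_D_add: "foldr D w (v + v') = foldr D w v + foldr D w v'"
  by (induction w) (auto simp: shift_add)

lemma foldr_D_scale: "foldr D w (sc c v) = sc c (foldr D w v)"
  by (induction w) (auto simp: shift_scale)

lemma K_Fil: "v \<in> K \<Longrightarrow> v \<in> Fil n"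
  by (auto simp: Fil_def foldr_D_K)

lemma Fil_subspace: "V.subspace (Fil n)"
  by (rule V.subspaceI) (auto simp: Fil_def foldr_D_add foldr_D_scale K_rules foldr_D_K)

lemmas Fil_rules = V.subspace_0[OF Fil_subspace] V.subspace_add[OF Fil_subspace]
  V.subspace_diff[OF Fil_subspace] V.subspace_scale[OF Fil_subspace] V.subspace_neg[OF Fil_subspace]

lemma subspace_diff_mem: "V.subspace S \<Longrightarrow> a - b \<in> S \<Longrightarrow> b \<in> S \<Longrightarrow> a \<in> S"
  using V.subspace_add[of S "a - b" b] by simp

lemmas Fil_diff_mem = subspace_diff_mem[OF Fil_subspace]

lemma Fil_mono: "v \<in> Fil k \<Longrightarrow> k \<le> n \<Longrightarrow> v \<in> Fil n"
  by (auto simp: Fil_def)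

lemma Fil_neg: "n < 0 \<Longrightarrow> Fil n = K"
proof
  assume "n < 0"
  then show "Fil n \<subseteq> K" by (force simp: Fil_def dest: bspec[of _ _ "[]"])
qed (auto intro: K_Fil)

lemma Fil_D: "v \<in> Fil n \<Longrightarrow> i \<in> set order \<Longrightarrow> D i v \<in> Fil (n - d i)"
proof -
  assume a: "v \<in> Fil n" "i \<in> set order"
  have "foldr D w (D i v) \<in> K" if "w \<in> lists (set order)" "n - d i < wt w" for w
  proof -
    have "w @ [i] \<in> lists (set order)" "n < wt (w @ [i])" using that a(2) by auto
    then have "foldr D (w @ [i]) v \<in> K" using a(1) unfolding Fil_def by blast
    then show ?thesis by simp
  qed
  then show ?thesis by (auto simp: Fil_def)
qed

lemma Fil_I:
  assumes "0 \<le> n" "\<And>i. i \<in> set order \<Longrightarrow> D i v \<in> Fil (n - d i)"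
  shows "v \<in> Fil n"
proof -
  have "foldr D w v \<in> K" if w: "w \<in> lists (set order)" "n < wt w" for w
  proof (cases w rule: rev_cases)
    case Nil then show ?thesis using w assms(1) by simp
  next
    case (snoc w' i) then show ?thesis using w assms(2)[of i] by (auto simp: Fil_def)
  qed
  then show ?thesis by (auto simp: Fil_def)
qed

lemma shift_gr:
  assumes "1 \<le> e" "z \<in> gr (- e)" "v \<in> Fil n"
  shows "shift z v \<in> Fil (n - e)"
  by (rule shift_span[OF _ u_span[OF assms(1,2)] Fil_subspace])
     (use Fil_D[OF assms(3)] K_Fil in auto)

lemma act_low:
  assumes "k \<le> -1" "y \<in> gr k" "v \<in> Fil n"
  shows "act y v \<in> Fil (n + k + 1)"
proof -
  have y: "1 \<le> -k" "y \<in> gr (- (- k))" using assms by auto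
  have s: "shift y v \<in> Fil (n + k)" using shift_gr[OF y assms(3)] by simp
  show ?thesis
  proof (cases "k = -1")
    case True
    have "shift y v + sc (\<phi> y) v \<in> Fil n" using s True assms(3) Fil_mono Fil_rules by force
    then show ?thesis using True by (simp add: shift_def)
  next
    case False
    then have "\<phi> y = 0" using phi_low[of "-k" y] assms by auto
    then show ?thesis using s Fil_mono[of _ "n+k" "n+k+1"] by (simp add: shift_def)
  qed
qed

text \<open>For \<open>k < 0\<close> the element \<open>y\<close> is a combination of the \<open>u i\<close> with \<open>d i = - k\<close>, and only for \<open>k = -1\<close> does \<open>\<phi>\<close>
contribute a scalar.  For \<open>k \<ge> 0\<close> the commutator of \<open>D i\<close> with \<open>y\<close> is \<open>[u i, y]\<close>, of degree \<open>k - d i\<close>, so the claim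
follows by induction on \<open>k\<close> and then on \<open>n\<close>.\<close>

lemma act_gr: "y \<in> gr k \<Longrightarrow> v \<in> Fil n \<Longrightarrow> act y v \<in> Fil (n + k + 1)"
proof (induction "nat (k + 1)" arbitrary: k y v n rule: less_induct)
  case outer: less
  show ?case
  proof (cases "k \<le> -1")
    case True then show ?thesis using act_low outer.prems by blast
  next
    case k: False
    show ?thesis using outer.prems
    proof (induction "nat (n + 1)" arbitrary: y v n rule: less_induct)
      case inner: less
      show ?case
      proof (cases "n < 0")
        case True
        then show ?thesis using inner.prems act_K K_Fil Fil_neg by auto
      next
        case n: False
        have hom: "act z v \<in> Fil (n + k + 1)" if z: "z \<in> gr k" "z \<in> lparity L j" for z j
        proof (rule Fil_I)
          show "0 \<le> n + k + 1" using n k by simp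
          fix i assume i: "i \<in> set order"
          have a: "act z (D i v) \<in> Fil (n + k + 1 - d i)"
            using inner.hyps[of "n - d i" z "D i v"] d_pos[OF i] n z Fil_D[OF inner.prems(2) i]
            by (simp add: algebra_simps)
          have "bracket L (u i) z \<in> gr (k - d i)" using gr_bracket[OF u_gr[OF i] z(1)] by simp
          then have b: "act (bracket L (u i) z) v \<in> Fil (n + k + 1 - d i)"
            using outer.hyps[of "k - d i" "bracket L (u i) z" v n] d_pos[OF i] k inner.prems(2)
            by (simp add: algebra_simps)
          show "D i (act z v) \<in> Fil (n + k + 1 - d i)"
            by (rule Fil_diff_mem[OF K_Fil[OF D_act_commute[OF i z(2)]] Fil_rules(2)[OF Fil_rules(4)[OF a] b]])
        qed
        obtain y0 y1 where "y0 \<in> gr k \<inter> lparity L 0" "y1 \<in> gr k \<inter> lparity L 1" "y = y0 + y1"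
          using gr_super[OF inner.prems(1)] by blast
        then show ?thesis
          using Fil_rules(2)[OF K_Fil[OF act_add_left[of y0 y1 v]] Fil_rules(2)[OF hom[of y0 0] hom[of y1 1]]]
          by auto
      qed
    qed
  qed
qed

lemma X_Fil: "v \<in> Fil n \<Longrightarrow> i \<in> set order \<Longrightarrow> X i v \<in> Fil (n + d i)"
  using act_gr[OF x_gr, of i v n] by simp

text \<open>The commutator is \<open>[u i, x j]\<close>, an element of negative degree.  It acts as a shifted operator, which lowers
the filtration further, plus the scalar \<open>\<phi>([u i, x j])\<close>, which is the Kronecker delta.\<close>

lemma D_X_commute:
  assumes "i \<in> set order" "j \<in> set order" "d j \<le> d i" "v \<in> Fil n"
  shows "D i (X j v) - (sc (koszul_sign (par i) (par j)) (X j (D i v)) + (if i = j then v else 0))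
    \<in> Fil (n + d j - d i - 1)"
proof -
  let ?z = "bracket L (u i) (x j)"
  let ?e = "d i - d j + 1"
  have z: "?z \<in> gr (- ?e)" using gr_bracket[OF u_gr[OF assms(1)] x_gr[OF assms(2)]] by (simp add: algebra_simps)
  have p: "\<phi> ?z = (if i = j then 1 else 0)"
    using phi_pairing[OF assms(1,2)] phi_low[OF _ z] assms(3) by force
  have s: "shift ?z v \<in> Fil (n + d j - d i - 1)" using shift_gr[OF _ z assms(4)] assms(3) by (simp add: algebra_simps)
  have eq: "D i (X j v) - (sc (koszul_sign (par i) (par j)) (X j (D i v)) + (if i = j then v else 0)) =
     D i (X j v) - (sc (koszul_sign (par i) (par j)) (X j (D i v)) + act ?z v) + shift ?z v"
    using p by (simp add: shift_def)
  show ?thesis unfolding eq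
    by (rule Fil_rules(2)[OF K_Fil[OF D_act_commute[OF assms(1) x_par[OF assms(2)]]] s])
qed

end

section \<open>Splitting off one variable\<close>

context action_mod begin

lemma D_pow_add: "(D i ^^ r) (v + w) = (D i ^^ r) v + (D i ^^ r) w"
  by (induction r) (auto simp: shift_add)

lemma D_pow_diff: "(D i ^^ r) (v - w) = (D i ^^ r) v - (D i ^^ r) w"
  by (induction r) (auto simp: shift_diff)

lemma D_pow_scale: "(D i ^^ r) (sc c v) = sc c ((D i ^^ r) v)"
  by (induction r) (auto simp: shift_scale)

lemma X_pow_add: "(X i ^^ r) (v + w) = (X i ^^ r) v + (X i ^^ r) w"
  by (induction r) (auto simp: act_add)

lemma X_pow_scale: "(X i ^^ r) (sc c v) = sc c ((X i ^^ r) v)"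
  by (induction r) (auto simp: act_scale)

lemma X_pow_0 [simp]: "(X i ^^ r) 0 = 0"
  by (induction r) auto

lemma X_pow_K: "v \<in> K \<Longrightarrow> (X i ^^ r) v \<in> K"
  by (induction r) (auto simp: act_K)

lemma Fil_D_pow: "v \<in> Fil n \<Longrightarrow> i \<in> set order \<Longrightarrow> (D i ^^ r) v \<in> Fil (n - int r * d i)"
proof (induction r)
  case (Suc r)
  then show ?case using Fil_D[of "(D i ^^ r) v" "n - int r * d i" i] by (simp add: algebra_simps)
qed simp

lemma Fil_X_pow: "v \<in> Fil n \<Longrightarrow> i \<in> set order \<Longrightarrow> (X i ^^ r) v \<in> Fil (n + int r * d i)"
proof (induction r)
  case (Suc r)
  then show ?case using X_Fil[of "(X i ^^ r) v" "n + int r * d i" i] by (simp add: algebra_simps)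
qed simp

text \<open>Representatives of the classes in \<open>Fil n / Fil (n - 1)\<close> that are killed by \<open>D j\<close> for all \<open>j\<close> in \<open>js\<close>.\<close>

definition P :: "nat list \<Rightarrow> int \<Rightarrow> 'v set" where
  "P js n = {v \<in> Fil n. \<forall>j\<in>set js. D j v \<in> Fil (n - d j - 1)}"

lemma P_subspace: "V.subspace (P js n)"
  by (rule V.subspaceI) (auto simp: P_def shift_add shift_scale Fil_rules shift_K K_Fil K_rules)

lemmas P_rules = V.subspace_0[OF P_subspace] V.subspace_add[OF P_subspace]
  V.subspace_diff[OF P_subspace] V.subspace_scale[OF P_subspace]

lemma K_P: "v \<in> K \<Longrightarrow> v \<in> P js n"
  by (auto simp: P_def K_Fil shift_K)

lemma P_Fil: "v \<in> P js n \<Longrightarrow> v \<in> Fil n" by (simp add: P_def)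

lemma P_prefix: "v \<in> P (js @ ks) n \<Longrightarrow> v \<in> P js n" by (simp add: P_def)

lemma order_split:
  assumes "order = js @ ks" "j \<in> set js" "k \<in> set ks"
  shows "j \<noteq> k" "d k \<le> d j"
  using assms order_distinct order_sorted by (auto simp: sorted_wrt_append)

text \<open>A variable that comes after \<open>js\<close> has at most the weight of those in \<open>js\<close>, so it commutes with their \<open>D j\<close> modulo lower terms.\<close>

lemma P_X:
  assumes "order = js @ ks" "k \<in> set ks" "v \<in> P js n"
  shows "X k v \<in> P js (n + d k)"
proof -
  have k: "k \<in> set order" using assms by auto
  have "D j (X k v) \<in> Fil (n + d k - d j - 1)" if j: "j \<in> set js" for j
  proof (rule Fil_diff_mem)
    have jk: "j \<in> set order" "j \<noteq> k" "d k \<le> d j" using order_split[OF assms(1) j assms(2)] j assms(1) by auto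
    show "D j (X k v) - sc (koszul_sign (par j) (par k)) (X k (D j v)) \<in> Fil (n + d k - d j - 1)"
      using D_X_commute[OF jk(1) k jk(3) P_Fil[OF assms(3)]] jk(2) by simp
    have "X k (D j v) \<in> Fil (n - d j - 1 + d k)" using X_Fil[of "D j v"] k assms(3) j by (auto simp: P_def)
    then show "sc (koszul_sign (par j) (par k)) (X k (D j v)) \<in> Fil (n + d k - d j - 1)"
      using Fil_rules(4) by (simp add: algebra_simps)
  qed
  then show ?thesis using X_Fil[OF P_Fil[OF assms(3)] k] by (simp add: P_def)
qed

lemma P_X_pow:
  assumes "order = js @ ks" "k \<in> set ks" "v \<in> P js n"
  shows "(X k ^^ r) v \<in> P js (n + int r * d k)"
proof (induction r)
  case (Suc r)
  then show ?case using P_X[OF assms(1,2), of "(X k ^^ r) v" "n + int r * d k"] by (simp add: algebra_simps)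
qed (simp add: assms(3))

lemma shift_P:
  assumes "v \<in> P js n" "1 \<le> e" "z \<in> gr (- e)" "\<And>i. i \<in> set order \<Longrightarrow> d i = e \<Longrightarrow> i \<in> set js"
  shows "shift z v \<in> Fil (n - e - 1)"
  by (rule shift_span[OF _ u_span[OF assms(2,3)] Fil_subspace])
     (use assms K_Fil in \<open>auto simp: P_def\<close>)

text \<open>The commutator \<open>[u j, u l]\<close> has weight \<open>d j + d l > d j\<close>, so it is a combination of basis elements that come
before \<open>j\<close> and hence belong to \<open>js\<close>.\<close>

lemma P_D:
  assumes o: "order = js @ ks" and l: "l \<in> set order" and v: "v \<in> P js n"
  shows "D l v \<in> P js (n - d l)"
proof -
  have "D j (D l v) \<in> Fil (n - d l - d j - 1)" if j: "j \<in> set js" for j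
  proof (rule Fil_diff_mem[OF K_Fil[OF D_D_commute[OF _ l]]])
    show jo: "j \<in> set order" using j o by simp
    have "D j v \<in> Fil (n - d j - 1)" using v j by (simp add: P_def)
    then have a: "D l (D j v) \<in> Fil (n - d l - d j - 1)" using Fil_D[of _ _ l] l by (force simp: algebra_simps)
    have z: "bracket L (u j) (u l) \<in> gr (- (d j + d l))"
      using gr_bracket[OF u_gr[OF jo] u_gr[OF l]] by (simp add: algebra_simps)
    have "shift (bracket L (u j) (u l)) v \<in> Fil (n - (d j + d l) - 1)"
    proof (rule shift_P[OF v _ z])
      show "1 \<le> d j + d l" using d_pos[OF jo] d_pos[OF l] by simp
      fix i assume i: "i \<in> set order" "d i = d j + d l"
      show "i \<in> set js"
      proof (rule ccontr)
        assume "i \<notin> set js"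
        then have "d i \<le> d j" using order_split(2)[OF o j, of i] i o by auto
        then show False using i d_pos[OF l] by simp
      qed
    qed
    then show "sc (koszul_sign (par j) (par l)) (D l (D j v)) + shift (bracket L (u j) (u l)) v \<in> Fil (n - d l - d j - 1)"
      using a Fil_rules by (simp add: algebra_simps)
  qed
  then show ?thesis using Fil_D[OF P_Fil[OF v] l] by (simp add: P_def)
qed

lemma P_D_pow:
  assumes "order = js @ ks" "l \<in> set order" "v \<in> P js n"
  shows "(D l ^^ r) v \<in> P js (n - int r * d l)"
proof (induction r)
  case (Suc r)
  then show ?case using P_D[OF assms(1,2), of "(D l ^^ r) v" "n - int r * d l"] by (simp add: algebra_simps)
qed (simp add: assms(3))

text \<open>Here \<open>2 (D k)\<^sup>2 = [u k, u k]\<close>, which again involves only indices before \<open>k\<close>.\<close>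

lemma D_odd_square:
  assumes o: "order = js @ k # ks" and odd: "par k = 1" and v: "v \<in> P js n"
  shows "D k (D k v) \<in> Fil (n - 2 * d k - 1)"
proof -
  have k: "k \<in> set order" using o by simp
  let ?z = "bracket L (u k) (u k)"
  have z: "?z \<in> gr (- (2 * d k))" using gr_bracket[OF u_gr[OF k] u_gr[OF k]] by (simp add: algebra_simps)
  have s: "shift ?z v \<in> Fil (n - 2 * d k - 1)"
  proof (rule shift_P[OF v _ z])
    show "1 \<le> 2 * d k" using d_pos[OF k] by simp
    fix i assume i: "i \<in> set order" "d i = 2 * d k"
    then have "d k < d i" using d_pos[OF k] by simp
    then show "i \<in> set js" using i order_sorted unfolding o by (auto simp: sorted_wrt_append)
  qed
  have "D k (D k v) - (sc (-1) (D k (D k v)) + shift ?z v) \<in> Fil (n - 2 * d k - 1)"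
    using K_Fil[OF D_D_commute[OF k k, of v]] odd by simp
  then have "D k (D k v) - (sc (-1) (D k (D k v)) + shift ?z v) + shift ?z v \<in> Fil (n - 2 * d k - 1)"
    using s Fil_rules by blast
  moreover have "D k (D k v) - (sc (-1) (D k (D k v)) + shift ?z v) + shift ?z v = sc 2 (D k (D k v))"
    using V.scale_left_distrib[of 1 1 "D k (D k v)"] by simp
  ultimately have "sc 2 (D k (D k v)) \<in> Fil (n - 2 * d k - 1)" by metis
  from Fil_rules(4)[OF this, of "1/2"] show ?thesis by simp
qed

text \<open>The Weyl relation \<open>D x\<^sup>R - x\<^sup>R D = R x\<^sup>R\<^sup>-\<^sup>1\<close>, applied to a class killed by \<open>D\<close>; for odd \<open>k\<close> the powers \<open>R \<le> 1\<close> suffice.\<close>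

lemma D_X_pow:
  assumes o: "order = js @ k # ks" and y: "y \<in> P (js @ [k]) n" and R: "par k = 1 \<longrightarrow> R \<le> 1"
  shows "D k ((X k ^^ R) y) - sc (of_nat R) ((X k ^^ (R - 1)) y) \<in> Fil (n + int R * d k - d k - 1)"
  using R
proof (induction R)
  case 0
  then show ?case using y by (simp add: P_def algebra_simps)
next
  case (Suc R)
  have k: "k \<in> set order" using o by simp
  let ?z = "(X k ^^ R) y" and ?s = "koszul_sign (par k) (par k)"
  let ?F = "Fil (n + int (Suc R) * d k - d k - 1)"
  have z: "?z \<in> Fil (n + int R * d k)" using Fil_X_pow[OF P_Fil[OF y] k] .
  have 1: "D k (X k ?z) - (sc ?s (X k (D k ?z)) + ?z) \<in> ?F"
    using D_X_commute[OF k k _ z] by (simp add: algebra_simps)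
  have "D k ?z - sc (of_nat R) ((X k ^^ (R - 1)) y) \<in> Fil (n + int R * d k - d k - 1)" using Suc by simp
  from X_Fil[OF this k]
  have 2: "X k (D k ?z) - sc (of_nat R) (X k ((X k ^^ (R - 1)) y)) \<in> ?F"
    by (simp add: act_diff act_scale algebra_simps)
  have 3: "sc ?s (X k (D k ?z)) - sc (of_nat R) ?z \<in> ?F"
  proof (cases R)
    case 0 then show ?thesis using 2 Fil_rules by simp
  next
    case (Suc R')
    then have "par k = 0" using Suc.prems by (cases "par k") auto
    then show ?thesis using 2 Suc by simp
  qed
  have eq: "D k ((X k ^^ Suc R) y) - sc (of_nat (Suc R)) ((X k ^^ (Suc R - 1)) y) =
    (D k (X k ?z) - (sc ?s (X k (D k ?z)) + ?z)) + (sc ?s (X k (D k ?z)) - sc (of_nat R) ?z)"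
    by (simp add: V.scale_left_distrib algebra_simps)
  show ?case unfolding eq by (rule Fil_rules(2)[OF 1 3])
qed

lemma D_pow_X_pow:
  assumes o: "order = js @ k # ks" and y: "y \<in> P (js @ [k]) n" and R: "par k = 1 \<longrightarrow> R \<le> 1"
  shows "(D k ^^ R) ((X k ^^ R) y) - sc (fact R) y \<in> Fil (n - 1)"
  using R
proof (induction R)
  case 0 then show ?case by (simp add: Fil_rules)
next
  case (Suc R)
  have k: "k \<in> set order" using o by simp
  let ?e = "D k ((X k ^^ Suc R) y) - sc (of_nat (Suc R)) ((X k ^^ R) y)"
  have "?e \<in> Fil (n + int R * d k - 1)"
    using D_X_pow[OF o y Suc.prems] by (simp add: algebra_simps)
  from Fil_D_pow[OF this k, of R] have 1: "(D k ^^ R) ?e \<in> Fil (n - 1)" by (simp add: algebra_simps)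
  have 2: "(D k ^^ R) ((X k ^^ R) y) - sc (fact R) y \<in> Fil (n - 1)" using Suc by simp
  have eq: "(D k ^^ Suc R) ((X k ^^ Suc R) y) - sc (fact (Suc R)) y =
    (D k ^^ R) ?e + sc (of_nat (Suc R)) ((D k ^^ R) ((X k ^^ R) y) - sc (fact R) y)"
    unfolding D_pow_diff D_pow_scale
    by (simp add: funpow_swap1 V.scale_right_diff_distrib del: of_nat_Suc)
  show ?case unfolding eq by (rule Fil_rules(2)[OF 1 Fil_rules(4)[OF 2]])
qed

lemma D_pow_X_pow_less:
  assumes o: "order = js @ k # ks" and y: "y \<in> P (js @ [k]) n" and R: "par k = 1 \<longrightarrow> R \<le> 1" and S: "R < S"
  shows "(D k ^^ S) ((X k ^^ R) y) \<in> Fil (n + (int R - int S) * d k - 1)"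
proof -
  have k: "k \<in> set order" using o by simp
  let ?w = "(D k ^^ R) ((X k ^^ R) y)"
  have "D k (?w - sc (fact R) y) \<in> Fil (n - 1 - d k)"
    using Fil_D[OF D_pow_X_pow[OF o y R] k] .
  moreover have "sc (fact R) (D k y) \<in> Fil (n - 1 - d k)" using y Fil_rules by (simp add: P_def algebra_simps)
  ultimately have "D k ?w \<in> Fil (n - 1 - d k)"
    using Fil_diff_mem by (simp add: shift_diff shift_scale)
  from Fil_D_pow[OF this k, of "S - Suc R"]
  have "(D k ^^ (S - Suc R)) (D k ?w) \<in> Fil (n + (int R - int S) * d k - 1)"
    using S by (simp add: of_nat_diff algebra_simps)
  moreover have "(D k ^^ (S - Suc R)) (D k ?w) = (D k ^^ (S - Suc R + Suc R)) ((X k ^^ R) y)"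
    unfolding funpow_add by simp
  ultimately show ?thesis using S by simp
qed

section \<open>Ordered monomials\<close>

text \<open>Polynomials of degree at most \<open>R\<close> in \<open>x k\<close> with coefficients in \<open>F\<close>.  The summand of degree \<open>R\<close> is split
off last, so that applying \<open>(D k)\<^sup>R\<close> isolates its coefficient.\<close>

fun tower :: "nat \<Rightarrow> (int \<Rightarrow> 'v set) \<Rightarrow> nat \<Rightarrow> int \<Rightarrow> 'v set" where
  "tower k F 0 n = F n"
| "tower k F (Suc R) n = {z + (X k ^^ Suc R) y | z y. z \<in> tower k F R n \<and> y \<in> F (n - int (Suc R) * d k)}"

text \<open>For even \<open>k\<close> a power of \<open>x k\<close> beyond the total weight \<open>n\<close> cannot occur, because \<open>d k \<ge> 1\<close>.\<close>

definition rmax :: "nat \<Rightarrow> int \<Rightarrow> nat" where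
  "rmax k n = (if par k = 1 then 1 else nat n)"

text \<open>Combinations of ordered monomials of weight \<open>n\<close> in the variables \<open>ks\<close>, applied to Whittaker vectors.  All
these spaces contain \<open>K\<close>.\<close>

fun ordf :: "nat list \<Rightarrow> int \<Rightarrow> 'v set" where
  "ordf [] n = (if n = 0 then Fil 0 else K)"
| "ordf (k # ks) n = tower k (ordf ks) (rmax k n) n"

lemma tower_subspace:
  assumes "\<And>n. V.subspace (F n)"
  shows "V.subspace (tower k F R n)"
proof (induction R)
  case 0 then show ?case using assms by simp
next
  case (Suc R)
  note a = V.subspace_0 V.subspace_add V.subspace_scale
  show ?case
  proof (rule V.subspaceI)
    have "0 = 0 + (X k ^^ Suc R) 0" unfolding X_pow_0 by simp
    then show "0 \<in> tower k F (Suc R) n" using a(1)[OF Suc] a(1)[OF assms] by (simp only: tower.simps) blast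
  next
    fix v w assume "v \<in> tower k F (Suc R) n" "w \<in> tower k F (Suc R) n"
    then obtain z y z' y' where *: "v = z + (X k ^^ Suc R) y" "w = z' + (X k ^^ Suc R) y'"
      "z \<in> tower k F R n" "z' \<in> tower k F R n"
      "y \<in> F (n - int (Suc R) * d k)" "y' \<in> F (n - int (Suc R) * d k)"
      by (simp only: tower.simps) blast
    have "v + w = (z + z') + (X k ^^ Suc R) (y + y')"
      unfolding * X_pow_add by (simp add: algebra_simps)
    then show "v + w \<in> tower k F (Suc R) n" using a(2)[OF Suc *(3,4)] a(2)[OF assms *(5,6)]
      by (simp only: tower.simps) blast
  next
    fix c v assume "v \<in> tower k F (Suc R) n"
    then obtain z y where *: "v = z + (X k ^^ Suc R) y"
      "z \<in> tower k F R n" "y \<in> F (n - int (Suc R) * d k)"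
      by (simp only: tower.simps) blast
    have "sc c v = sc c z + (X k ^^ Suc R) (sc c y)"
      unfolding * X_pow_scale V.scale_right_distrib by simp
    then show "sc c v \<in> tower k F (Suc R) n" using a(3)[OF Suc *(2)] a(3)[OF assms *(3)]
      by (simp only: tower.simps) blast
  qed
qed

lemma ordf_subspace: "V.subspace (ordf ks n)"
  by (induction ks arbitrary: n) (auto intro: tower_subspace simp: Fil_subspace K_subspace)

lemma tower_mem_le: "\<lbrakk>\<And>n. V.subspace (F n); z \<in> tower k F R n; R \<le> S\<rbrakk> \<Longrightarrow> z \<in> tower k F S n"
proof (induction S)
  case (Suc S)
  have "z = z + (X k ^^ Suc S) 0" unfolding X_pow_0 by simp
  then have "z \<in> tower k F (Suc S) n" if "z \<in> tower k F S n"
    using that V.subspace_0[OF Suc.prems(1)] by (simp only: tower.simps) blast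
  then show ?case using Suc by (cases "R = Suc S") auto
qed simp

lemma ordf_P: "order = js @ ks \<Longrightarrow> z \<in> ordf ks n \<Longrightarrow> z \<in> P js n"
proof (induction ks arbitrary: js n z)
  case Nil
  show ?case
  proof (cases "z \<in> K")
    case False
    then have z: "n = 0" "z \<in> Fil 0" using Nil(2) by (auto split: if_splits)
    have "D j z \<in> Fil (- d j - 1)" if "j \<in> set order" for j
      using Fil_D[OF z(2) that] Fil_neg[of "- d j"] d_pos[OF that] K_Fil by auto
    then have "\<forall>j\<in>set js. D j z \<in> Fil (- d j - 1)" using arg_cong[OF Nil(1), of set] by simp
    then show ?thesis unfolding z(1) using z(2) by (simp add: P_def)
  qed (rule K_P)
next
  case (Cons k ks)
  have IH: "z \<in> P js n" if "z \<in> ordf ks n" for z n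
  proof (rule P_prefix)
    show "z \<in> P (js @ [k]) n" by (rule Cons.IH) (use Cons.prems(1) that in auto)
  qed
  have "z \<in> P js n" if "z \<in> tower k (ordf ks) R n" for R z
    using that
  proof (induction R arbitrary: z)
    case (Suc R)
    then obtain z' y where *: "z = z' + (X k ^^ Suc R) y"
      "z' \<in> tower k (ordf ks) R n" "y \<in> ordf ks (n - int (Suc R) * d k)"
      by (simp only: tower.simps) blast
    have "(X k ^^ Suc R) y \<in> P js n"
      using P_X_pow[OF Cons.prems(1) _ IH[OF *(3)], of k "Suc R"] by (simp del: funpow.simps)
    then show ?case unfolding *(1) using Suc.IH *(2) P_rules by blast
  qed (simp add: IH)
  from this[of z "rmax k n"] Cons.prems(2) show ?case by simp
qed

text \<open>A polynomial in \<open>x k\<close> that vanishes modulo lower terms has vanishing coefficients: \<open>(D k)\<^sup>R\<close> turns the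
leading term into \<open>R!\<close> times its coefficient and kills the terms of smaller degree.  The coefficients are
treated by induction on the list.\<close>

theorem ordf_independent: "order = js @ ks \<Longrightarrow> z \<in> ordf ks n \<Longrightarrow> z \<in> Fil (n - 1) \<Longrightarrow> z \<in> K"
proof (induction ks arbitrary: js n z)
  case Nil
  from Nil(2,3) show ?case using Fil_neg[of "-1"] by (cases "n = 0") simp_all
next
  case (Cons k ks)
  note o = Cons.prems(1)
  have k: "k \<in> set order" using o by simp
  have o': "order = (js @ [k]) @ ks" using o by simp
  have low: "(D k ^^ S) z \<in> Fil (n - int S * d k - 1)"
    if "z \<in> tower k (ordf ks) R n" "R < S" "par k = 1 \<longrightarrow> R \<le> 1" for R S z
    using that
  proof (induction R arbitrary: z)
    case 0
    then show ?case using D_pow_X_pow_less[OF o ordf_P[OF o'], of z n 0 S] by (simp add: algebra_simps)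
  next
    case (Suc R)
    then obtain z' y where *: "z = z' + (X k ^^ Suc R) y"
      "z' \<in> tower k (ordf ks) R n" "y \<in> ordf ks (n - int (Suc R) * d k)"
      by (simp only: tower.simps) blast
    have "(D k ^^ S) ((X k ^^ Suc R) y) \<in> Fil (n - int S * d k - 1)"
      using D_pow_X_pow_less[OF o ordf_P[OF o' *(3)] Suc.prems(3,2)] by (simp add: algebra_simps)
    then show ?case unfolding *(1) D_pow_add using Suc.IH[OF *(2)] Suc.prems Fil_rules by simp
  qed
  have "z \<in> K" if "z \<in> tower k (ordf ks) R n" "z \<in> Fil (n - 1)" "par k = 1 \<longrightarrow> R \<le> 1" for R z
    using that
  proof (induction R arbitrary: z)
    case 0 then show ?case using Cons.IH[OF o'] by simp
  next
    case (Suc R)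
    let ?n = "n - int (Suc R) * d k"
    obtain z' y where *: "z = z' + (X k ^^ Suc R) y"
      "z' \<in> tower k (ordf ks) R n" "y \<in> ordf ks ?n"
      using Suc.prems(1) by (simp only: tower.simps) blast
    have a: "(D k ^^ Suc R) z' \<in> Fil (?n - 1)"
      using low[OF *(2), of "Suc R"] Suc.prems(3) by simp
    have b: "(D k ^^ Suc R) z \<in> Fil (?n - 1)"
      using Fil_D_pow[OF Suc.prems(2) k, of "Suc R"] by (simp add: algebra_simps del: funpow.simps)
    have c: "(D k ^^ Suc R) ((X k ^^ Suc R) y) - sc (fact (Suc R)) y \<in> Fil (?n - 1)"
      by (rule D_pow_X_pow[OF o ordf_P[OF o' *(3)] Suc.prems(3)])
    have eq: "sc (fact (Suc R)) y = (D k ^^ Suc R) z - (D k ^^ Suc R) z'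
        - ((D k ^^ Suc R) ((X k ^^ Suc R) y) - sc (fact (Suc R)) y)"
      unfolding *(1) D_pow_add by simp
    have "sc (fact (Suc R)) y \<in> Fil (?n - 1)"
      by (subst eq) (rule Fil_rules(3)[OF Fil_rules(3)[OF b a] c])
    from Fil_rules(4)[OF this, of "1 / fact (Suc R)"] have "y \<in> Fil (?n - 1)" by (simp del: fact_Suc)
    then have y: "y \<in> K" using Cons.IH[OF o' *(3)] by blast
    then have Xy: "(X k ^^ Suc R) y \<in> K" by (rule X_pow_K)
    have "z' = z - (X k ^^ Suc R) y" unfolding *(1) by simp
    then have "z' \<in> Fil (n - 1)" using Fil_rules(3)[OF Suc.prems(2) K_Fil[OF Xy]] by simp
    then have "z' \<in> K" using Suc.IH *(2) Suc.prems(3) by simp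
    then show ?case unfolding *(1) using Xy K_rules by blast
  qed
  from this[of z "rmax k n"] Cons.prems(2,3) show ?case by (simp add: rmax_def)
qed

text \<open>If \<open>(D k)\<^sup>R\<^sup>+\<^sup>1\<close> kills the class of \<open>v\<close>, then subtracting \<open>x\<^sup>R y\<close> with \<open>y = (D k)\<^sup>R v / R!\<close> leaves a class killed by
\<open>(D k)\<^sup>R\<close>, and the class of \<open>y\<close> is killed by \<open>D k\<close>.  The process starts because \<open>D k\<close> lowers the weight,
or by \<open>D_odd_square\<close>.\<close>

theorem ordf_exhausts: "order = js @ ks \<Longrightarrow> v \<in> P js n \<Longrightarrow> \<exists>z\<in>ordf ks n. v - z \<in> Fil (n - 1)"
proof (induction ks arbitrary: js n v)
  case Nil
  show ?case
  proof (cases "0 < n")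
    case True
    have "v \<in> Fil (n - 1)"
    proof (rule Fil_I)
      fix i assume "i \<in> set order"
      then have "i \<in> set js" using arg_cong[OF Nil(1), of set] by simp
      with Nil(2) show "D i v \<in> Fil (n - 1 - d i)" by (auto simp: P_def algebra_simps)
    qed (use True in simp)
    then show ?thesis using True K_rules by (intro bexI[of _ 0]) auto
  next
    case False
    then have "v \<in> ordf [] n" using P_Fil[OF Nil(2)] Fil_neg[of n] by auto
    then show ?thesis using Fil_rules by (intro bexI[of _ v]) auto
  qed
next
  case (Cons k ks)
  note o = Cons.prems(1)
  have k: "k \<in> set order" using o by simp
  have o': "order = (js @ [k]) @ ks" using o by simp
  have "\<exists>z\<in>tower k (ordf ks) R n. v - z \<in> Fil (n - 1)"
    if "v \<in> P js n" "(D k ^^ Suc R) v \<in> Fil (n - int (Suc R) * d k - 1)" "par k = 1 \<longrightarrow> R \<le> 1" for R v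
    using that
  proof (induction R arbitrary: v)
    case 0
    then have "v \<in> P (js @ [k]) n" by (auto simp: P_def)
    then show ?case using Cons.IH[OF o'] by simp
  next
    case (Suc R)
    let ?n = "n - int (Suc R) * d k"
    define y0 where "y0 = sc (1 / fact (Suc R)) ((D k ^^ Suc R) v)"
    have 1: "y0 \<in> P js ?n" unfolding y0_def by (rule P_rules(4)[OF P_D_pow[OF o k Suc.prems(1)]])
    have "D k y0 \<in> Fil (?n - d k - 1)"
      using Fil_rules(4)[OF Suc.prems(2), of "1 / fact (Suc R)"] by (simp add: y0_def shift_scale algebra_simps)
    then have y0: "y0 \<in> P (js @ [k]) ?n" using 1 by (auto simp: P_def)
    \<comment> \<open>The coefficient itself is only determined modulo lower terms, which \<open>x\<^sup>R\<^sup>+\<^sup>1\<close> keeps in \<open>Fil (n - 1)\<close>.\<close>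
    obtain y where y: "y \<in> ordf ks ?n" "y0 - y \<in> Fil (?n - 1)" using Cons.IH[OF o' y0] by blast
    let ?v = "v - (X k ^^ Suc R) y0"
    have 2: "(X k ^^ Suc R) y0 \<in> P js n" using P_X_pow[OF o _ 1, of k "Suc R"] by (simp del: funpow.simps)
    have 3: "?v \<in> P js n" using P_rules(3)[OF Suc.prems(1) 2] .
    have eq: "(D k ^^ Suc R) ?v = - ((D k ^^ Suc R) ((X k ^^ Suc R) y0) - sc (fact (Suc R)) y0)"
      unfolding D_pow_diff by (simp add: y0_def del: fact_Suc)
    have "(D k ^^ Suc R) ?v \<in> Fil (?n - 1)"
      unfolding eq by (rule Fil_rules(5)[OF D_pow_X_pow[OF o y0 Suc.prems(3)]])
    then obtain z where z: "z \<in> tower k (ordf ks) R n" "?v - z \<in> Fil (n - 1)"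
      using Suc.IH[OF 3] Suc.prems(3) by auto
    have "z + (X k ^^ Suc R) y \<in> tower k (ordf ks) (Suc R) n" using z(1) y(1) by (simp only: tower.simps) blast
    moreover have "v - (z + (X k ^^ Suc R) y) = (?v - z) + (X k ^^ Suc R) (y0 - y)"
      using X_pow_add[where i = k and r = "Suc R" and v = "y0 - y" and w = y] by (simp del: funpow.simps)
    moreover have "(X k ^^ Suc R) (y0 - y) \<in> Fil (n - 1)"
      using Fil_X_pow[OF y(2) k, of "Suc R"] by (simp del: funpow.simps)
    ultimately show ?case using Fil_rules(2)[OF z(2)] by metis
  qed
  moreover have "(D k ^^ Suc (rmax k n)) v \<in> Fil (n - int (Suc (rmax k n)) * d k - 1)"
  proof (cases "par k = 1")
    case True
    then show ?thesis using D_odd_square[OF o True Cons.prems(2)] by (simp add: rmax_def)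
  next
    case False
    have "n < int (Suc (nat n)) * 1" by simp
    also have "\<dots> \<le> int (Suc (nat n)) * d k" using d_pos[OF k] by (intro mult_left_mono) auto
    finally have neg: "n - int (Suc (nat n)) * d k < 0" by simp
    show ?thesis using Fil_D_pow[OF P_Fil[OF Cons.prems(2)] k, of "Suc (nat n)"]
        Fil_neg[OF neg] False K_Fil by (simp add: rmax_def del: funpow.simps)
  qed
  ultimately show ?case using Cons.prems(2) by (simp add: rmax_def)
qed

end

text \<open>The exponents of ordered monomials, as words in the indices.\<close>

fun ordered_words :: "(nat \<Rightarrow> bit) \<Rightarrow> nat list \<Rightarrow> nat list set" where
  "ordered_words p [] = {[]}"
| "ordered_words p (k # ks) =
     {replicate r k @ w | r w. w \<in> ordered_words p ks \<and> (p k = 1 \<longrightarrow> r \<le> 1)}"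

lemma ordered_words_set: "w \<in> ordered_words p ks \<Longrightarrow> set w \<subseteq> set ks"
  by (induction ks arbitrary: w) (fastforce split: if_splits)+

context action_mod begin

lemma foldr_X_replicate: "foldr X (replicate r k @ w) v = (X k ^^ r) (foldr X w v)"
  by (induction r) auto

lemma span_map:
  assumes "\<And>v w. f (v + w) = f v + f w" "\<And>c v. f (sc c v) = sc c (f v)"
    and "\<And>v. v \<in> S \<Longrightarrow> f v \<in> V.span T" and "y \<in> V.span S"
  shows "f y \<in> V.span T"
proof -
  have "V.subspace {v. f v \<in> V.span T}"
    using assms(1,2)[of 0 0] assms(2)[of 0 0]
    by (intro V.subspaceI) (auto simp: assms V.span_add V.span_scale V.span_zero)
  from V.span_subspace_induct[OF assms(4) this] assms(3) show ?thesis by auto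
qed

lemma ordf_span:
  "set ks \<subseteq> set order \<Longrightarrow> z \<in> ordf ks n \<Longrightarrow>
    z \<in> V.span (K \<union> {foldr X w v | w v. w \<in> ordered_words par ks \<and> wt w = n \<and> v \<in> Fil 0})"
proof (induction ks arbitrary: n z)
  case Nil
  then show ?case by (intro V.span_base) (auto split: if_splits)
next
  case (Cons k ks)
  let ?T = "\<lambda>ks n. K \<union> {foldr X w v | w v. w \<in> ordered_words par ks \<and> wt w = n \<and> v \<in> Fil 0}"
  have pow: "(X k ^^ R) y \<in> V.span (?T (k # ks) n)"
    if "y \<in> ordf ks (n - int R * d k)" "par k = 1 \<longrightarrow> R \<le> 1" for R y
  proof (rule span_map[OF X_pow_add X_pow_scale _ Cons.IH[OF _ that(1)]])
    fix v assume "v \<in> ?T ks (n - int R * d k)"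
    then consider "v \<in> K" | w v' where "v = foldr X w v'" "w \<in> ordered_words par ks"
      "wt w = n - int R * d k" "v' \<in> Fil 0" by blast
    then show "(X k ^^ R) v \<in> V.span (?T (k # ks) n)"
    proof cases
      case 1 then show ?thesis by (intro V.span_base) (simp add: X_pow_K)
    next
      case 2
      have "(X k ^^ R) v = foldr X (replicate R k @ w) v'" unfolding 2(1) foldr_X_replicate ..
      moreover have "replicate R k @ w \<in> ordered_words par (k # ks)" using 2 that(2) by auto
      moreover have "wt (replicate R k @ w) = n" using 2 by simp
      ultimately show ?thesis using 2(4) by (intro V.span_base) blast
    qed
  qed (use Cons.prems in auto)
  have "z \<in> V.span (?T (k # ks) n)" if "z \<in> tower k (ordf ks) R n" "par k = 1 \<longrightarrow> R \<le> 1" for R z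
    using that
  proof (induction R arbitrary: z)
    case 0 then show ?case using pow[of z 0] by simp
  next
    case (Suc R)
    then obtain z' y where *: "z = z' + (X k ^^ Suc R) y"
      "z' \<in> tower k (ordf ks) R n" "y \<in> ordf ks (n - int (Suc R) * d k)"
      by (simp only: tower.simps) blast
    show ?case unfolding *(1) using Suc.IH[OF *(2)] Suc.prems(2) pow[OF *(3)] by (intro V.span_add) auto
  qed
  from this[of z "rmax k n"] Cons.prems(2) show ?case by (simp add: rmax_def)
qed

lemma ordf_word:
  "set ks \<subseteq> set order \<Longrightarrow> w \<in> ordered_words par ks \<Longrightarrow> v \<in> Fil 0 \<Longrightarrow> foldr X w v \<in> ordf ks (wt w)"
proof (induction ks arbitrary: w)
  case (Cons k ks)
  then obtain r w' where w: "w = replicate r k @ w'" "w' \<in> ordered_words par ks" "par k = 1 \<longrightarrow> r \<le> 1"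
    by auto
  have IH: "foldr X w' v \<in> ordf ks (wt w')" using Cons.IH[OF _ w(2) Cons.prems(3)] Cons.prems(1) by simp
  have w'o: "w' \<in> lists (set order)" using ordered_words_set[OF w(2)] Cons.prems(1) by auto
  have r: "r \<le> rmax k (wt w)"
  proof (cases "par k = 1")
    case False
    have "int r * 1 \<le> int r * d k" using d_pos[of k] Cons.prems(1) by (intro mult_left_mono) auto
    then have "int r \<le> wt w" using wt_nonneg[OF w'o] w(1) by simp
    then show ?thesis using False by (simp add: rmax_def)
  qed (use w in \<open>simp add: rmax_def\<close>)
  have "foldr X w v \<in> tower k (ordf ks) r (wt w)"
  proof (cases r)
    case 0 then show ?thesis using IH w by simp
  next
    case (Suc r')
    have "0 \<in> tower k (ordf ks) r' (wt w)" by (rule V.subspace_0[OF tower_subspace[OF ordf_subspace]])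
    moreover have "foldr X w v = 0 + (X k ^^ Suc r') (foldr X w' v)"
      unfolding w(1) foldr_X_replicate Suc by simp
    moreover have "foldr X w' v \<in> ordf ks (wt w - int (Suc r') * d k)"
    proof -
      have "wt w - int (Suc r') * d k = wt w'" unfolding w(1) Suc by (simp add: algebra_simps)
      then show ?thesis using IH by simp
    qed
    ultimately show ?thesis unfolding Suc by (simp only: tower.simps) blast
  qed
  from tower_mem_le[OF ordf_subspace this r] show ?case by simp
qed simp

text \<open>The space \<open>M\<^sub>+\<close> on the level of representatives.\<close>

definition positive_part :: "'v set" where
  "positive_part = V.span (K \<union> {foldr X w v | w v. w \<in> ordered_words par order \<and> w \<noteq> [] \<and> v \<in> Fil 0})"

theorem Whittaker_decomposition:
  assumes "v \<in> Fil n"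
  shows "\<exists>w\<in>Fil 0. v - w \<in> positive_part"
  using assms
proof (induction "nat n" arbitrary: n v)
  case 0
  then have "v \<in> Fil 0" using Fil_mono[of v n 0] by simp
  then show ?case by (intro bexI[of _ v]) (auto simp: positive_part_def V.span_zero)
next
  case (Suc N)
  have "v \<in> P [] n" using Suc.prems by (simp add: P_def)
  then obtain z where z: "z \<in> ordf order n" "v - z \<in> Fil (n - 1)"
    using ordf_exhausts[of "[]" order] by auto
  have zp: "z \<in> positive_part"
  proof -
    have "K \<union> {foldr X w v | w v. w \<in> ordered_words par order \<and> wt w = n \<and> v \<in> Fil 0}
      \<subseteq> K \<union> {foldr X w v | w v. w \<in> ordered_words par order \<and> w \<noteq> [] \<and> v \<in> Fil 0}"
      using Suc.hyps(2) by fastforce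
    then show ?thesis unfolding positive_part_def using ordf_span[OF _ z(1)] V.span_mono by blast
  qed
  obtain w where w: "w \<in> Fil 0" "v - z - w \<in> positive_part"
  proof -
    have "N = nat (n - 1)" using Suc.hyps(2) by simp
    from Suc.hyps(1)[OF this z(2)] that show ?thesis by blast
  qed
  have "v - w = (v - z - w) + z" by simp
  then have "v - w \<in> positive_part" using V.span_add[OF w(2)[unfolded positive_part_def] zp[unfolded positive_part_def]]
    unfolding positive_part_def by simp
  then show ?case using w(1) by blast
qed

text \<open>Sums of components of weights \<open>1, \<dots>, n\<close>, which make the top weight of an element of \<open>positive_part\<close> accessible.\<close>

fun psum :: "nat \<Rightarrow> 'v set" where
  "psum 0 = K"
| "psum (Suc n) = {a + b | a b. a \<in> psum n \<and> b \<in> ordf order (int (Suc n))}"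

lemma psum_subspace: "V.subspace (psum n)"
proof (induction n)
  case (Suc n)
  note B = ordf_subspace[of order "int (Suc n)"]
  have "psum (Suc n) = {a + b | a b. a \<in> psum n \<and> b \<in> ordf order (int (Suc n))}" by (rule psum.simps)
  also have "V.subspace \<dots>" by (rule V.subspace_sums[OF Suc B])
  finally show ?case .
qed (simp add: K_subspace)

lemma psum_mono: "a \<in> psum n \<Longrightarrow> n \<le> N \<Longrightarrow> a \<in> psum N"
proof (induction N)
  case (Suc N)
  have "a \<in> psum (Suc N)" if "a \<in> psum N"
    using that V.subspace_0[OF ordf_subspace, of order "int (Suc N)"]
    by (simp only: psum.simps) (metis (mono_tags, lifting) add.right_neutral mem_Collect_eq)
  then show ?case using Suc by (cases "n = Suc N") auto
qed simp

lemma ordf_psum: "b \<in> ordf order (int (Suc n)) \<Longrightarrow> b \<in> psum (Suc n)"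
  using V.subspace_0[OF psum_subspace, of n]
  by (simp only: psum.simps) (metis (mono_tags, lifting) add.left_neutral mem_Collect_eq)

lemma psum_Fil: "a \<in> psum n \<Longrightarrow> a \<in> Fil (int n)"
proof (induction n arbitrary: a)
  case (Suc n)
  then obtain b c where "a = b + c" "b \<in> psum n" "c \<in> ordf order (int (Suc n))"
    by (simp only: psum.simps) blast
  then show ?case
    using Fil_rules(2)[OF Fil_mono[OF Suc.IH] P_Fil[OF ordf_P[of "[]" order c "int (Suc n)"]], of b] by simp
qed (simp add: K_Fil)

lemma positive_psum: "z \<in> positive_part \<Longrightarrow> \<exists>n. z \<in> psum n"
proof -
  have sub: "V.subspace {z. \<exists>n. z \<in> psum n}"
  proof (rule V.subspaceI)
    show "0 \<in> {z. \<exists>n. z \<in> psum n}" using V.subspace_0[OF psum_subspace] by auto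
    fix y z assume "y \<in> {z. \<exists>n. z \<in> psum n}" "z \<in> {z. \<exists>n. z \<in> psum n}"
    then obtain a b where "y \<in> psum a" "z \<in> psum b" by auto
    then have "y + z \<in> psum (max a b)"
      using psum_mono[of _ _ "max a b"] V.subspace_add[OF psum_subspace] by auto
    then show "y + z \<in> {z. \<exists>n. z \<in> psum n}" by auto
  next
    fix c y assume "y \<in> {z. \<exists>n. z \<in> psum n}"
    then show "sc c y \<in> {z. \<exists>n. z \<in> psum n}" using V.subspace_scale[OF psum_subspace] by auto
  qed
  have gen: "g \<in> {z. \<exists>n. z \<in> psum n}"
    if "g \<in> K \<union> {foldr X w v | w v. w \<in> ordered_words par order \<and> w \<noteq> [] \<and> v \<in> Fil 0}" for g
    using that
  proof
    assume "g \<in> K" then have "g \<in> psum 0" by simp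
    then show ?thesis by blast
  next
    assume "g \<in> {foldr X w v | w v. w \<in> ordered_words par order \<and> w \<noteq> [] \<and> v \<in> Fil 0}"
    then obtain w v where w: "g = foldr X w v" "w \<in> ordered_words par order" "w \<noteq> []" "v \<in> Fil 0" by blast
    have "int (length w) \<le> wt w" using wt_ge_length[of w] ordered_words_set[OF w(2)] by auto
    then have "wt w = int (Suc (nat (wt w) - 1))" using w(3) by (cases w) auto
    then have "g \<in> psum (Suc (nat (wt w) - 1))"
      using ordf_psum ordf_word[OF subset_refl w(2,4)] w(1) by metis
    then show ?thesis by blast
  qed
  assume "z \<in> positive_part"
  from V.span_subspace_induct[OF this[unfolded positive_part_def] sub gen] show ?thesis by simp
qed

text \<open>A Whittaker vector lies in step \<open>0\<close>, so the component of highest positive weight is zero by \<open>ordf_independent\<close>.\<close>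

theorem Whittaker_positive_disjoint:
  assumes "v \<in> Fil 0" "v \<in> positive_part"
  shows "v \<in> K"
proof -
  have "v \<in> K" if "v \<in> psum n" "v \<in> Fil 0" for n v
    using that
  proof (induction n arbitrary: v)
    case (Suc n)
    then obtain a b where *: "v = a + b" "a \<in> psum n" "b \<in> ordf order (int (Suc n))"
      by (simp only: psum.simps) blast
    have "b = v - a" using *(1) by simp
    moreover have "v \<in> Fil (int n)" using Fil_mono[OF Suc.prems(2)] by simp
    ultimately have "b \<in> Fil (int (Suc n) - 1)"
      using Fil_rules(3)[OF _ psum_Fil[OF *(2)]] by simp
    then have b: "b \<in> K" using ordf_independent[of "[]" order b] *(3) by simp
    then have "a \<in> Fil 0" using Fil_rules(3)[OF Suc.prems(2) K_Fil[OF b]] *(1) by simp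
    then have "a \<in> K" using Suc.IH *(2) by blast
    then show ?case using b *(1) K_rules by simp
  qed simp
  then show ?thesis using positive_psum assms by blast
qed

text \<open>A nonzero class in the lowest step of the filtration that \<open>Z\<close> meets is a Whittaker vector.\<close>

lemma subrep_meets_Whittaker:
  assumes "V.subspace Z" "\<And>i v. i \<in> set order \<Longrightarrow> v \<in> Z \<Longrightarrow> D i v \<in> Z" "\<And>v. v \<in> Z \<Longrightarrow> v \<in> Fil 0 \<Longrightarrow> v \<in> K"
    and "v \<in> Z" "v \<in> Fil n"
  shows "v \<in> K"
  using assms(4,5)
proof (induction "nat (n + 1)" arbitrary: v n rule: less_induct)
  case less
  show ?case
  proof (cases "n < 0")
    case True then show ?thesis using less.prems Fil_neg by simp
  next
    case False
    have "D i v \<in> Fil (0 - d i)" if i: "i \<in> set order" for i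
      using less.hyps[OF _ assms(2)[OF i less.prems(1)] Fil_D[OF less.prems(2) i]] d_pos[OF i] False K_Fil by auto
    then have "v \<in> Fil 0" using Fil_I[of 0 v] by auto
    then show ?thesis using assms(3) less.prems(1) by blast
  qed
qed

lemma Fil_union_subspace: "V.subspace {v. \<exists>n. v \<in> Fil n}"
proof (rule V.subspaceI)
  show "0 \<in> {v. \<exists>n. v \<in> Fil n}" using Fil_rules by auto
  fix y z assume "y \<in> {v. \<exists>n. v \<in> Fil n}" "z \<in> {v. \<exists>n. v \<in> Fil n}"
  then obtain a b where "y \<in> Fil a" "z \<in> Fil b" by auto
  then have "y + z \<in> Fil (max a b)" using Fil_mono[of _ _ "max a b"] Fil_rules(2) by auto
  then show "y + z \<in> {v. \<exists>n. v \<in> Fil n}" by auto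
next
  fix c y assume "y \<in> {v. \<exists>n. v \<in> Fil n}"
  then show "sc c y \<in> {v. \<exists>n. v \<in> Fil n}" using Fil_rules(4) by auto
qed

text \<open>Every element of \<open>\<aa>\<close> is a finite sum of homogeneous elements.\<close>

lemma Fil_union_act:
  assumes "v \<in> Fil n"
  shows "\<exists>n. act y v \<in> Fil n"
proof -
  obtain c where c: "\<forall>k. c k \<in> gr k" "finite {k. c k \<noteq> 0}" "y = (\<Sum>k\<in>{k. c k \<noteq> 0}. c k)"
    using gr_decomposition[of y] by blast
  have "\<exists>n. act (\<Sum>k\<in>A. c k) v \<in> Fil n" if "finite A" for A
    using that
  proof (induction A)
    case empty
    show ?case using K_Fil[OF act_zero_left] by auto
  next
    case (insert k A)
    have "act (c k) v \<in> {v. \<exists>n. v \<in> Fil n}" using act_gr[OF _ assms] c(1) by blast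
    moreover have "act (\<Sum>k\<in>A. c k) v \<in> {v. \<exists>n. v \<in> Fil n}" using insert by simp
    moreover have "act (c k + (\<Sum>k\<in>A. c k)) v - (act (c k) v + act (\<Sum>k\<in>A. c k) v) \<in> {v. \<exists>n. v \<in> Fil n}"
      using K_Fil[OF act_add_left] by auto
    ultimately have "act (c k + (\<Sum>k\<in>A. c k)) v \<in> {v. \<exists>n. v \<in> Fil n}"
      using Fil_union_subspace V.subspace_add subspace_diff_mem by blast
    then show ?case using insert by simp
  qed
  then show ?thesis using c by auto
qed

lemma shift_nilpotent:
  assumes "v \<in> Fil (int n)" "z \<in> \<mm>"
  shows "(shift z ^^ Suc n) v \<in> K"
proof -
  have step: "shift z v \<in> Fil (n - 1)" if "v \<in> Fil n" for v n
  proof (rule shift_span[OF subset_refl assms(2)[unfolded m_span] Fil_subspace K_Fil[THEN subsetI]])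
    fix i assume i: "i \<in> set order"
    show "D i v \<in> Fil (n - 1)" using Fil_mono[OF Fil_D[OF that i]] d_pos[OF i] by simp
  qed
  have "(shift z ^^ r) v \<in> Fil (int n - int r)" for r
  proof (induction r)
    case (Suc r) then show ?case using step[of "(shift z ^^ r) v" "int n - int r"] by (simp add: algebra_simps)
  qed (simp add: assms(1))
  from this[of "Suc n"] show ?thesis using Fil_neg[of "-1"] by (simp add: algebra_simps)
qed

text \<open>The indices are added one by one, from large weights to small ones.  Moving \<open>D k\<close> to the right past the \<open>D j\<close>
with earlier \<open>j\<close> produces only operators \<open>D i\<close> with earlier \<open>i\<close>.  So a word in all of them, applied to \<open>v\<close>, is a
combination of words in the earlier ones applied to the finitely many vectors \<open>(D k)\<^sup>a v\<close>.\<close>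

theorem Fil_exhaustive:
  assumes nil: "\<And>i v. i \<in> set order \<Longrightarrow> \<exists>n. (D i ^^ n) v \<in> K"
  shows "\<exists>n. v \<in> Fil n"
proof -
  have "\<exists>n. \<forall>w\<in>lists (set js). n < wt w \<longrightarrow> foldr D w v \<in> K" if "order = js @ ks" for js ks v
    using that
  proof (induction js arbitrary: v ks rule: rev_induct)
    case Nil
    show ?case by (intro exI[of _ 0]) auto
  next
    case (snoc k js)
    have o: "order = js @ k # ks" using snoc.prems by simp
    have k: "k \<in> set order" using o by simp
    obtain s where s: "(D k ^^ s) v \<in> K" using nil[OF k] by blast
    have sK: "(D k ^^ (b + s)) v \<in> K" for b
      by (induction b) (auto intro: shift_K s)
    define T where "T n = V.span (K \<union> {foldr D W ((D k ^^ a) v) | W a. W \<in> lists (set js) \<and> wt W + int a * d k = n})" for n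
    have T_sub: "V.subspace (T n)" for n unfolding T_def by simp
    have T_K: "K \<subseteq> T n" for n unfolding T_def by (auto intro: V.span_base)
    have T_base: "foldr D W ((D k ^^ a) v) \<in> T n" if "W \<in> lists (set js)" "wt W + int a * d k = n" for W a n
      unfolding T_def using that by (intro V.span_base) blast
    have T_step: "D i z \<in> T (n + d i)" if "z \<in> T n"
      "\<And>W a. W \<in> lists (set js) \<Longrightarrow> wt W + int a * d k = n \<Longrightarrow> D i (foldr D W ((D k ^^ a) v)) \<in> T (n + d i)" for i z n
      unfolding T_def
    proof (rule span_map[OF shift_add shift_scale _ that(1)[unfolded T_def]], fold T_def)
      fix g assume "g \<in> K \<union> {foldr D W ((D k ^^ a) v) | W a. W \<in> lists (set js) \<and> wt W + int a * d k = n}"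
      then show "D i g \<in> T (n + d i)" using that(2) T_K shift_K by blast
    qed
    have T_js: "D j z \<in> T (n + d j)" if "z \<in> T n" "j \<in> set js" for j z n
      by (rule T_step[OF that(1)]) (use T_base[of "j # _"] that(2) in auto)
    have T_k0: "D k (foldr D W ((D k ^^ a) v)) \<in> T (wt W + int a * d k + d k)" if "W \<in> lists (set js)" for W a
      using that
    proof (induction W)
      case Nil
      show ?case using T_base[of "[]" "Suc a"] by (simp add: algebra_simps)
    next
      case (Cons j W)
      let ?y = "foldr D W ((D k ^^ a) v)"
      have j: "j \<in> set js" "j \<in> set order" and W: "W \<in> lists (set js)" using Cons.hyps Cons.prems o by auto
      let ?N = "wt (j # W) + int a * d k + d k"
      have 1: "D j (D k ?y) \<in> T ?N" using T_js[OF Cons.IH j(1)] by (simp add: algebra_simps)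
      have z: "bracket L (u k) (u j) \<in> gr (- (d k + d j))"
        using gr_bracket[OF u_gr[OF k] u_gr[OF j(2)]] by (simp add: algebra_simps)
      have 2: "shift (bracket L (u k) (u j)) ?y \<in> T ?N"
      proof (rule shift_span[OF _ u_span[OF _ z] T_sub T_K])
        show "1 \<le> d k + d j" using d_pos[OF k] d_pos[OF j(2)] by simp
        fix i assume "i \<in> {i \<in> set order. d i = d k + d j}"
        then have i: "i \<in> set order" "d i = d k + d j" by auto
        have "d k < d i" using i d_pos[OF j(2)] by simp
        then have "i \<in> set js" using i order_sorted unfolding o by (auto simp: sorted_wrt_append)
        then show "D i ?y \<in> T ?N" using T_base[of "i # W" a ?N] W i by simp
      qed auto
      have "D k (D j ?y) \<in> T ?N"
        by (rule subspace_diff_mem[OF T_sub subsetD[OF T_K D_D_commute[OF k j(2)]]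
              V.subspace_add[OF T_sub V.subspace_scale[OF T_sub 1] 2]])
      then show ?case by simp
    qed
    have T_k: "D k z \<in> T (n + d k)" if "z \<in> T n" for z n
      by (rule T_step[OF that]) (use T_k0 in auto)
    have T_all: "foldr D w v \<in> T (wt w)" if "w \<in> lists (set (js @ [k]))" for w
      using that
    proof (induction w)
      case Nil
      show ?case using T_base[of "[]" 0 0] by simp
    next
      case (Cons i w)
      then show ?case using T_js[of "foldr D w v" "wt w" i] T_k[of "foldr D w v" "wt w"] by (auto simp: add.commute)
    qed
    define N where "N a = (SOME n. \<forall>w\<in>lists (set js). n < wt w \<longrightarrow> foldr D w ((D k ^^ a) v) \<in> K)" for a
    have N: "\<forall>w\<in>lists (set js). N a < wt w \<longrightarrow> foldr D w ((D k ^^ a) v) \<in> K" for a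
      unfolding N_def by (rule someI_ex[OF snoc.IH[OF o]])
    define M where "M = Max (insert 0 (N ` {..<s}))"
    have M: "\<forall>a<s. N a \<le> M" unfolding M_def by (auto intro!: Max_ge)
    \<comment> \<open>The factor \<open>(D k)\<^sup>a\<close> takes up less than \<open>s * d k\<close> of the weight; the rest exceeds every bound \<open>N a\<close>.\<close>
    show ?case
    proof (intro exI[of _ "M + int s * d k"] ballI impI)
      fix w assume w: "w \<in> lists (set (js @ [k]))" "M + int s * d k < wt w"
      have gen: "g \<in> K" if "g \<in> K \<union> {foldr D W ((D k ^^ a) v) | W a. W \<in> lists (set js) \<and> wt W + int a * d k = wt w}" for g
        using that
      proof
        assume "g \<in> {foldr D W ((D k ^^ a) v) | W a. W \<in> lists (set js) \<and> wt W + int a * d k = wt w}"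
        then obtain W a where g: "g = foldr D W ((D k ^^ a) v)" "W \<in> lists (set js)" "wt W + int a * d k = wt w" by blast
        show ?thesis
        proof (cases "s \<le> a")
          case True
          then show ?thesis using sK[of "a - s"] g(1) foldr_D_K by simp
        next
          case False
          have "int a * d k \<le> int s * d k" using False d_pos[OF k] by (intro mult_right_mono) auto
          moreover have "N a \<le> M" using False M by simp
          ultimately have "N a < wt W" using w(2) g(3) by linarith
          then show ?thesis using N[of a] g by blast
        qed
      qed
      show "foldr D w v \<in> K"
        using V.span_subspace_induct[OF T_all[OF w(1), unfolded T_def] K_subspace gen] by simp
    qed
  qed
  from this[of order "[]"] show ?thesis by (auto simp: Fil_def)
qed

end

section \<open>Complex vector spaces with explicit carrier\<close>

lemma complex_ring_simps [simp]:
  "carrier complex_ring = UNIV" "a \<otimes>\<^bsub>complex_ring\<^esub> b = a * b" "\<one>\<^bsub>complex_ring\<^esub> = 1"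
  "\<zero>\<^bsub>complex_ring\<^esub> = 0" "a \<oplus>\<^bsub>complex_ring\<^esub> b = a + b"
  by (simp_all add: complex_ring_def)

lemma cring_complex_ring: "cring complex_ring"
proof (rule cringI)
  show "abelian_group complex_ring"
    by (rule abelian_groupI) (auto simp: algebra_simps intro: exI[of _ "- _"] add.left_inverse)
  show "Group.comm_monoid complex_ring"
    by (rule Group.comm_monoidI) (auto simp: algebra_simps)
qed (auto simp: algebra_simps)

locale complex_module = Module.module complex_ring M for M :: "(complex, 'm, 'z) module_scheme" (structure)
begin

lemma smult_mem [simp, intro]: "v \<in> carrier M \<Longrightarrow> c \<odot> v \<in> carrier M"
  by (rule smult_closed) auto

lemma add_smult: "v \<in> carrier M \<Longrightarrow> (a + b) \<odot> v = a \<odot> v \<oplus> b \<odot> v"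
  using smult_l_distr[of a b v] by simp

lemma smult_add: "v \<in> carrier M \<Longrightarrow> w \<in> carrier M \<Longrightarrow> c \<odot> (v \<oplus> w) = c \<odot> v \<oplus> c \<odot> w"
  using smult_r_distr[of c v w] by simp

lemma smult_smult [simp]: "v \<in> carrier M \<Longrightarrow> a \<odot> (b \<odot> v) = (a * b) \<odot> v"
  using smult_assoc1[of a b v] by simp

lemma one_smult [simp]: "v \<in> carrier M \<Longrightarrow> 1 \<odot> v = v"
  using smult_one[of v] by simp

lemma zero_smult [simp]: "v \<in> carrier M \<Longrightarrow> 0 \<odot> v = \<zero>"
  using smult_l_null[of v] by simp

lemma smult_zero [simp]: "c \<odot> \<zero> = \<zero>"
  using smult_r_null[of c] by simp

lemma neg_smult: "v \<in> carrier M \<Longrightarrow> \<ominus> v = (-1) \<odot> v"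
proof -
  assume v: "v \<in> carrier M"
  have "v \<oplus> (-1) \<odot> v = \<zero>" using add_smult[OF v, of 1 "-1"] v by simp
  then show ?thesis using v by (metis M.minus_equality M.a_comm smult_mem)
qed

lemma minus_smult: "v \<in> carrier M \<Longrightarrow> w \<in> carrier M \<Longrightarrow> v \<ominus> w = v \<oplus> (-1) \<odot> w"
  by (simp add: a_minus_def neg_smult)

lemma cancel_smult [simp]:
  assumes "v \<in> carrier M"
  shows "v \<oplus> (-1) \<odot> v = \<zero>" "(-1) \<odot> v \<oplus> v = \<zero>"
  using add_smult[OF assms, of 1 "-1"] add_smult[OF assms, of "-1" 1] assms by simp_all

lemma cancel_smult_left [simp]:
  assumes "v \<in> carrier M" "w \<in> carrier M"
  shows "v \<oplus> ((-1) \<odot> v \<oplus> w) = w" "(-1) \<odot> v \<oplus> (v \<oplus> w) = w"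
  using assms by (simp_all add: M.a_assoc[symmetric])

lemma minus_zero_iff: "v \<in> carrier M \<Longrightarrow> w \<in> carrier M \<Longrightarrow> v \<ominus> w = \<zero> \<longleftrightarrow> v = w"
  using M.a_assoc[of v "(-1) \<odot> w" w] by (auto simp: minus_smult)

lemma smult_minus: "v \<in> carrier M \<Longrightarrow> w \<in> carrier M \<Longrightarrow> c \<odot> (v \<ominus> w) = c \<odot> v \<ominus> c \<odot> w"
  by (simp add: minus_smult smult_add)

lemma minus_minus_cancel: "v \<in> carrier M \<Longrightarrow> w \<in> carrier M \<Longrightarrow> v \<ominus> (v \<ominus> w) = w"
  by (simp add: minus_smult smult_add)

lemma complex_submoduleI:
  assumes "H \<subseteq> carrier M" "\<zero> \<in> H" "\<And>v w. v \<in> H \<Longrightarrow> w \<in> H \<Longrightarrow> v \<oplus> w \<in> H" "\<And>c v. v \<in> H \<Longrightarrow> c \<odot> v \<in> H"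
  shows "submodule H complex_ring M"
proof (rule submoduleI)
  fix a assume "a \<in> H"
  then show "\<ominus> a \<in> H" using assms(1) assms(4)[of a "-1"] neg_smult[of a] by auto
qed (use assms in auto)

lemma complex_submoduleE:
  assumes "submodule H complex_ring M"
  shows "H \<subseteq> carrier M" "\<zero> \<in> H" "\<And>v w. v \<in> H \<Longrightarrow> w \<in> H \<Longrightarrow> v \<oplus> w \<in> H" "\<And>c v. v \<in> H \<Longrightarrow> c \<odot> v \<in> H"
    "\<And>v w. v \<in> H \<Longrightarrow> w \<in> H \<Longrightarrow> v \<ominus> w \<in> H"
proof -
  note E = submoduleE[OF assms]
  show sub: "H \<subseteq> carrier M" and add: "\<And>v w. v \<in> H \<Longrightarrow> w \<in> H \<Longrightarrow> v \<oplus> w \<in> H"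
    and sc: "\<And>c v. v \<in> H \<Longrightarrow> c \<odot> v \<in> H" using E by auto
  obtain h where "h \<in> H" using E(2) by auto
  then show "\<zero> \<in> H" using sc[of h 0] sub by auto
  fix v w assume vw: "v \<in> H" "w \<in> H"
  then have "v \<in> carrier M" "w \<in> carrier M" using sub by auto
  then show "v \<ominus> w \<in> H" using vw minus_smult[of v w] add sc by auto
qed

lemma generated_subspace_submodule:
  assumes "S \<subseteq> carrier M"
  shows "submodule (\<Inter>{K. submodule K complex_ring M \<and> S \<subseteq> K}) complex_ring M"
proof (rule complex_submoduleI)
  show "\<Inter>{K. submodule K complex_ring M \<and> S \<subseteq> K} \<subseteq> carrier M"
    using carrier_is_submodule assms by auto
qed (auto dest: complex_submoduleE)

end

lemma complex_moduleI: "super_vector_space M \<Longrightarrow> complex_module M"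
  by (simp add: super_vector_space_def complex_module_def)

section \<open>Quotients\<close>

locale quotient_module = complex_module P for P :: "('m, 'z) superspace_scheme" (structure) +
  fixes K :: "'m set"
  assumes K_sub: "submodule K complex_ring P"
begin

lemmas K = complex_submoduleE[OF K_sub]

lemma K_carrier: "v \<in> K \<Longrightarrow> v \<in> carrier P" using K(1) by auto

sublocale K: abelian_subgroup K P
  by (rule abelian_subgroupI3) (use K_sub M.abelian_group_axioms in \<open>auto simp: submodule_def additive_subgroup_def\<close>)

lemma mem_coset: "v \<in> carrier P \<Longrightarrow> w \<in> K +> v \<longleftrightarrow> w \<in> carrier P \<and> w \<ominus> v \<in> K"
proof
  assume v: "v \<in> carrier P"
  {
    assume "w \<in> K +> v"
    then obtain k where k: "k \<in> K" "w = k \<oplus> v" by (auto simp: a_r_coset_def')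
    then have "w \<ominus> v = k" using v K_carrier[OF k(1)] by (simp add: a_minus_def a_assoc r_neg)
    then show "w \<in> carrier P \<and> w \<ominus> v \<in> K" using k v K_carrier by auto
  }
  assume w: "w \<in> carrier P \<and> w \<ominus> v \<in> K"
  then have "w = (w \<ominus> v) \<oplus> v" using v by (simp add: a_minus_def a_assoc l_neg)
  then show "w \<in> K +> v" using w by (auto simp: a_r_coset_def')
qed

lemma self_coset: "v \<in> carrier P \<Longrightarrow> v \<in> K +> v"
  using mem_coset[of v v] K(2) by (simp add: a_minus_def r_neg)

lemma coset_eq: "v \<in> carrier P \<Longrightarrow> w \<in> carrier P \<Longrightarrow> K +> v = K +> w \<longleftrightarrow> v \<ominus> w \<in> K"
proof
  assume "v \<in> carrier P" "w \<in> carrier P" "K +> v = K +> w"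
  then show "v \<ominus> w \<in> K" using self_coset[of v] mem_coset[of w v] by simp
next
  assume "v \<in> carrier P" "w \<in> carrier P" "v \<ominus> w \<in> K"
  then have "v \<in> K +> w" using mem_coset by simp
  then show "K +> v = K +> w" using K.a_subgroup a_repr_independence[of v K w] \<open>w \<in> carrier P\<close> by simp
qed

lemma coset_zero: "K +> \<zero> = K" using K(1) by simp

lemma coset_const:
  assumes "v \<in> carrier P" "\<And>w. w \<in> carrier P \<Longrightarrow> w \<ominus> v \<in> K \<Longrightarrow> h w = h v"
  shows "(\<Union>w\<in>K +> v. h w) = h v"
  using assms mem_coset[OF assms(1)] self_coset[OF assms(1)] by blast

lemma coset_map_apply:
  assumes "v \<in> carrier P" "\<And>w. w \<in> carrier P \<Longrightarrow> w \<ominus> v \<in> K \<Longrightarrow> K' +>\<^bsub>N\<^esub> h w = K' +>\<^bsub>N\<^esub> h v"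
  shows "coset_map N K' h (K +> v) = K' +>\<^bsub>N\<^esub> h v"
  unfolding coset_map_def using coset_const[of v "\<lambda>w. K' +>\<^bsub>N\<^esub> h w"] assms by blast

lemma quotient_carrier: "carrier (quotient_superspace P K) = (\<lambda>v. K +> v) ` carrier P"
  by (auto simp: quotient_superspace_def FactRing_def A_RCOSETS_def')

lemma quotient_add: "v \<in> carrier P \<Longrightarrow> w \<in> carrier P \<Longrightarrow>
    (K +> v) \<oplus>\<^bsub>quotient_superspace P K\<^esub> (K +> w) = K +> (v \<oplus> w)"
  by (simp add: quotient_superspace_def FactRing_def K.a_rcos_sum)

lemma quotient_zero: "\<zero>\<^bsub>quotient_superspace P K\<^esub> = K"
  by (simp add: quotient_superspace_def FactRing_def)

lemma quotient_one: "\<one>\<^bsub>quotient_superspace P K\<^esub> = K +> \<one>"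
  by (simp add: quotient_superspace_def FactRing_def)

lemma quotient_smult: "v \<in> carrier P \<Longrightarrow> c \<odot>\<^bsub>quotient_superspace P K\<^esub> (K +> v) = K +> (c \<odot> v)"
proof -
  assume v: "v \<in> carrier P"
  have "coset_map P K (smult P c) (K +> v) = K +> (c \<odot> v)"
  proof (rule coset_map_apply[OF v])
    fix w assume "w \<in> carrier P" "w \<ominus> v \<in> K"
    then show "K +> (c \<odot> w) = K +> (c \<odot> v)"
      using v K(4)[of "w \<ominus> v" c] by (simp add: coset_eq smult_minus)
  qed
  then show ?thesis by (simp add: quotient_superspace_def)
qed

lemma quotient_parity: "parity (quotient_superspace P K) i = (\<lambda>v. K +> v) ` parity P i"
  by (simp add: quotient_superspace_def)

lemma quotient_is_module: "complex_module (quotient_superspace P K)"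
  unfolding complex_module_def
proof (rule moduleI[OF cring_complex_ring])
  let ?Q = "quotient_superspace P K"
  note q = quotient_carrier quotient_add quotient_smult
  show "abelian_group ?Q"
  proof (rule abelian_groupI)
    show "\<zero>\<^bsub>?Q\<^esub> \<in> carrier ?Q" using coset_zero by (auto simp: q quotient_zero)
  next
    fix x assume "x \<in> carrier ?Q"
    then obtain v where v: "v \<in> carrier P" "x = K +> v" by (auto simp: q)
    have "\<zero>\<^bsub>?Q\<^esub> = K +> \<zero>" using coset_zero by (simp add: quotient_zero)
    then show "\<zero>\<^bsub>?Q\<^esub> \<oplus>\<^bsub>?Q\<^esub> x = x" using v quotient_add[of \<zero> v] by simp
    have "(K +> \<ominus> v) \<oplus>\<^bsub>?Q\<^esub> x = \<zero>\<^bsub>?Q\<^esub>"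
      using v quotient_add[of "\<ominus> v" v] coset_zero by (simp add: l_neg quotient_zero)
    then show "\<exists>y\<in>carrier ?Q. y \<oplus>\<^bsub>?Q\<^esub> x = \<zero>\<^bsub>?Q\<^esub>" using v by (auto simp: q)
  qed (auto simp: q a_ac)
qed (auto simp: quotient_carrier quotient_add quotient_smult add_smult smult_add)

lemma quotient_submodule:
  assumes "submodule S complex_ring P"
  shows "submodule ((\<lambda>v. K +> v) ` S) complex_ring (quotient_superspace P K)"
proof -
  interpret Q: complex_module "quotient_superspace P K" by (rule quotient_is_module)
  note S = complex_submoduleE[OF assms]
  have [simp]: "v \<in> S \<Longrightarrow> v \<in> carrier P" for v using S(1) by auto
  show ?thesis
  proof (rule Q.complex_submoduleI)
    show "(\<lambda>v. K +> v) ` S \<subseteq> carrier (quotient_superspace P K)" using S(1) by (auto simp: quotient_carrier)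
    show "\<zero>\<^bsub>quotient_superspace P K\<^esub> \<in> (\<lambda>v. K +> v) ` S" using S(2) coset_zero by (force simp: quotient_zero)
  qed (auto simp: quotient_add quotient_smult S)
qed

text \<open>The map \<open>t\<close> induces an involution of the quotient with the images of the two parities in its eigenspaces for
\<open>1\<close> and \<open>-1\<close>.  This makes the parity decomposition unique, even if it is not unique before passing to the
quotient, as for words containing the letter \<open>0\<close>.\<close>

lemma quotient_super:
  assumes S: "\<And>i. submodule (parity P i) complex_ring P"
    and t: "\<And>v. v \<in> carrier P \<Longrightarrow> t v \<in> carrier P"
    and t_add: "\<And>v w. v \<in> carrier P \<Longrightarrow> w \<in> carrier P \<Longrightarrow> t (v \<oplus> w) = t v \<oplus> t w"
    and t_smult: "\<And>c v. v \<in> carrier P \<Longrightarrow> t (c \<odot> v) = c \<odot> t v"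
    and t_K: "\<And>v. v \<in> K \<Longrightarrow> t v \<in> K"
    and t_parity: "\<And>i v. v \<in> parity P i \<Longrightarrow> t v \<ominus> koszul_sign i i \<odot> v \<in> K"
    and ex: "\<And>v. v \<in> carrier P \<Longrightarrow> \<exists>a\<in>parity P 0. \<exists>b\<in>parity P 1. v \<ominus> (a \<oplus> b) \<in> K"
  shows "super_vector_space (quotient_superspace P K)"
proof -
  let ?Q = "quotient_superspace P K"
  interpret Q: complex_module ?Q by (rule quotient_is_module)
  have mem: "v \<in> parity P i \<Longrightarrow> v \<in> carrier P" for v i using complex_submoduleE(1)[OF S] by auto
  have both: "v \<in> K" if v: "v \<in> carrier P" "a \<in> parity P 0" "v \<ominus> a \<in> K" "b \<in> parity P 1" "v \<ominus> b \<in> K" for v a b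
  proof -
    have lin: "t v \<ominus> t w \<in> K" if "w \<in> carrier P" "v \<ominus> w \<in> K" for w
    proof -
      have "t (v \<ominus> w) = t v \<ominus> t w" using v(1) that(1) by (simp add: minus_smult t_add t_smult t)
      then show ?thesis using t_K[OF that(2)] by simp
    qed
    have ca: "a \<in> carrier P" "b \<in> carrier P" using mem v by auto
    have 1: "t v \<ominus> t a \<in> K" "t v \<ominus> t b \<in> K" using lin ca v by auto
    have 2: "t a \<ominus> a \<in> K" "t b \<oplus> b \<in> K"
      using t_parity[OF v(2)] t_parity[OF v(4)] ca by (simp_all add: minus_smult t)
    have A: "K +> t v = K +> v"
    proof -
      have "K +> t v = K +> t a" using 1 v ca t by (simp add: coset_eq)
      also have "\<dots> = K +> a" using 2 v ca t by (simp add: coset_eq)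
      also have "\<dots> = K +> v" using v ca coset_eq[of v a] by simp
      finally show ?thesis .
    qed
    have B: "K +> t v = K +> ((-1) \<odot> v)"
    proof -
      have "K +> t v = K +> t b" using 1 v ca t by (simp add: coset_eq)
      also have "\<dots> = K +> ((-1) \<odot> b)" using 2 v ca t by (simp add: coset_eq minus_smult)
      also have "\<dots> = (-1) \<odot>\<^bsub>?Q\<^esub> (K +> b)" using ca by (simp add: quotient_smult)
      also have "\<dots> = (-1) \<odot>\<^bsub>?Q\<^esub> (K +> v)" using v ca coset_eq[of v b] by simp
      finally show ?thesis using v by (simp add: quotient_smult)
    qed
    have "v \<ominus> (-1) \<odot> v \<in> K" using A B coset_eq[of v "(-1) \<odot> v"] v by simp
    moreover have "v \<ominus> (-1) \<odot> v = 2 \<odot> v" using v add_smult[of v 1 1] by (simp add: minus_smult)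
    ultimately have "(1/2) \<odot> (2 \<odot> v) \<in> K" using K(4) by metis
    then show "v \<in> K" using v(1) by simp
  qed
  show ?thesis
    unfolding super_vector_space_def
  proof (intro conjI allI ballI)
    show "Module.module complex_ring ?Q" using Q.complex_module_axioms by (simp add: complex_module_def)
    show "submodule (parity ?Q i) complex_ring ?Q" for i
      unfolding quotient_parity by (rule quotient_submodule[OF S])
    fix x assume "x \<in> carrier ?Q"
    then obtain v where v: "v \<in> carrier P" "x = K +> v" by (auto simp: quotient_carrier)
    obtain a b where ab: "a \<in> parity P 0" "b \<in> parity P 1" "v \<ominus> (a \<oplus> b) \<in> K" using ex[OF v(1)] by auto
    have c: "a \<in> carrier P" "b \<in> carrier P" using ab mem by auto
    show "\<exists>!p. fst p \<in> parity ?Q 0 \<and> snd p \<in> parity ?Q 1 \<and> x = fst p \<oplus>\<^bsub>?Q\<^esub> snd p"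
    proof (rule ex1I[of _ "(K +> a, K +> b)"])
      show "fst (K +> a, K +> b) \<in> parity ?Q 0 \<and> snd (K +> a, K +> b) \<in> parity ?Q 1 \<and>
        x = fst (K +> a, K +> b) \<oplus>\<^bsub>?Q\<^esub> snd (K +> a, K +> b)"
        using ab c v coset_eq[of v "a \<oplus> b"] by (auto simp: quotient_parity quotient_add)
      fix p assume p: "fst p \<in> parity ?Q 0 \<and> snd p \<in> parity ?Q 1 \<and> x = fst p \<oplus>\<^bsub>?Q\<^esub> snd p"
      then obtain a' b' where p': "fst p = K +> a'" "snd p = K +> b'" "a' \<in> parity P 0" "b' \<in> parity P 1"
        by (auto simp: quotient_parity)
      have c': "a' \<in> carrier P" "b' \<in> carrier P" using p' mem by auto
      have "K +> (a' \<oplus> b') = K +> (a \<oplus> b)"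
        using p p' v ab c c' coset_eq[of v "a \<oplus> b"] by (simp add: quotient_add)
      then have *: "(a' \<oplus> b') \<ominus> (a \<oplus> b) \<in> K" using c c' by (simp add: coset_eq)
      let ?x = "a' \<ominus> a" and ?y = "b \<ominus> b'"
      have x0: "?x \<in> parity P 0" "?y \<in> parity P 1" using complex_submoduleE(5)[OF S] p' ab by auto
      have xy: "?x \<ominus> ?y = (a' \<oplus> b') \<ominus> (a \<oplus> b)"
        using c c' by (simp add: minus_smult smult_add a_ac)
      have "?x \<in> K" using both[of ?x ?x ?y] x0 xy * c c' K(2) by (simp add: r_neg a_minus_def)
      moreover have "?y \<in> K"
      proof -
        have "?y = ?x \<ominus> (?x \<ominus> ?y)" using c c' minus_minus_cancel[of ?x ?y] by simp
        then show ?thesis using K(5) \<open>?x \<in> K\<close> xy * by metis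
      qed
      ultimately have "K +> a' = K +> a" "K +> b = K +> b'" using c c' by (simp_all add: coset_eq)
      then show "p = (K +> a, K +> b)" using p' by (metis prod.collapse)
    qed
  qed
qed

end

section \<open>Linear extension\<close>

lemma lookup_scale_pm [simp]: "Poly_Mapping.lookup (scale_pm c f) k = c * Poly_Mapping.lookup f k"
  by (simp add: scale_pm_def Poly_Mapping.map.rep_eq when_def)

interpretation pm: vector_space "scale_pm :: complex \<Rightarrow> ('k \<Rightarrow>\<^sub>0 complex) \<Rightarrow> _"
  by unfold_locales (auto intro!: poly_mapping_eqI simp: lookup_add algebra_simps)

lemma scale_pm_single [simp]: "scale_pm c (Poly_Mapping.single k b) = Poly_Mapping.single k (c * b)"
  by (rule poly_mapping_eqI) (simp add: lookup_single when_def)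

lemma keys_scale_pm: "Poly_Mapping.keys (scale_pm c f) \<subseteq> Poly_Mapping.keys f"
  by (auto simp: in_keys_iff)

lemma poly_mapping_sum_singles: "f = (\<Sum>k\<in>Poly_Mapping.keys f. Poly_Mapping.single k (Poly_Mapping.lookup f k))"
  by (rule poly_mapping_eqI) (simp add: lookup_sum lookup_single when_def in_keys_iff)

definition supported :: "'k set \<Rightarrow> ('k \<Rightarrow>\<^sub>0 complex) set" where
  "supported S = {f. Poly_Mapping.keys f \<subseteq> S}"

lemma supported_subspace: "pm.subspace (supported S)"
proof (rule pm.subspaceI)
  show "f + g \<in> supported S" if "f \<in> supported S" "g \<in> supported S" for f g
    using keys_add[of f g] that by (auto simp: supported_def)
  show "scale_pm c f \<in> supported S" if "f \<in> supported S" for c f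
    using keys_scale_pm[of c f] that by (auto simp: supported_def)
qed (simp add: supported_def)

lemma single_supported [simp]: "k \<in> S \<Longrightarrow> Poly_Mapping.single k c \<in> supported S"
  by (simp add: supported_def)

lemma supported_UNIV [simp]: "f \<in> supported UNIV" by (simp add: supported_def)

lemma supported_induct [consumes 1, case_names zero single add]:
  assumes "f \<in> supported S" "P 0" "\<And>k c. k \<in> S \<Longrightarrow> P (Poly_Mapping.single k c)"
    and add: "\<And>f g. f \<in> supported S \<Longrightarrow> g \<in> supported S \<Longrightarrow> P f \<Longrightarrow> P g \<Longrightarrow> P (f + g)"
  shows "P f"
proof -
  have "P (\<Sum>k\<in>A. Poly_Mapping.single k (h k)) \<and> (\<Sum>k\<in>A. Poly_Mapping.single k (h k)) \<in> supported S"
    if "finite A" "A \<subseteq> S" for A and h :: "_ \<Rightarrow> complex"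
    using that
  proof (induction A)
    case empty then show ?case using assms(2) by (simp add: supported_def)
  next
    case (insert k A)
    then show ?case
      using add[of "Poly_Mapping.single k (h k)" "\<Sum>k\<in>A. Poly_Mapping.single k (h k)"] assms(3)
        pm.subspace_add[OF supported_subspace, of "Poly_Mapping.single k (h k)" S "\<Sum>k\<in>A. Poly_Mapping.single k (h k)"]
      by auto
  qed
  then show ?thesis using poly_mapping_sum_singles[of f] assms(1) by (metis finite_keys supported_def mem_Collect_eq)
qed

lemma push_forward_superset:
  "finite A \<Longrightarrow> Poly_Mapping.keys f \<subseteq> A \<Longrightarrow>
    push_forward h f = (\<Sum>k\<in>A. Poly_Mapping.single (h k) (Poly_Mapping.lookup f k))"
  unfolding push_forward_def by (rule sum.mono_neutral_left) (auto simp: in_keys_iff)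

lemma push_forward_add: "push_forward h (f + g) = push_forward h f + push_forward h g"
proof -
  let ?A = "Poly_Mapping.keys f \<union> Poly_Mapping.keys g"
  have "Poly_Mapping.keys (f + g) \<subseteq> ?A" by (rule keys_add)
  then show ?thesis
    by (simp add: push_forward_superset[of ?A] lookup_add single_add sum.distrib)
qed

lemma push_forward_scale: "push_forward h (scale_pm c f) = scale_pm c (push_forward h f)"
proof -
  have "push_forward h (scale_pm c f) = (\<Sum>k\<in>Poly_Mapping.keys f. scale_pm c (Poly_Mapping.single (h k) (Poly_Mapping.lookup f k)))"
    using push_forward_superset[OF finite_keys keys_scale_pm, of h c f] by simp
  then show ?thesis unfolding push_forward_def by (simp only: pm.scale_sum_right)
qed

lemma push_forward_single [simp]: "push_forward h (Poly_Mapping.single k c) = Poly_Mapping.single (h k) c"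
  by (cases "c = 0") (simp_all add: push_forward_def)

lemma push_forward_zero [simp]: "push_forward h 0 = 0"
  by (simp add: push_forward_def)

lemma push_forward_diff: "push_forward h (f - g) = push_forward h f - push_forward h g"
  using push_forward_add[of h "f - g" g] by simp

lemma push_forward_supported: "f \<in> supported S \<Longrightarrow> (\<And>k. k \<in> S \<Longrightarrow> h k \<in> T) \<Longrightarrow> push_forward h f \<in> supported T"
  by (induction f rule: supported_induct)
     (auto simp: push_forward_add pm.subspace_add[OF supported_subspace] pm.subspace_0[OF supported_subspace])

lemma push_forward_compose:
  "push_forward g (push_forward h f) = push_forward (\<lambda>k. g (h k)) f"
  by (induction f rule: supported_induct[OF supported_UNIV]) (auto simp: push_forward_add)

lemma push_forward_cong:
  "f \<in> supported S \<Longrightarrow> (\<And>k. k \<in> S \<Longrightarrow> g k = h k) \<Longrightarrow> push_forward g f = push_forward h f"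
  unfolding push_forward_def supported_def by (intro sum.cong) auto

lemma push_forward_id: "push_forward (\<lambda>k. k) f = f"
  by (induction f rule: supported_induct[OF supported_UNIV]) (auto simp: push_forward_add)

text \<open>Both the action of the free algebra on a module and maps out of a tensor product are of this form.\<close>

definition lin_ext :: "(complex, 'm, 'z) module_scheme \<Rightarrow> ('k \<Rightarrow> 'm) \<Rightarrow> ('k \<Rightarrow>\<^sub>0 complex) \<Rightarrow> 'm" where
  "lin_ext M B f = (\<Oplus>\<^bsub>M\<^esub>k\<in>Poly_Mapping.keys f. Poly_Mapping.lookup f k \<odot>\<^bsub>M\<^esub> B k)"

context complex_module begin

lemma lin_ext_superset:
  assumes "finite A" "Poly_Mapping.keys f \<subseteq> A" "\<And>k. k \<in> A \<Longrightarrow> B k \<in> carrier M"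
  shows "lin_ext M B f = (\<Oplus>k\<in>A. Poly_Mapping.lookup f k \<odot> B k)"
  unfolding lin_ext_def
  by (rule M.add.finprod_mono_neutral_cong_left[simplified]) (use assms in \<open>auto simp: in_keys_iff\<close>)

lemma lin_ext_zero [simp]: "lin_ext M B 0 = \<zero>"
  by (simp add: lin_ext_def)

lemma lin_ext_closed: "f \<in> supported S \<Longrightarrow> (\<And>k. k \<in> S \<Longrightarrow> B k \<in> carrier M) \<Longrightarrow> lin_ext M B f \<in> carrier M"
  unfolding lin_ext_def supported_def by (rule M.finsum_closed) auto

lemma lin_ext_add:
  assumes "f \<in> supported S" "g \<in> supported S" "\<And>k. k \<in> S \<Longrightarrow> B k \<in> carrier M"
  shows "lin_ext M B (f + g) = lin_ext M B f \<oplus> lin_ext M B g"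
proof -
  let ?A = "Poly_Mapping.keys f \<union> Poly_Mapping.keys g"
  have A: "finite ?A" "\<And>k. k \<in> ?A \<Longrightarrow> B k \<in> carrier M" using assms by (auto simp: supported_def)
  have "lin_ext M B (f + g) = (\<Oplus>k\<in>?A. Poly_Mapping.lookup f k \<odot> B k \<oplus> Poly_Mapping.lookup g k \<odot> B k)"
    by (subst lin_ext_superset[OF A(1) keys_add A(2)], assumption)
       (rule M.finsum_cong'[OF refl], use A in \<open>auto simp: lookup_add add_smult\<close>)
  also have "\<dots> = (\<Oplus>k\<in>?A. Poly_Mapping.lookup f k \<odot> B k) \<oplus> (\<Oplus>k\<in>?A. Poly_Mapping.lookup g k \<odot> B k)"
    by (rule M.finsum_addf) (use A in auto)
  finally show ?thesis using lin_ext_superset[OF A(1) _ A(2)] by simp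
qed

lemma lin_ext_scale:
  assumes "f \<in> supported S" "\<And>k. k \<in> S \<Longrightarrow> B k \<in> carrier M"
  shows "lin_ext M B (scale_pm c f) = c \<odot> lin_ext M B f"
proof -
  let ?A = "Poly_Mapping.keys f"
  have A: "finite ?A" "\<And>k. k \<in> ?A \<Longrightarrow> B k \<in> carrier M" using assms by (auto simp: supported_def)
  have "lin_ext M B (scale_pm c f) = (\<Oplus>k\<in>?A. c \<odot> (Poly_Mapping.lookup f k \<odot> B k))"
    by (subst lin_ext_superset[OF A(1) keys_scale_pm A(2)], assumption)
       (rule M.finsum_cong'[OF refl], use A in auto)
  also have "\<dots> = c \<odot> lin_ext M B f" unfolding lin_ext_def
    by (rule finsum_smult_ldistr[symmetric]) (use A in auto)
  finally show ?thesis .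
qed

lemma lin_ext_single: "B k \<in> carrier M \<Longrightarrow> lin_ext M B (Poly_Mapping.single k c) = c \<odot> B k"
  using lin_ext_superset[of "{k}" "Poly_Mapping.single k c" B] by (cases "c = 0") auto

lemma lin_ext_diff:
  assumes "f \<in> supported S" "g \<in> supported S" "\<And>k. k \<in> S \<Longrightarrow> B k \<in> carrier M"
  shows "lin_ext M B (f - g) = lin_ext M B f \<ominus> lin_ext M B g"
proof -
  have d: "f - g \<in> supported S" by (rule pm.subspace_diff[OF supported_subspace assms(1,2)])
  have "lin_ext M B f = lin_ext M B (f - g) \<oplus> lin_ext M B g"
    using lin_ext_add[OF d assms(2,3)] by simp
  then show ?thesis
    using lin_ext_closed[OF d assms(3)] lin_ext_closed[OF assms(2,3)] by (simp add: minus_smult M.a_assoc)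
qed

lemma lin_ext_push_forward:
  assumes "f \<in> supported S" "\<And>k. k \<in> S \<Longrightarrow> B (h k) \<in> carrier M"
  shows "lin_ext M B (push_forward h f) = lin_ext M (\<lambda>k. B (h k)) f"
proof -
  have s: "push_forward h g \<in> supported (h ` S)" if "g \<in> supported S" for g
    using push_forward_supported[OF that] by blast
  have c: "\<And>k. k \<in> h ` S \<Longrightarrow> B k \<in> carrier M" using assms(2) by auto
  show ?thesis using assms(1)
  proof (induction f rule: supported_induct)
    case (add f g)
    then show ?case using lin_ext_add[OF s s c, of f g] lin_ext_add[of f S g "\<lambda>k. B (h k)"] assms(2) by (simp add: push_forward_add)
  qed (auto simp: lin_ext_single assms(2))
qed

lemma linear_lin_ext:
  assumes N: "complex_module N"
    and h: "\<And>v. v \<in> carrier M \<Longrightarrow> h v \<in> carrier N"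
      "\<And>v w. v \<in> carrier M \<Longrightarrow> w \<in> carrier M \<Longrightarrow> h (v \<oplus> w) = h v \<oplus>\<^bsub>N\<^esub> h w"
      "\<And>c v. v \<in> carrier M \<Longrightarrow> h (c \<odot> v) = c \<odot>\<^bsub>N\<^esub> h v"
    and "f \<in> supported S" "\<And>k. k \<in> S \<Longrightarrow> B k \<in> carrier M"
  shows "h (lin_ext M B f) = lin_ext N (\<lambda>k. h (B k)) f"
proof -
  interpret N: complex_module N by (rule N)
  have h0: "h \<zero> = \<zero>\<^bsub>N\<^esub>" using h(3)[of \<zero> 0] h(1)[of \<zero>] by simp
  show ?thesis using assms(5)
  proof (induction f rule: supported_induct)
    case (add f g)
    then show ?case using lin_ext_add[of f S g B] N.lin_ext_add[of f S g "\<lambda>k. h (B k)"] assms(6) h lin_ext_closed[of _ S B] by simp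
  qed (auto simp: lin_ext_single N.lin_ext_single h assms(6) h0)
qed

lemma lin_ext_cong:
  assumes "f \<in> supported S" "\<And>k. k \<in> S \<Longrightarrow> B k = C k" "\<And>k. k \<in> S \<Longrightarrow> C k \<in> carrier M"
  shows "lin_ext M B f = lin_ext M C f"
  unfolding lin_ext_def by (rule M.finsum_cong') (use assms in \<open>auto simp: supported_def\<close>)

lemma lin_ext_mem_submodule:
  assumes "submodule H complex_ring M" "f \<in> supported S" "\<And>k. k \<in> S \<Longrightarrow> B k \<in> H"
  shows "lin_ext M B f \<in> H"
proof -
  note H = complex_submoduleE[OF assms(1)]
  have c: "k \<in> S \<Longrightarrow> B k \<in> carrier M" for k using assms(3) H(1) by auto
  show ?thesis using assms(2)
  proof (induction f rule: supported_induct)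
    case (add f g)
    then show ?case using lin_ext_add[of f S g B] c H by simp
  qed (auto simp: lin_ext_single c H assms(3))
qed

end

section \<open>The parity involution\<close>

locale super_space = complex_module M for M :: "('m, 'z) superspace_scheme" (structure) +
  assumes super: "super_vector_space M"

lemma super_spaceI: "super_vector_space M \<Longrightarrow> super_space M"
  by (simp add: super_space_def super_space_axioms_def complex_moduleI)

definition parity_inv :: "('m, 'z) superspace_scheme \<Rightarrow> 'm \<Rightarrow> 'm" where
  "parity_inv M v = (let p = (THE p. fst p \<in> parity M 0 \<and> snd p \<in> parity M 1 \<and> v = fst p \<oplus>\<^bsub>M\<^esub> snd p)
     in fst p \<ominus>\<^bsub>M\<^esub> snd p)"

context super_space begin

lemma parity_submodule: "submodule (parity M i) complex_ring M"
  using super by (simp add: super_vector_space_def)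

lemmas par = complex_submoduleE[OF parity_submodule]

lemma par_carrier: "v \<in> parity M i \<Longrightarrow> v \<in> carrier M" using par(1) by auto

lemma parity_ex1: "v \<in> carrier M \<Longrightarrow> \<exists>!p. fst p \<in> parity M 0 \<and> snd p \<in> parity M 1 \<and> v = fst p \<oplus> snd p"
  using super by (simp add: super_vector_space_def)

lemma parity_split:
  assumes "v \<in> carrier M"
  obtains a b where "a \<in> parity M 0" "b \<in> parity M 1" "v = a \<oplus> b"
  using parity_ex1[OF assms] by blast

lemma parity_unique:
  assumes "a \<in> parity M 0" "b \<in> parity M 1" "a' \<in> parity M 0" "b' \<in> parity M 1" "a \<oplus> b = a' \<oplus> b'"
  shows "a = a' \<and> b = b'"
proof -
  have "a \<oplus> b \<in> carrier M" using assms par_carrier by auto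
  from parity_ex1[OF this] have "(a, b) = (a', b')" using assms by (metis fst_conv snd_conv)
  then show ?thesis by simp
qed

lemma parity_inv_eq:
  assumes "a \<in> parity M 0" "b \<in> parity M 1"
  shows "parity_inv M (a \<oplus> b) = a \<ominus> b"
proof -
  have "(THE p. fst p \<in> parity M 0 \<and> snd p \<in> parity M 1 \<and> a \<oplus> b = fst p \<oplus> snd p) = (a, b)"
    by (rule the1_equality[OF parity_ex1]) (use assms par_carrier in auto)
  then show ?thesis by (simp add: parity_inv_def)
qed

lemma parity_inv_closed: "v \<in> carrier M \<Longrightarrow> parity_inv M v \<in> carrier M"
  by (elim parity_split) (auto simp: parity_inv_eq par_carrier)

lemma parity_inv_add:
  assumes "v \<in> carrier M" "w \<in> carrier M"
  shows "parity_inv M (v \<oplus> w) = parity_inv M v \<oplus> parity_inv M w"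
proof -
  obtain a b where v: "a \<in> parity M 0" "b \<in> parity M 1" "v = a \<oplus> b" by (rule parity_split[OF assms(1)])
  obtain a' b' where w: "a' \<in> parity M 0" "b' \<in> parity M 1" "w = a' \<oplus> b'" by (rule parity_split[OF assms(2)])
  note c = par_carrier[OF v(1)] par_carrier[OF v(2)] par_carrier[OF w(1)] par_carrier[OF w(2)]
  have e: "v \<oplus> w = (a \<oplus> a') \<oplus> (b \<oplus> b')" using v w c by (simp add: M.a_ac)
  have "parity_inv M (v \<oplus> w) = (a \<oplus> a') \<ominus> (b \<oplus> b')"
    unfolding e by (rule parity_inv_eq) (use v w par(3) in auto)
  also have "\<dots> = (a \<ominus> b) \<oplus> (a' \<ominus> b')" using c by (simp add: minus_smult smult_add M.a_ac)
  finally show ?thesis using v w parity_inv_eq by simp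
qed

lemma parity_inv_smult:
  assumes "v \<in> carrier M"
  shows "parity_inv M (c \<odot> v) = c \<odot> parity_inv M v"
proof -
  obtain a b where v: "a \<in> parity M 0" "b \<in> parity M 1" "v = a \<oplus> b" by (rule parity_split[OF assms(1)])
  note k = par_carrier[OF v(1)] par_carrier[OF v(2)]
  have "c \<odot> v = c \<odot> a \<oplus> c \<odot> b" using v k by (simp add: smult_add)
  then show ?thesis using v k parity_inv_eq par(4) by (simp add: smult_minus)
qed

lemma parity_inv_parity: "v \<in> parity M i \<Longrightarrow> parity_inv M v = koszul_sign i i \<odot> v"
  using parity_inv_eq[of v \<zero>] parity_inv_eq[of \<zero> v] par(2) par_carrier[of v i]
  by (cases i) (auto simp: minus_smult)

lemma parity_inv_unique:
  assumes "\<And>i w. w \<in> parity M i \<Longrightarrow> h w = koszul_sign i i \<odot> w"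
    and "\<And>v w. v \<in> carrier M \<Longrightarrow> w \<in> carrier M \<Longrightarrow> h (v \<oplus> w) = h v \<oplus> h w"
    and "v \<in> carrier M"
  shows "h v = parity_inv M v"
proof -
  obtain a b where v: "a \<in> parity M 0" "b \<in> parity M 1" "v = a \<oplus> b" by (rule parity_split[OF assms(3)])
  note k = par_carrier[OF v(1)] par_carrier[OF v(2)]
  show ?thesis unfolding v(3) parity_inv_eq[OF v(1,2)] assms(2)[OF k] assms(1)[OF v(1)] assms(1)[OF v(2)]
    using k by (simp add: minus_smult)
qed

end

section \<open>The decomposition of modules in the category\<close>

locale lie_rep = complex_module M for M :: "('a::ab_group_add, 'm) supermodule" (structure) +
  fixes L :: "'a lie_super"
  assumes rep: "lie_module L M"
begin

lemma act_closed [simp, intro]: "v \<in> carrier M \<Longrightarrow> action M y v \<in> carrier M"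
  and act_add_left: "v \<in> carrier M \<Longrightarrow> action M (y + z) v = action M y v \<oplus> action M z v"
  and act_scale_left: "v \<in> carrier M \<Longrightarrow> action M (lscale L c y) v = c \<odot> action M y v"
  and act_add: "v \<in> carrier M \<Longrightarrow> w \<in> carrier M \<Longrightarrow> action M y (v \<oplus> w) = action M y v \<oplus> action M y w"
  and act_smult: "v \<in> carrier M \<Longrightarrow> action M y (c \<odot> v) = c \<odot> action M y v"
  and act_parity: "y \<in> lparity L i \<Longrightarrow> v \<in> parity M j \<Longrightarrow> action M y v \<in> parity M (i + j)"
  and act_bracket: "y \<in> lparity L i \<Longrightarrow> z \<in> lparity L j \<Longrightarrow> v \<in> carrier M \<Longrightarrow>
        action M (bracket L y z) v =
          action M y (action M z v) \<ominus> koszul_sign i j \<odot> action M z (action M y v)"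
  and super: "super_vector_space M"
  using rep unfolding lie_module_def by auto

lemma act_zero [simp]: "action M y \<zero> = \<zero>"
  using act_smult[of \<zero> y 0] by simp

sublocale super_space M by (rule super_spaceI[OF super])

end

lemma lie_repI: "lie_module L M \<Longrightarrow> lie_rep M L"
  by (auto simp: lie_rep_def lie_rep_axioms_def lie_module_def intro: complex_moduleI)

text \<open>The space \<open>M\<^sub>+\<close>, with an arbitrary set of vectors in place of the Whittaker vectors, so that it can be compared along maps.\<close>

definition positive_submodule ::
    "(nat \<Rightarrow> bit) \<Rightarrow> nat list \<Rightarrow> (nat \<Rightarrow> 'a) \<Rightarrow> ('a, 'm) supermodule \<Rightarrow> 'm set \<Rightarrow> 'm set" where
  "positive_submodule p ks x M S =
     generated_subspace M
       {foldr (\<lambda>k. action M (x k)) w s | w s. w \<in> ordered_words p ks \<and> w \<noteq> [] \<and> s \<in> S}"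

text \<open>The module \<open>M\<close> is presented as the space of formal combinations of its elements modulo the kernel of the
evaluation map, which is a representation in the sense of \<open>action_mod\<close>.\<close>

locale whittaker_rep = whittaker_datum L gr \<mm> \<phi> order u x d par + lie_rep M L
  for L :: "'a::ab_group_add lie_super" and gr \<mm> \<phi> order u x d par
    and M :: "('a, 'm) supermodule" (structure)
begin

text \<open>The default \<open>\<zero>\<close> makes the evaluation defined and linear on all formal combinations, including those of values outside the carrier.\<close>

definition ev :: "('m \<Rightarrow>\<^sub>0 complex) \<Rightarrow> 'm" where
  "ev = lin_ext M (\<lambda>k. if k \<in> carrier M then k else \<zero>)"

definition free_act :: "'a \<Rightarrow> ('m \<Rightarrow>\<^sub>0 complex) \<Rightarrow> ('m \<Rightarrow>\<^sub>0 complex)" where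
  "free_act y = push_forward (\<lambda>k. if k \<in> carrier M then action M y k else k)"

abbreviation ker :: "('m \<Rightarrow>\<^sub>0 complex) set" where "ker \<equiv> {f. ev f = \<zero>}"

lemma ev_closed [simp]: "ev f \<in> carrier M"
  unfolding ev_def by (rule lin_ext_closed[OF supported_UNIV]) auto

lemma ev_add: "ev (f + g) = ev f \<oplus> ev g"
  unfolding ev_def by (rule lin_ext_add[OF supported_UNIV supported_UNIV]) auto

lemma ev_scale: "ev (scale_pm c f) = c \<odot> ev f"
  unfolding ev_def by (rule lin_ext_scale[OF supported_UNIV]) auto

lemma ev_diff: "ev (f - g) = ev f \<ominus> ev g"
  unfolding ev_def by (rule lin_ext_diff[OF supported_UNIV supported_UNIV]) auto

lemma ev_zero [simp]: "ev 0 = \<zero>"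
  by (simp add: ev_def)

lemma ev_single: "v \<in> carrier M \<Longrightarrow> ev (Poly_Mapping.single v 1) = v"
  by (simp add: ev_def lin_ext_single)

lemma ev_image_submodule:
  assumes "pm.subspace S"
  shows "submodule (ev ` S) complex_ring M"
proof (rule complex_submoduleI)
  show "\<zero> \<in> ev ` S" using pm.subspace_0[OF assms] by (intro image_eqI[of _ _ 0]) simp_all
  fix v w assume "v \<in> ev ` S" "w \<in> ev ` S"
  then obtain f g where "v = ev f" "w = ev g" "f \<in> S" "g \<in> S" by blast
  then show "v \<oplus> w \<in> ev ` S" using pm.subspace_add[OF assms] by (intro image_eqI[of _ _ "f + g"]) (auto simp: ev_add)
next
  fix c v assume "v \<in> ev ` S"
  then obtain f where "v = ev f" "f \<in> S" by blast
  then show "c \<odot> v \<in> ev ` S" using pm.subspace_scale[OF assms] by (intro image_eqI[of _ _ "scale_pm c f"]) (auto simp: ev_scale)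
qed auto

lemma ev_free_act: "ev (free_act y f) = action M y (ev f)"
proof -
  let ?B = "\<lambda>k. if k \<in> carrier M then k else \<zero>"
  have "ev (free_act y f) = lin_ext M (\<lambda>k. ?B (if k \<in> carrier M then action M y k else k)) f"
    unfolding ev_def free_act_def by (rule lin_ext_push_forward[OF supported_UNIV]) auto
  also have "\<dots> = lin_ext M (\<lambda>k. action M y (?B k)) f"
    by (rule lin_ext_cong[OF supported_UNIV]) auto
  also have "\<dots> = action M y (ev f)" unfolding ev_def
    by (rule linear_lin_ext[OF complex_module_axioms _ _ _ supported_UNIV, symmetric]) (auto simp: act_add act_smult)
  finally show ?thesis .
qed

sublocale A: action_mod L gr \<mm> \<phi> order u x d par scale_pm free_act ker
proof unfold_locales
  show "pm.subspace ker" by (rule pm.subspaceI) (auto simp: ev_add ev_scale)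
  show "free_act y (v + w) = free_act y v + free_act y w" for y v w
    by (simp add: free_act_def push_forward_add)
  show "free_act y (scale_pm c v) = scale_pm c (free_act y v)" for y c v
    by (simp add: free_act_def push_forward_scale)
  show "free_act y v \<in> ker" if "v \<in> ker" for v y using that by (simp add: ev_free_act)
  show "free_act (y + z) v - (free_act y v + free_act z v) \<in> ker" for y z v
    by (simp add: ev_diff ev_add ev_free_act act_add_left minus_zero_iff)
  show "free_act (lscale L c y) v - scale_pm c (free_act y v) \<in> ker" for c y v
    by (simp add: ev_diff ev_scale ev_free_act act_scale_left minus_zero_iff)
  show "free_act (bracket L y z) v -
       (free_act y (free_act z v) - scale_pm (koszul_sign i j) (free_act z (free_act y v))) \<in> ker"
    if "y \<in> lparity L i" "z \<in> lparity L j" for y i z j v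
    by (simp add: ev_diff ev_scale ev_free_act act_bracket[OF that] minus_zero_iff)
qed

abbreviation Whit :: "'m set" where "Whit \<equiv> whittaker_vectors \<mm> \<phi> M"

definition shiftM :: "'a \<Rightarrow> 'm \<Rightarrow> 'm" where
  "shiftM z v = action M z v \<ominus> \<phi> z \<odot> v"

lemma ev_shift: "ev (A.shift z f) = shiftM z (ev f)"
  by (simp add: A.shift_def shiftM_def ev_diff ev_scale ev_free_act)

lemma ev_shift_pow: "ev ((A.shift z ^^ n) f) = (shiftM z ^^ n) (ev f)"
  by (induction n) (auto simp: ev_shift)

lemma Whit_iff: "v \<in> Whit \<longleftrightarrow> v \<in> carrier M \<and> (\<forall>z\<in>\<mm>. shiftM z v = \<zero>)"
  by (auto simp: whittaker_vectors_def shiftM_def minus_zero_iff)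

lemma Fil0_iff: "f \<in> A.Fil 0 \<longleftrightarrow> ev f \<in> Whit"
proof
  assume f: "f \<in> A.Fil 0"
  have "A.shift z f \<in> ker" if "z \<in> \<mm>" for z
  proof (rule A.shift_span[OF subset_refl that[unfolded m_span] A.K_subspace subset_refl])
    fix i assume i: "i \<in> set order"
    show "A.shift (u i) f \<in> ker" using A.Fil_D[OF f i] A.Fil_neg[of "- d i"] d_pos[OF i] by simp
  qed
  then show "ev f \<in> Whit" by (simp add: Whit_iff ev_shift)
next
  assume "ev f \<in> Whit"
  then have "A.shift (u i) f \<in> ker" if "i \<in> set order" for i
    using u_in_m[OF that] by (simp add: Whit_iff ev_shift)
  then show "f \<in> A.Fil 0" using A.Fil_I[of 0 f] A.K_Fil by auto
qed

lemma ev_foldr: "ev (foldr (\<lambda>i. free_act (x i)) w f) = foldr (\<lambda>k. action M (x k)) w (ev f)"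
  by (induction w) (auto simp: ev_free_act)

abbreviation Pos :: "'m set \<Rightarrow> 'm set" where "Pos \<equiv> positive_submodule par order x M"

lemma foldr_closed: "s \<in> carrier M \<Longrightarrow> foldr (\<lambda>k. action M (x k)) w s \<in> carrier M"
  by (induction w) auto

lemma Whit_carrier: "v \<in> Whit \<Longrightarrow> v \<in> carrier M" by (simp add: whittaker_vectors_def)

lemma Pos_submodule: "S \<subseteq> carrier M \<Longrightarrow> submodule (Pos S) complex_ring M"
  unfolding positive_submodule_def generated_subspace_def
  by (rule generated_subspace_submodule) (use foldr_closed in auto)

lemma Pos_base:
  "w \<in> ordered_words par order \<Longrightarrow> w \<noteq> [] \<Longrightarrow> s \<in> S \<Longrightarrow> foldr (\<lambda>k. action M (x k)) w s \<in> Pos S"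
  unfolding positive_submodule_def generated_subspace_def by blast

lemma Pos_least:
  assumes "submodule H complex_ring M"
    "\<And>w s. w \<in> ordered_words par order \<Longrightarrow> w \<noteq> [] \<Longrightarrow> s \<in> S \<Longrightarrow> foldr (\<lambda>k. action M (x k)) w s \<in> H"
  shows "Pos S \<subseteq> H"
  unfolding positive_submodule_def generated_subspace_def using assms by blast

lemma Pos_iff: "v \<in> Pos Whit \<longleftrightarrow> (\<exists>f. v = ev f \<and> f \<in> A.positive_part)"
proof -
  have WW: "Whit \<subseteq> carrier M" using Whit_carrier by auto
  note P = complex_submoduleE[OF Pos_submodule[OF WW]]
  have 1: "ev f \<in> Pos Whit" if "f \<in> A.positive_part" for f
  proof -
    have "pm.subspace {f. ev f \<in> Pos Whit}"
      by (rule pm.subspaceI) (use P in \<open>auto simp: ev_add ev_scale\<close>)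
    moreover have "ev f \<in> Pos Whit"
      if "f \<in> ker \<union> {foldr (\<lambda>i. free_act (x i)) w v | w v. w \<in> ordered_words par order \<and> w \<noteq> [] \<and> v \<in> A.Fil 0}" for f
      using that P(2) Pos_base by (auto simp: ev_foldr Fil0_iff)
    ultimately show ?thesis
      using pm.span_subspace_induct[OF that[unfolded A.positive_part_def], of "{f. ev f \<in> Pos Whit}"] by auto
  qed
  have 2: "\<exists>f. v = ev f \<and> f \<in> A.positive_part" if "v \<in> Pos Whit"
  proof -
    have "Pos Whit \<subseteq> ev ` A.positive_part"
    proof (rule Pos_least)
      show "submodule (ev ` A.positive_part) complex_ring M"
        by (rule ev_image_submodule) (simp add: A.positive_part_def)
      fix w s assume w: "w \<in> ordered_words par order" "w \<noteq> []" "s \<in> Whit"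
      have s: "ev (Poly_Mapping.single s 1) = s" using w Whit_carrier ev_single by blast
      have "foldr (\<lambda>i. free_act (x i)) w (Poly_Mapping.single s 1) \<in> A.positive_part"
      proof -
        have "Poly_Mapping.single s 1 \<in> A.Fil 0" using w(3) s by (simp add: Fil0_iff)
        then show ?thesis unfolding A.positive_part_def using w by (intro pm.span_base) blast
      qed
      then show "foldr (\<lambda>k. action M (x k)) w s \<in> ev ` A.positive_part"
        using ev_foldr[of w "Poly_Mapping.single s 1"] s by (metis imageI)
    qed
    then show ?thesis using that by blast
  qed
  show ?thesis using 1 2 by blast
qed

lemma Whit_Pos_disjoint: "v \<in> Whit \<Longrightarrow> v \<in> Pos Whit \<Longrightarrow> v = \<zero>"
  using A.Whittaker_positive_disjoint by (auto simp: Pos_iff Fil0_iff)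

lemma WMod_iff: "WMod L \<mm> \<phi> M \<longleftrightarrow> (\<forall>z\<in>\<mm>. \<forall>v\<in>carrier M. \<exists>n. (shiftM z ^^ n) v = \<zero>)"
  unfolding WMod_def shiftM_def[abs_def] using rep by simp

lemma WMod_exhaustive: "WMod L \<mm> \<phi> M \<Longrightarrow> \<exists>n. f \<in> A.Fil n"
  by (rule A.Fil_exhaustive) (auto simp: ev_shift_pow WMod_iff u_in_m)

lemma Whit_decomposition:
  assumes "WMod L \<mm> \<phi> M" "v \<in> carrier M"
  shows "\<exists>w\<in>Whit. \<exists>z\<in>Pos Whit. v = w \<oplus> z"
proof -
  obtain n where "Poly_Mapping.single v 1 \<in> A.Fil n" using WMod_exhaustive[OF assms(1)] by blast
  from A.Whittaker_decomposition[OF this] obtain w where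
    w: "w \<in> A.Fil 0" "Poly_Mapping.single v 1 - w \<in> A.positive_part" by blast
  have "v = ev w \<oplus> ev (Poly_Mapping.single v 1 - w)"
    unfolding ev_add[symmetric] using ev_single[OF assms(2)] by simp
  then show ?thesis using w Pos_iff Fil0_iff by blast
qed

lemma submodule_meets_Whit:
  assumes "WMod L \<mm> \<phi> M" "submodule Z complex_ring M" "\<And>y v. v \<in> Z \<Longrightarrow> action M y v \<in> Z"
    and "\<And>v. v \<in> Z \<Longrightarrow> v \<in> Whit \<Longrightarrow> v = \<zero>" "v \<in> Z"
  shows "v = \<zero>"
proof -
  note Z = complex_submoduleE[OF assms(2)]
  obtain n where n: "Poly_Mapping.single v 1 \<in> A.Fil n" using WMod_exhaustive[OF assms(1)] by blast
  have v: "ev (Poly_Mapping.single v 1) = v" using ev_single Z(1) assms(5) by blast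
  have "Poly_Mapping.single v 1 \<in> ker"
  proof (rule A.subrep_meets_Whittaker[of "{f. ev f \<in> Z}", OF _ _ _ _ n])
    show "pm.subspace {f. ev f \<in> Z}" by (rule pm.subspaceI) (use Z in \<open>auto simp: ev_add ev_scale\<close>)
    show "A.shift (u i) f \<in> {f. ev f \<in> Z}" if "f \<in> {f. ev f \<in> Z}" for i f
      using that assms(3) Z by (auto simp: ev_shift shiftM_def)
  qed (use assms v in \<open>auto simp: Fil0_iff\<close>)
  then show ?thesis using v by simp
qed

text \<open>The union of the filtration is a submodule that contains the Whittaker vectors, and each element of \<open>\<mm>\<close>, shifted by its character, lowers the filtration.\<close>

lemma generated_WMod:
  assumes "\<And>H. submodule H complex_ring M \<Longrightarrow> Whit \<subseteq> H \<Longrightarrow> (\<And>y v. v \<in> H \<Longrightarrow> action M y v \<in> H) \<Longrightarrow> carrier M \<subseteq> H"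
  shows "WMod L \<mm> \<phi> M"
proof -
  have "carrier M \<subseteq> ev ` {f. \<exists>n. f \<in> A.Fil n}"
  proof (rule assms)
    show "submodule (ev ` {f. \<exists>n. f \<in> A.Fil n}) complex_ring M"
      by (rule ev_image_submodule[OF A.Fil_union_subspace])
    show "Whit \<subseteq> ev ` {f. \<exists>n. f \<in> A.Fil n}"
    proof
      fix v assume v: "v \<in> Whit"
      have e: "ev (Poly_Mapping.single v 1) = v" using v Whit_carrier ev_single by blast
      then have "Poly_Mapping.single v 1 \<in> A.Fil 0" using v by (simp add: Fil0_iff)
      then show "v \<in> ev ` {f. \<exists>n. f \<in> A.Fil n}" using e by (metis (mono_tags) image_eqI mem_Collect_eq)
    qed
    show "action M y v \<in> ev ` {f. \<exists>n. f \<in> A.Fil n}" if "v \<in> ev ` {f. \<exists>n. f \<in> A.Fil n}" for y v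
      using that A.Fil_union_act by (auto simp: ev_free_act[symmetric])
  qed
  then have ex: "\<exists>f n. v = ev f \<and> f \<in> A.Fil (int n)" if "v \<in> carrier M" for v
    using that A.Fil_mono by (smt (verit) image_iff int_nat_eq mem_Collect_eq nat_0_le subset_iff)
  show ?thesis unfolding WMod_iff
  proof (intro ballI)
    fix z v assume z: "z \<in> \<mm>" and v: "v \<in> carrier M"
    obtain f n where f: "v = ev f" "f \<in> A.Fil (int n)" using ex[OF v] by blast
    have "(shiftM z ^^ Suc n) v = \<zero>" using A.shift_nilpotent[OF f(2) z] unfolding f(1) ev_shift_pow[symmetric] by simp
    then show "\<exists>n. (shiftM z ^^ n) v = \<zero>" by blast
  qed
qed

end

section \<open>The free superalgebra\<close>

lemma single_mult_scale: "Poly_Mapping.single 0 c * f = scale_pm c (f :: 'a free_elem)"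
  by (simp add: scale_pm_def mult_map_scale_conv_mult)

lemma scale_pm_one: "scale_pm c (1 :: 'a free_elem) = Poly_Mapping.single 0 c"
  by (simp add: single_mult_scale[symmetric])

lemma scale_pm_mult_left [simp]: "scale_pm c f * g = scale_pm c (f * g :: 'a free_elem)"
  by (simp add: single_mult_scale[symmetric] mult.assoc)

lemma mult_single_const: "f * Poly_Mapping.single 0 c = scale_pm c (f :: 'a free_elem)"
  by (induction f rule: supported_induct[OF supported_UNIV])
     (auto simp: mult_single distrib_right pm.scale_right_distrib mult.commute)

lemma scale_pm_mult_right [simp]: "f * scale_pm c g = scale_pm c (f * g :: 'a free_elem)"
  by (metis mult.assoc mult_single_const single_mult_scale)

lemma single_Cons: "Poly_Mapping.single (Word (y # ys)) c = letter y * Poly_Mapping.single (Word ys) c"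
  by (simp add: letter_def mult_single plus_word_def)

lemma single_Nil: "Poly_Mapping.single (Word []) c = scale_pm c (1 :: 'a free_elem)"
  by (simp add: scale_pm_one zero_word_def)

lemma free_induct [case_names one add scale letter]:
  fixes f :: "'a free_elem"
  assumes "P 1" "\<And>f g. P f \<Longrightarrow> P g \<Longrightarrow> P (f + g)" "\<And>c f. P f \<Longrightarrow> P (scale_pm c f)" "\<And>y f. P f \<Longrightarrow> P (letter y * f)"
  shows "P f"
proof -
  have *: "P (Poly_Mapping.single (Word ys) c)" for ys c
    by (induction ys) (simp_all add: single_Nil single_Cons assms)
  have "P (Poly_Mapping.single w c)" for w c using *[of "letters w"] by simp
  moreover have "P 0" using assms(3)[OF assms(1), of 0] by simp
  ultimately show ?thesis
    using supported_induct[OF supported_UNIV, of P f] assms(2) by blast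
qed

locale free_superalgebra_of =
  fixes L :: "'a::ab_group_add lie_super"
begin

abbreviation F where "F \<equiv> free_superalgebra L"

lemma F_simps [simp]: "carrier F = UNIV" "f \<otimes>\<^bsub>F\<^esub> g = f * g" "\<one>\<^bsub>F\<^esub> = 1" "\<zero>\<^bsub>F\<^esub> = 0"
  "f \<oplus>\<^bsub>F\<^esub> g = f + g" "c \<odot>\<^bsub>F\<^esub> f = scale_pm c f" "parity F i = supported (word_parity L i)"
  by (simp_all add: free_superalgebra_def supported_def)

lemma ring_F: "Ring.ring F"
proof (rule ringI)
  show "abelian_group F"
    by (rule abelian_groupI) (auto simp: algebra_simps intro: exI[of _ "- _"] add.left_inverse)
  show "Group.monoid F" by (rule monoidI) (auto simp: algebra_simps)
qed (auto simp: algebra_simps)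

sublocale F: complex_module F
  unfolding complex_module_def
  by (rule moduleI[OF cring_complex_ring])
     (use ring_F Ring.ring.is_abelian_group in \<open>auto simp: pm.scale_left_distrib pm.scale_right_distrib\<close>)

lemma F_minus [simp]: "f \<ominus>\<^bsub>F\<^esub> g = f - g"
  by (simp add: F.minus_smult pm.scale_minus_left)

abbreviation E where "E \<equiv> enveloping_ideal L"

lemma E_ideal: "ideal E F"
  unfolding enveloping_ideal_def by (rule ring.genideal_ideal[OF ring_F]) simp

lemma E_mult: "f \<in> E \<Longrightarrow> g * f \<in> E" "f \<in> E \<Longrightarrow> f * g \<in> E"
  using ideal.I_l_closed[OF E_ideal, of f g] ideal.I_r_closed[OF E_ideal, of f g] by auto

lemma E_subspace: "pm.subspace E"
proof -
  interpret E: ideal E F by (rule E_ideal)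
  show ?thesis
  proof (rule pm.subspaceI)
    show "0 \<in> E" using E.zero_closed by simp
    show "f + g \<in> E" if "f \<in> E" "g \<in> E" for f g using E.a_closed[OF that] by simp
    show "scale_pm c f \<in> E" if "f \<in> E" for c f using E_mult(1)[OF that, of "Poly_Mapping.single 0 c"]
      by (simp add: single_mult_scale)
  qed
qed

lemmas E = pm.subspace_0[OF E_subspace] pm.subspace_add[OF E_subspace] pm.subspace_scale[OF E_subspace]
  pm.subspace_diff[OF E_subspace]

lemma E_relations: "enveloping_relations L \<subseteq> E"
  unfolding enveloping_ideal_def by (rule ring.genideal_self[OF ring_F]) simp

lemma E_letter_add: "letter (y + z) - letter y - letter z \<in> E"
  using E_relations unfolding enveloping_relations_def by blast

lemma E_letter_scale: "letter (lscale L c y) - scale_pm c (letter y) \<in> E"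
  using E_relations unfolding enveloping_relations_def by blast

lemma E_letter_bracket: "y \<in> lparity L i \<Longrightarrow> z \<in> lparity L j \<Longrightarrow>
   letter y * letter z - scale_pm (koszul_sign i j) (letter z * letter y) - letter (bracket L y z) \<in> E"
  using E_relations unfolding enveloping_relations_def by blast

lemma E_least:
  assumes "pm.subspace T" "\<And>f g. f \<in> T \<Longrightarrow> g * f \<in> T" "\<And>f g. f \<in> T \<Longrightarrow> f * g \<in> T"
    and "\<And>y z. letter (y + z) - letter y - letter z \<in> T"
    and "\<And>c y. letter (lscale L c y) - scale_pm c (letter y) \<in> T"
    and "\<And>y z i j. y \<in> lparity L i \<Longrightarrow> z \<in> lparity L j \<Longrightarrow>
       letter y * letter z - scale_pm (koszul_sign i j) (letter z * letter y) - letter (bracket L y z) \<in> T"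
  shows "E \<subseteq> T"
  unfolding enveloping_ideal_def
proof (rule ring.genideal_minimal[OF ring_F])
  show "ideal T F"
  proof (rule idealI[OF ring_F])
    show "subgroup T (add_monoid F)"
      using F.complex_submoduleI[of T] assms(1) by (auto simp: submodule_def pm.subspace_def)
  qed (use assms in auto)
  show "enveloping_relations L \<subseteq> T" using assms unfolding enveloping_relations_def by auto
qed

lemma E_submodule: "submodule E complex_ring F"
  by (rule F.complex_submoduleI) (use E in auto)

sublocale QU: quotient_module F E
  by (intro quotient_module.intro quotient_module_axioms.intro F.complex_module_axioms E_submodule)

abbreviation U where "U \<equiv> enveloping_algebra L"
definition cl :: "'a free_elem \<Rightarrow> 'a env_elem" where "cl f = E +>\<^bsub>F\<^esub> f"

lemma cl_eq: "cl f = cl g \<longleftrightarrow> f - g \<in> E"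
  unfolding cl_def using QU.coset_eq[of f g] by simp

lemma U_carrier: "carrier U = range cl"
  unfolding enveloping_algebra_def QU.quotient_carrier by (auto simp: cl_def)

lemma cl_carrier [simp]: "cl f \<in> carrier U" by (simp add: U_carrier)

lemma U_add: "cl f \<oplus>\<^bsub>U\<^esub> cl g = cl (f + g)"
  unfolding enveloping_algebra_def cl_def using QU.quotient_add[of f g] by simp

lemma U_smult: "c \<odot>\<^bsub>U\<^esub> cl f = cl (scale_pm c f)"
  unfolding enveloping_algebra_def cl_def using QU.quotient_smult[of f c] by simp

lemma U_zero: "\<zero>\<^bsub>U\<^esub> = cl 0"
  unfolding enveloping_algebra_def cl_def using QU.quotient_zero QU.coset_zero by simp

lemma U_one: "\<one>\<^bsub>U\<^esub> = cl 1"
  unfolding enveloping_algebra_def cl_def using QU.quotient_one by simp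

lemma U_mult: "cl f \<otimes>\<^bsub>U\<^esub> cl g = cl (f * g)"
  unfolding enveloping_algebra_def cl_def using ideal.rcoset_mult_add[OF E_ideal, of f g]
  by (simp add: quotient_superspace_def FactRing_def)

lemma U_parity: "parity U i = cl ` supported (word_parity L i)"
  unfolding enveloping_algebra_def QU.quotient_parity by (auto simp: cl_def)

lemma env_embed_cl: "env_embed L y = cl (letter y)"
  by (simp add: env_embed_def cl_def)

sublocale U: complex_module U
  unfolding enveloping_algebra_def by (rule QU.quotient_is_module)

lemma U_minus: "cl f \<ominus>\<^bsub>U\<^esub> cl g = cl (f - g)"
  by (simp add: U.minus_smult U_add U_smult pm.scale_minus_left)

lemma mem_cl: "g \<in> cl f \<longleftrightarrow> g - f \<in> E"
  unfolding cl_def using QU.mem_coset[of f g] by simp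

end

context lie_superalgebra begin

sublocale FS: free_superalgebra_of L .

text \<open>The parity involution of \<open>\<aa>\<close>.\<close>

definition inv_L :: "'a \<Rightarrow> 'a" where
  "inv_L z = (let p = (THE p. fst p \<in> lparity L 0 \<and> snd p \<in> lparity L 1 \<and> z = fst p + snd p) in fst p - snd p)"

lemma lparity_split: obtains a b where "a \<in> lparity L 0" "b \<in> lparity L 1" "z = a + b"
  using parity_decomposition[of z] by blast

lemma inv_L_eq: "a \<in> lparity L 0 \<Longrightarrow> b \<in> lparity L 1 \<Longrightarrow> inv_L (a + b) = a - b"
proof -
  assume ab: "a \<in> lparity L 0" "b \<in> lparity L 1"
  have "(THE p. fst p \<in> lparity L 0 \<and> snd p \<in> lparity L 1 \<and> a + b = fst p + snd p) = (a, b)"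
    by (rule the1_equality[OF parity_decomposition]) (use ab in auto)
  then show ?thesis by (simp add: inv_L_def)
qed

lemmas lpar = lie.subspace_0[OF parity_subspace] lie.subspace_add[OF parity_subspace]
  lie.subspace_scale[OF parity_subspace] lie.subspace_neg[OF parity_subspace]

lemma inv_L_add: "inv_L (y + z) = inv_L y + inv_L z"
proof -
  obtain a b where y: "a \<in> lparity L 0" "b \<in> lparity L 1" "y = a + b" by (rule lparity_split)
  obtain a' b' where z: "a' \<in> lparity L 0" "b' \<in> lparity L 1" "z = a' + b'" by (rule lparity_split)
  have e: "y + z = (a + a') + (b + b')" using y z by simp
  have "inv_L (y + z) = (a + a') - (b + b')" unfolding e by (rule inv_L_eq) (use y z lpar in auto)
  then show ?thesis using inv_L_eq y z by simp
qed

lemma inv_L_scale: "inv_L (lscale L c z) = lscale L c (inv_L z)"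
proof -
  obtain a b where y: "a \<in> lparity L 0" "b \<in> lparity L 1" "z = a + b" by (rule lparity_split)
  then show ?thesis using inv_L_eq[of "lscale L c a" "lscale L c b"] inv_L_eq[of a b] lpar
    by (simp add: lie.scale_right_distrib lie.scale_right_diff_distrib)
qed

lemma inv_L_parity: "z \<in> lparity L i \<Longrightarrow> inv_L z = lscale L (koszul_sign i i) z"
  using inv_L_eq[of z 0] inv_L_eq[of 0 z] lpar by (cases i) auto

lemma inv_L_inv_L [simp]: "inv_L (inv_L z) = z"
proof -
  obtain a b where y: "a \<in> lparity L 0" "b \<in> lparity L 1" "z = a + b" by (rule lparity_split)
  then show ?thesis using inv_L_eq[of a b] inv_L_eq[of a "- b"] lpar by simp
qed

lemma koszul_sign_diag_add: "koszul_sign (i + j) (i + j) = koszul_sign i i * koszul_sign j j"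
  by (cases i; cases j) (simp_all add: koszul_sign_def)

lemma inv_L_bracket: "y \<in> lparity L i \<Longrightarrow> z \<in> lparity L j \<Longrightarrow> bracket L (inv_L y) (inv_L z) = inv_L (bracket L y z)"
  using inv_L_parity[OF bracket_parity[of y i z j]] unfolding koszul_sign_diag_add
  by (simp add: inv_L_parity bracket_scale_left bracket_scale_right mult.commute)

lemma inv_L_mem: "z \<in> lparity L i \<Longrightarrow> inv_L z \<in> lparity L i"
  using lpar by (simp add: inv_L_parity)

text \<open>The algebra endomorphism of the free algebra that extends \<open>inv_L\<close>; it preserves the enveloping relations and so descends to \<open>U(\<aa>)\<close>.\<close>

definition free_inv :: "'a free_elem \<Rightarrow> 'a free_elem" where
  "free_inv = push_forward (\<lambda>w. Word (map inv_L (letters w)))"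

lemma free_inv_add: "free_inv (f + g) = free_inv f + free_inv g"
  and free_inv_scale: "free_inv (scale_pm c f) = scale_pm c (free_inv f)"
  and free_inv_diff: "free_inv (f - g) = free_inv f - free_inv g"
  and free_inv_zero [simp]: "free_inv 0 = 0"
  by (simp_all add: free_inv_def push_forward_add push_forward_scale push_forward_diff)

lemma free_inv_letter: "free_inv (letter y) = letter (inv_L y)"
  by (simp add: free_inv_def letter_def)

lemma free_inv_one [simp]: "free_inv 1 = 1"
  by (simp add: free_inv_def single_one[symmetric] zero_word_def del: single_one)

lemma free_inv_mult: "free_inv (f * g) = free_inv f * free_inv g"
proof (induction f rule: supported_induct[OF supported_UNIV])
  case (2 k c)
  show ?case
    by (induction g rule: supported_induct[OF supported_UNIV])
       (auto simp: free_inv_def mult_single plus_word_def push_forward_add distrib_left)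
qed (auto simp: free_inv_add distrib_right)

lemma free_inv_E: "f \<in> FS.E \<Longrightarrow> free_inv f \<in> FS.E"
proof -
  have "FS.E \<subseteq> {f. free_inv f \<in> FS.E}"
  proof (rule FS.E_least)
    show "pm.subspace {f. free_inv f \<in> FS.E}"
      by (rule pm.subspaceI) (auto simp: free_inv_add free_inv_scale FS.E)
    show "letter (y + z) - letter y - letter z \<in> {f. free_inv f \<in> FS.E}" for y z
      using FS.E_letter_add by (simp add: free_inv_diff free_inv_letter inv_L_add)
    show "letter (lscale L c y) - scale_pm c (letter y) \<in> {f. free_inv f \<in> FS.E}" for c y
      using FS.E_letter_scale by (simp add: free_inv_diff free_inv_scale free_inv_letter inv_L_scale)
    show "letter y * letter z - scale_pm (koszul_sign i j) (letter z * letter y) - letter (bracket L y z)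
      \<in> {f. free_inv f \<in> FS.E}" if "y \<in> lparity L i" "z \<in> lparity L j" for y z i j
      using FS.E_letter_bracket[OF inv_L_mem inv_L_mem, OF that]
      by (simp add: free_inv_diff free_inv_scale free_inv_letter free_inv_mult inv_L_bracket[OF that])
  qed (auto simp: free_inv_mult FS.E_mult)
  then show "f \<in> FS.E \<Longrightarrow> free_inv f \<in> FS.E" by auto
qed

lemma free_inv_parity:
  assumes "f \<in> supported (word_parity L i)"
  shows "free_inv f - scale_pm (koszul_sign i i) f \<in> FS.E"
proof -
  have word: "free_inv (Poly_Mapping.single (Word ys) c) - scale_pm (koszul_sign (sum_list js) (sum_list js)) (Poly_Mapping.single (Word ys) c) \<in> FS.E"
    if "list_all2 (\<lambda>x j. x \<in> lparity L j) ys js" for ys js c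
    using that
  proof (induction rule: list_all2_induct)
    case Nil
    show ?case by (simp add: free_inv_def FS.E)
  next
    case (Cons y ys j js)
    let ?w = "Poly_Mapping.single (Word ys) c" and ?a = "koszul_sign j j" and ?b = "koszul_sign (sum_list js) (sum_list js)"
    have 1: "letter (inv_L y) - scale_pm ?a (letter y) \<in> FS.E"
      using FS.E_letter_scale[of ?a y] inv_L_parity[OF Cons(1)] by simp
    let ?r = "(letter (inv_L y) - scale_pm ?a (letter y)) * free_inv ?w
        + scale_pm ?a (letter y) * (free_inv ?w - scale_pm ?b ?w)"
    have "?r \<in> FS.E"
      by (rule FS.E(2)[OF FS.E_mult(2)[OF 1] FS.E_mult(1)[OF Cons.IH]])
    moreover have "?r = free_inv (Poly_Mapping.single (Word (y # ys)) c)
       - scale_pm (koszul_sign (sum_list (j # js)) (sum_list (j # js))) (Poly_Mapping.single (Word (y # ys)) c)"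
    proof -
      have k: "koszul_sign (sum_list (j # js)) (sum_list (j # js)) = ?a * ?b"
        by (simp only: sum_list.Cons koszul_sign_diag_add)
      show ?thesis unfolding single_Cons free_inv_mult free_inv_letter k
        by (simp add: algebra_simps pm.scale_right_diff_distrib del: scale_pm_single)
    qed
    ultimately show ?case by simp
  qed
  show ?thesis using assms
  proof (induction f rule: supported_induct)
    case (single w c)
    then obtain js where "list_all2 (\<lambda>x j. x \<in> lparity L j) (letters w) js" "sum_list js = i"
      by (auto simp: word_parity_def)
    then show ?case using word[of "letters w" js c] by simp
  next
    case (add f g)
    have "free_inv (f + g) - scale_pm (koszul_sign i i) (f + g) =
      (free_inv f - scale_pm (koszul_sign i i) f) + (free_inv g - scale_pm (koszul_sign i i) g)"
      by (simp add: free_inv_add pm.scale_right_distrib)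
    then show ?case using FS.E(2)[OF add(3,4)] by simp
  qed (simp add: FS.E)
qed

lemma letter_parity:
  assumes "y \<in> lparity L i" "f \<in> supported (word_parity L j)"
  shows "letter y * f \<in> supported (word_parity L (i + j))"
  using assms(2)
proof (induction f rule: supported_induct)
  case (single w c)
  then obtain js where "list_all2 (\<lambda>x j. x \<in> lparity L j) (letters w) js" "sum_list js = j"
    by (auto simp: word_parity_def)
  with assms(1) have "Word (y # letters w) \<in> word_parity L (i + j)"
    unfolding word_parity_def by (auto intro!: exI[of _ "i # js"])
  then show ?case by (simp add: letter_def mult_single plus_word_def)
qed (auto simp: distrib_left pm.subspace_add[OF supported_subspace] pm.subspace_0[OF supported_subspace])

text \<open>Modulo linearity of \<open>\<aa> \<rightarrow> U(\<aa>)\<close>, every letter splits into an even and an odd letter.\<close>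

lemma free_parity_ex:
  "\<exists>a\<in>supported (word_parity L 0). \<exists>b\<in>supported (word_parity L 1). f - (a + b) \<in> FS.E"
proof (induction f rule: free_induct)
  case one
  have "1 \<in> supported (word_parity L 0)" by (auto simp: supported_def word_parity_def zero_word_def)
  then show ?case using FS.E pm.subspace_0[OF supported_subspace] by (intro bexI[of _ 1] bexI[of _ 0]) auto
next
  case (add f g)
  then obtain a b a' b' where *: "a \<in> supported (word_parity L 0)" "b \<in> supported (word_parity L 1)"
    "a' \<in> supported (word_parity L 0)" "b' \<in> supported (word_parity L 1)" "f - (a + b) \<in> FS.E" "g - (a' + b') \<in> FS.E" by blast
  have "f + g - ((a + a') + (b + b')) \<in> FS.E" using FS.E(2)[OF *(5,6)] by (simp add: algebra_simps)
  then show ?case using * pm.subspace_add[OF supported_subspace] by blast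
next
  case (scale c f)
  then obtain a b where *: "a \<in> supported (word_parity L 0)" "b \<in> supported (word_parity L 1)" "f - (a + b) \<in> FS.E" by blast
  have "scale_pm c f - (scale_pm c a + scale_pm c b) \<in> FS.E"
    using FS.E(3)[OF *(3), of c] by (simp add: pm.scale_right_distrib pm.scale_right_diff_distrib)
  then show ?case using * pm.subspace_scale[OF supported_subspace] by blast
next
  case (letter y f)
  then obtain a b where *: "a \<in> supported (word_parity L 0)" "b \<in> supported (word_parity L 1)" "f - (a + b) \<in> FS.E" by blast
  obtain y0 y1 where y: "y0 \<in> lparity L 0" "y1 \<in> lparity L 1" "y = y0 + y1" by (rule lparity_split)
  have "(letter y - letter y0 - letter y1) * f + (letter y0 + letter y1) * (f - (a + b)) \<in> FS.E"
    using FS.E(2)[OF FS.E_mult(2)[OF FS.E_letter_add[of y0 y1], of f] FS.E_mult(1)[OF *(3), of "letter y0 + letter y1"]] y(3)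
    by simp
  then have 1: "letter y * f - ((letter y0 * a + letter y1 * b) + (letter y0 * b + letter y1 * a)) \<in> FS.E"
    by (simp add: algebra_simps)
  have "letter y0 * a + letter y1 * b \<in> supported (word_parity L 0)"
    "letter y0 * b + letter y1 * a \<in> supported (word_parity L 1)"
    using letter_parity[OF y(1) *(1)] letter_parity[OF y(2) *(2)] letter_parity[OF y(1) *(2)] letter_parity[OF y(2) *(1)]
      pm.subspace_add[OF supported_subspace] by simp_all
  then show ?case using 1 by blast
qed

lemma U_super: "super_vector_space FS.U"
  unfolding enveloping_algebra_def
proof (rule FS.QU.quotient_super[where t = free_inv])
  show "submodule (parity FS.F i) complex_ring FS.F" for i
    by (rule FS.F.complex_submoduleI)
       (auto intro: pm.subspace_0 pm.subspace_add pm.subspace_scale supported_subspace)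
  show "\<exists>a\<in>parity FS.F 0. \<exists>b\<in>parity FS.F 1. v \<ominus>\<^bsub>FS.F\<^esub> (a \<oplus>\<^bsub>FS.F\<^esub> b) \<in> FS.E" for v
    using free_parity_ex[of v] by simp
qed (auto simp: free_inv_add free_inv_scale free_inv_E free_inv_parity)

end

section \<open>The action of the enveloping algebra\<close>

context lie_rep begin

lemma free_action_lin_ext: "free_action M f v = lin_ext M (\<lambda>w. foldr (action M) (letters w) v) f"
  by (simp add: free_action_def lin_ext_def)

lemma foldr_act_closed: "v \<in> carrier M \<Longrightarrow> foldr (action M) ys v \<in> carrier M"
  by (induction ys) auto

lemma rho_closed [simp]: "v \<in> carrier M \<Longrightarrow> free_action M f v \<in> carrier M"
  unfolding free_action_lin_ext by (rule lin_ext_closed[OF supported_UNIV]) (simp add: foldr_act_closed)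

lemma rho_add_left: "v \<in> carrier M \<Longrightarrow> free_action M (f + g) v = free_action M f v \<oplus> free_action M g v"
  unfolding free_action_lin_ext by (rule lin_ext_add[OF supported_UNIV supported_UNIV]) (simp add: foldr_act_closed)

lemma rho_scale_left: "v \<in> carrier M \<Longrightarrow> free_action M (scale_pm c f) v = c \<odot> free_action M f v"
  unfolding free_action_lin_ext by (rule lin_ext_scale[OF supported_UNIV]) (simp add: foldr_act_closed)

lemma rho_diff_left: "v \<in> carrier M \<Longrightarrow> free_action M (f - g) v = free_action M f v \<ominus> free_action M g v"
  unfolding free_action_lin_ext by (rule lin_ext_diff[OF supported_UNIV supported_UNIV]) (simp add: foldr_act_closed)

lemma rho_single: "v \<in> carrier M \<Longrightarrow> free_action M (Poly_Mapping.single w c) v = c \<odot> foldr (action M) (letters w) v"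
  unfolding free_action_lin_ext by (rule lin_ext_single) (simp add: foldr_act_closed)

lemma rho_zero_left [simp]: "free_action M 0 v = \<zero>"
  by (simp add: free_action_lin_ext)

lemma rho_one [simp]: "v \<in> carrier M \<Longrightarrow> free_action M 1 v = v"
  using rho_single[of v "Word []" 1] by (simp add: single_Nil)

lemma rho_letter_mult: "v \<in> carrier M \<Longrightarrow> free_action M (letter y * f) v = action M y (free_action M f v)"
proof (induction f rule: supported_induct[OF supported_UNIV])
  case (2 w c)
  have "letter y * Poly_Mapping.single w c = Poly_Mapping.single (Word (y # letters w)) c"
    by (simp add: letter_def mult_single plus_word_def)
  then show ?case using 2 by (simp add: rho_single act_smult foldr_act_closed)
next
  case 1
  then show ?case by (simp add: free_action_lin_ext)
qed (auto simp: distrib_left rho_add_left act_add)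

lemma rho_letter [simp]: "v \<in> carrier M \<Longrightarrow> free_action M (letter y) v = action M y v"
  using rho_letter_mult[of v y 1] by simp

lemma rho_mult: "v \<in> carrier M \<Longrightarrow> free_action M (f * g) v = free_action M f (free_action M g v)"
  by (induction f rule: free_induct)
     (auto simp: distrib_right rho_add_left rho_scale_left rho_letter_mult mult.assoc)

lemma rho_add: "v \<in> carrier M \<Longrightarrow> w \<in> carrier M \<Longrightarrow> free_action M f (v \<oplus> w) = free_action M f v \<oplus> free_action M f w"
  by (induction f rule: free_induct)
     (auto simp: rho_add_left rho_scale_left rho_letter_mult smult_add act_add M.a_ac)

lemma rho_smult: "v \<in> carrier M \<Longrightarrow> free_action M f (c \<odot> v) = c \<odot> free_action M f v"
  by (induction f rule: free_induct)
     (auto simp: rho_add_left rho_scale_left rho_letter_mult smult_add act_smult mult.commute)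

lemma rho_stable:
  assumes "submodule H complex_ring M" "\<And>y v. v \<in> H \<Longrightarrow> action M y v \<in> H" "v \<in> H"
  shows "free_action M f v \<in> H"
proof -
  have "v \<in> carrier M" using complex_submoduleE(1)[OF assms(1)] assms(3) by auto
  then show ?thesis using complex_submoduleE(3,4)[OF assms(1)] assms(2,3)
    by (induction f rule: free_induct) (auto simp: rho_add_left rho_scale_left rho_letter_mult)
qed

lemma rho_parity:
  assumes "f \<in> supported (word_parity L i)" "v \<in> parity M j"
  shows "free_action M f v \<in> parity M (i + j)"
  unfolding free_action_lin_ext
proof (rule lin_ext_mem_submodule[OF parity_submodule assms(1)])
  fix w assume "w \<in> word_parity L i"
  then obtain js where "list_all2 (\<lambda>x j. x \<in> lparity L j) (letters w) js" "sum_list js = i"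
    by (auto simp: word_parity_def)
  then show "foldr (action M) (letters w) v \<in> parity M (i + j)"
  proof (induction "letters w" js arbitrary: w i rule: list_all2_induct)
    case Nil then show ?case using assms(2) by (cases j) (simp_all add: Nil(1)[symmetric] del: Nil)
  next
    case (Cons y ys k ks)
    have "foldr (action M) (letters (Word ys)) v \<in> parity M (sum_list ks + j)" by (rule Cons(3)) simp_all
    then show ?case using act_parity[OF Cons(1)] unfolding Cons(4)[symmetric] Cons(5)[symmetric]
      by (simp only: sum_list.Cons add.assoc foldr.simps comp_apply word.sel)
  qed
qed

end

locale lie_superalgebra_rep = lie_superalgebra L + lie_rep M L
  for L :: "'a::ab_group_add lie_super" and M :: "('a, 'm) supermodule" (structure)
begin

lemma rho_E: "f \<in> FS.E \<Longrightarrow> v \<in> carrier M \<Longrightarrow> free_action M f v = \<zero>"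
proof -
  have "FS.E \<subseteq> {f. \<forall>v\<in>carrier M. free_action M f v = \<zero>}"
  proof (rule FS.E_least)
    show "pm.subspace {f. \<forall>v\<in>carrier M. free_action M f v = \<zero>}"
      by (rule pm.subspaceI) (auto simp: rho_add_left rho_scale_left)
    show "g * f \<in> {f. \<forall>v\<in>carrier M. free_action M f v = \<zero>}"
      if "f \<in> {f. \<forall>v\<in>carrier M. free_action M f v = \<zero>}" for f g
      using that rho_smult[of \<zero> g 0] by (auto simp: rho_mult)
    show "letter y * letter z - scale_pm (koszul_sign i j) (letter z * letter y) - letter (bracket L y z)
       \<in> {f. \<forall>v\<in>carrier M. free_action M f v = \<zero>}" if "y \<in> lparity L i" "z \<in> lparity L j" for y z i j
      using act_bracket[OF that]
      by (auto simp: rho_diff_left rho_scale_left rho_letter_mult minus_zero_iff)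
  qed (auto simp: rho_mult diff_diff_add rho_diff_left rho_add_left rho_scale_left act_add_left act_scale_left minus_zero_iff)
  then show "f \<in> FS.E \<Longrightarrow> v \<in> carrier M \<Longrightarrow> free_action M f v = \<zero>" by blast
qed

lemma env_action_cl:
  assumes "v \<in> carrier M"
  shows "env_action M (FS.cl f) v = free_action M f v"
proof -
  have "free_action M g v = free_action M f v" if "g \<in> FS.cl f" for g
    using rho_E[of "g - f" v] that assms by (simp add: FS.mem_cl rho_diff_left minus_zero_iff)
  moreover have "f \<in> FS.cl f" by (simp add: FS.mem_cl FS.E)
  ultimately have "(\<lambda>f. free_action M f v) ` FS.cl f = {free_action M f v}" by blast
  then show ?thesis by (simp add: env_action_def)
qed

end

section \<open>Q and W\<close>

context whittaker_character
begin

lemmas m_rules = lie.subspace_0[OF m_subspace] lie.subspace_add[OF m_subspace] lie.subspace_scale[OF m_subspace]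
  lie.subspace_diff[OF m_subspace]

lemma inv_L_m: "z \<in> \<mm> \<Longrightarrow> inv_L z \<in> \<mm>" "z \<in> \<mm> \<Longrightarrow> \<phi> (inv_L z) = \<phi> z"
proof -
  assume "z \<in> \<mm>"
  then obtain a b where ab: "a \<in> \<mm>" "a \<in> lparity L 0" "b \<in> \<mm>" "b \<in> lparity L 1" "z = a + b" using m_super by blast
  have i: "inv_L z = a + lscale L (-1) b" using ab inv_L_eq by simp
  show "inv_L z \<in> \<mm>" unfolding i using ab m_rules by auto
  have "\<phi> (inv_L z) = \<phi> a" unfolding i using ab phi_odd m_rules(3)[of b "-1"]
    by (simp add: phi_add phi_scale del: lie.scale_minus_left)
  moreover have "\<phi> z = \<phi> a" using ab phi_odd by (simp add: phi_add)
  ultimately show "\<phi> (inv_L z) = \<phi> z" by simp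
qed

text \<open>The element \<open>z - \<phi>(z)\<close> of the free algebra.\<close>

definition sh :: "'a \<Rightarrow> 'a free_elem" where "sh z = letter z - scale_pm (\<phi> z) 1"

abbreviation I where "I \<equiv> whittaker_ideal L \<mm> \<phi>"

lemma shifted_cl: "shifted L \<phi> z = FS.cl (sh z)"
  by (simp add: shifted_def Let_def FS.env_embed_cl FS.U_one FS.U_smult FS.U_minus sh_def)

lemma left_ideal_iff:
  "left_ideal T FS.U \<longleftrightarrow> submodule T complex_ring FS.U \<and> (\<forall>f. \<forall>b\<in>T. FS.cl f \<otimes>\<^bsub>FS.U\<^esub> b \<in> T)"
proof
  assume T: "left_ideal T FS.U"
  then have m: "\<forall>f. \<forall>b\<in>T. FS.cl f \<otimes>\<^bsub>FS.U\<^esub> b \<in> T" and s: "subgroup T (add_monoid FS.U)"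
    by (auto simp: left_ideal_def additive_subgroup_def)
  have "c \<odot>\<^bsub>FS.U\<^esub> b \<in> T" if "b \<in> T" for c b
  proof -
    have "b \<in> carrier FS.U" using s that subgroup.subset by fastforce
    then obtain f where f: "b = FS.cl f" by (auto simp: FS.U_carrier)
    have "FS.cl (Poly_Mapping.single 0 c) \<otimes>\<^bsub>FS.U\<^esub> b \<in> T" using m that by blast
    then show ?thesis by (simp add: f FS.U_mult FS.U_smult single_mult_scale)
  qed
  then show "submodule T complex_ring FS.U \<and> (\<forall>f. \<forall>b\<in>T. FS.cl f \<otimes>\<^bsub>FS.U\<^esub> b \<in> T)"
    using m s by (auto simp: submodule_def submodule_axioms_def)
next
  assume "submodule T complex_ring FS.U \<and> (\<forall>f. \<forall>b\<in>T. FS.cl f \<otimes>\<^bsub>FS.U\<^esub> b \<in> T)"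
  then show "left_ideal T FS.U"
    by (auto simp: left_ideal_def additive_subgroup_def submodule_def FS.U_carrier)
qed

lemma I_left_ideal: "left_ideal I FS.U"
proof -
  have top: "left_ideal (carrier FS.U) FS.U"
    using FS.U.carrier_is_submodule by (auto simp: left_ideal_iff FS.U_carrier FS.U_mult)
  show ?thesis unfolding left_ideal_iff
  proof (intro conjI allI ballI FS.U.complex_submoduleI)
    show "I \<subseteq> carrier FS.U" using top by (auto simp: whittaker_ideal_def shifted_cl)
  qed (auto simp: whittaker_ideal_def left_ideal_iff dest: FS.U.complex_submoduleE)
qed

lemma I_submodule: "submodule I complex_ring FS.U" using I_left_ideal left_ideal_iff by blast

sublocale QQ: quotient_module FS.U I
  by (intro quotient_module.intro quotient_module_axioms.intro FS.U.complex_module_axioms I_submodule)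

text \<open>The preimage of the Whittaker ideal in the free algebra, so that \<open>Q\<close> is the free algebra modulo \<open>J\<close>.  It is the
smallest left ideal that contains the enveloping ideal and the elements \<open>z - \<phi>(z)\<close> (\<open>J_least\<close>).\<close>

definition J :: "'a free_elem set" where "J = {f. FS.cl f \<in> I}"

lemma J_subspace: "pm.subspace J"
  by (rule pm.subspaceI)
     (use FS.U.complex_submoduleE[OF I_submodule] in \<open>auto simp: J_def FS.U_zero FS.U_add[symmetric] FS.U_smult[symmetric]\<close>)

lemmas J_rules = pm.subspace_0[OF J_subspace] pm.subspace_add[OF J_subspace] pm.subspace_scale[OF J_subspace]
  pm.subspace_diff[OF J_subspace]

lemma J_mult: "f \<in> J \<Longrightarrow> g * f \<in> J"
  using I_left_ideal by (auto simp: J_def left_ideal_iff FS.U_mult[symmetric])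

lemma E_J: "f \<in> FS.E \<Longrightarrow> f \<in> J"
proof -
  assume "f \<in> FS.E"
  then have "FS.cl f = FS.cl 0" using FS.cl_eq by simp
  then show ?thesis using J_rules(1) by (simp add: J_def)
qed

lemma sh_J: "z \<in> \<mm> \<Longrightarrow> sh z \<in> J"
  by (auto simp: J_def whittaker_ideal_def shifted_cl[symmetric])

lemma J_least:
  assumes T: "pm.subspace T" "\<And>f g. f \<in> T \<Longrightarrow> g * f \<in> T" "FS.E \<subseteq> T" "\<And>z. z \<in> \<mm> \<Longrightarrow> sh z \<in> T"
  shows "J \<subseteq> T"
proof -
  have "left_ideal (FS.cl ` T) FS.U"
    unfolding left_ideal_iff
  proof (intro conjI allI ballI FS.U.complex_submoduleI)
    show "\<zero>\<^bsub>FS.U\<^esub> \<in> FS.cl ` T" using pm.subspace_0[OF T(1)] by (auto simp: FS.U_zero)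
  qed (auto simp: FS.U_add FS.U_smult FS.U_mult T pm.subspace_add[OF T(1)] pm.subspace_scale[OF T(1)])
  then have "I \<subseteq> FS.cl ` T" unfolding whittaker_ideal_def using T(4) by (auto simp: shifted_cl)
  show ?thesis
  proof
    fix f assume "f \<in> J"
    then obtain g where "g \<in> T" "FS.cl f = FS.cl g" using \<open>I \<subseteq> FS.cl ` T\<close> by (auto simp: J_def)
    then have "f - g \<in> T" "g \<in> T" using FS.cl_eq T(3) by auto
    then show "f \<in> T" using pm.subspace_add[OF T(1), of "f - g" g] by simp
  qed
qed

abbreviation Q where "Q \<equiv> Q_space L \<mm> \<phi>"
abbreviation W where "W \<equiv> W_algebra L \<mm> \<phi>"

definition qc :: "'a free_elem \<Rightarrow> 'a env_elem set" where "qc f = I +>\<^bsub>FS.U\<^esub> FS.cl f"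

lemma pr_cl: "pr L \<mm> \<phi> (FS.cl f) = qc f" by (simp add: pr_def qc_def)

lemma qc_eq: "qc f = qc g \<longleftrightarrow> f - g \<in> J"
  unfolding qc_def by (simp add: QQ.coset_eq FS.U_minus J_def)

lemma Q_carrier: "carrier Q = range qc"
  unfolding Q_space_def QQ.quotient_carrier by (auto simp: qc_def FS.U_carrier)

lemma qc_carrier [simp]: "qc f \<in> carrier Q" by (simp add: Q_carrier)

lemma Q_add: "qc f \<oplus>\<^bsub>Q\<^esub> qc g = qc (f + g)"
  unfolding Q_space_def qc_def by (simp add: QQ.quotient_add FS.U_add)

lemma Q_smult: "c \<odot>\<^bsub>Q\<^esub> qc f = qc (scale_pm c f)"
  unfolding Q_space_def qc_def by (simp add: QQ.quotient_smult FS.U_smult)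

lemma Q_zero: "\<zero>\<^bsub>Q\<^esub> = qc 0"
  unfolding Q_space_def qc_def using QQ.quotient_zero QQ.coset_zero by (simp add: FS.U_zero)

lemma Q_one: "\<one>\<^bsub>Q\<^esub> = qc 1"
  unfolding Q_space_def qc_def using QQ.quotient_one by (simp add: FS.U_one)

lemma Q_parity: "parity Q i = qc ` supported (word_parity L i)"
  unfolding Q_space_def QQ.quotient_parity FS.U_parity by (auto simp: qc_def)

lemma mem_qc: "C \<in> qc f \<longleftrightarrow> (\<exists>g. C = FS.cl g \<and> g - f \<in> J)"
  unfolding qc_def by (auto simp: QQ.mem_coset FS.U_carrier FS.U_minus J_def)

text \<open>The preimage of \<open>W\<close> in the free algebra: the elements that multiply \<open>J\<close> into itself from the right (\<open>J_Wf\<close>).\<close>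

definition Wf :: "'a free_elem set" where "Wf = {f. \<forall>z\<in>\<mm>. sh z * f \<in> J}"

lemma W_carrier: "carrier W = qc ` Wf"
proof -
  have "carrier W = {pr L \<mm> \<phi> y |y. y \<in> carrier FS.U \<and> (\<forall>x\<in>\<mm>. shifted L \<phi> x \<otimes>\<^bsub>FS.U\<^esub> y \<in> I)}"
    by (simp add: W_algebra_def Let_def)
  also have "\<dots> = {pr L \<mm> \<phi> (FS.cl f) | f. f \<in> Wf}"
    unfolding FS.U_carrier shifted_cl Wf_def J_def by (force simp: FS.U_mult)
  finally show ?thesis by (auto simp: pr_cl)
qed

lemma W_simps [simp]: "mult W = mult Q" "add W = add Q" "smult W = smult Q" "\<one>\<^bsub>W\<^esub> = \<one>\<^bsub>Q\<^esub>" "\<zero>\<^bsub>W\<^esub> = \<zero>\<^bsub>Q\<^esub>"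
  "parity W i = parity Q i \<inter> carrier W"
  by (simp_all add: W_algebra_def Let_def)

lemma Wf_subspace: "pm.subspace Wf"
  by (rule pm.subspaceI) (auto simp: Wf_def distrib_left J_rules)

lemma J_Wf: "f \<in> J \<Longrightarrow> g \<in> Wf \<Longrightarrow> f * g \<in> J"
proof -
  assume g: "g \<in> Wf"
  have "J \<subseteq> {f. f * g \<in> J}"
    by (rule J_least) (use g in \<open>auto intro!: pm.subspaceI simp: J_rules distrib_right mult.assoc J_mult E_J FS.E_mult Wf_def\<close>)
  then show "f \<in> J \<Longrightarrow> f * g \<in> J" by blast
qed

lemma Wf_mult: "f \<in> Wf \<Longrightarrow> g \<in> Wf \<Longrightarrow> f * g \<in> Wf"
  using J_Wf by (auto simp: Wf_def mult.assoc[symmetric])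

lemma Wf_one: "1 \<in> Wf" by (auto simp: Wf_def sh_J)

lemma J_in_Wf: "f \<in> J \<Longrightarrow> f \<in> Wf" by (auto simp: Wf_def J_mult)

lemma qc_W: "qc f \<in> carrier W \<longleftrightarrow> f \<in> Wf"
proof
  assume "qc f \<in> carrier W"
  then obtain g where g: "g \<in> Wf" "f - g \<in> J" by (auto simp: W_carrier qc_eq)
  then have "(f - g) + g \<in> Wf" using pm.subspace_add[OF Wf_subspace J_in_Wf] by blast
  then show "f \<in> Wf" by simp
qed (auto simp: W_carrier)

text \<open>The product of cosets is independent of the representatives because \<open>J g \<subseteq> J\<close>.\<close>

lemma Q_mult:
  assumes "g \<in> Wf"
  shows "qc f \<otimes>\<^bsub>Q\<^esub> qc g = qc (f * g)"
proof -
  have *: "I +>\<^bsub>FS.U\<^esub> (a \<otimes>\<^bsub>FS.U\<^esub> b) = qc (f * g)" if "a \<in> qc f" "b \<in> qc g" for a b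
  proof -
    note m = that[unfolded mem_qc]
    obtain f' where a: "a = FS.cl f'" "f' - f \<in> J" using m(1) by blast
    obtain g' where b: "b = FS.cl g'" "g' - g \<in> J" using m(2) by blast
    have "f' * (g' - g) + (f' - f) * g \<in> J" by (rule J_rules(2)[OF J_mult[OF b(2)] J_Wf[OF a(2) assms]])
    then have "f' * g' - f * g \<in> J" by (simp add: algebra_simps)
    then show ?thesis unfolding a b FS.U_mult using qc_eq by (simp add: qc_def)
  qed
  have ne: "FS.cl f \<in> qc f" "FS.cl g \<in> qc g" by (auto simp: mem_qc J_rules)
  have "rcoset_mult FS.U I (qc f) (qc g) = qc (f * g)"
    unfolding rcoset_mult_def using * ne by blast
  then show ?thesis by (simp add: Q_space_def quotient_superspace_def FactRing_def)
qed

sublocale Qm: complex_module Q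
  unfolding Q_space_def by (rule QQ.quotient_is_module)

lemma Q_minus: "qc f \<ominus>\<^bsub>Q\<^esub> qc g = qc (f - g)"
  by (simp add: Qm.minus_smult Q_add Q_smult pm.scale_minus_left)

lemma free_inv_J: "f \<in> J \<Longrightarrow> free_inv f \<in> J"
proof -
  have "J \<subseteq> {f. free_inv f \<in> J}"
  proof (rule J_least)
    show "pm.subspace {f. free_inv f \<in> J}" by (rule pm.subspaceI) (auto simp: free_inv_add free_inv_scale J_rules)
    show "sh z \<in> {f. free_inv f \<in> J}" if "z \<in> \<mm>" for z
      using sh_J[of "inv_L z"] inv_L_m[OF that] by (simp add: sh_def free_inv_diff free_inv_letter free_inv_scale)
  qed (auto simp: free_inv_mult J_mult free_inv_E E_J)
  then show "f \<in> J \<Longrightarrow> free_inv f \<in> J" by blast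
qed

lemma free_inv_Wf: "f \<in> Wf \<Longrightarrow> free_inv f \<in> Wf"
  unfolding Wf_def
proof (rule CollectI, rule ballI)
  fix z assume f: "f \<in> {f. \<forall>z\<in>\<mm>. sh z * f \<in> J}" and z: "z \<in> \<mm>"
  have "free_inv (sh (inv_L z)) = sh z" using inv_L_m[OF z] by (simp add: sh_def free_inv_diff free_inv_letter free_inv_scale)
  moreover have "sh (inv_L z) * f \<in> J" using f inv_L_m(1)[OF z] by blast
  ultimately show "sh z * free_inv f \<in> J" using free_inv_J[of "sh (inv_L z) * f"] by (simp add: free_inv_mult)
qed

definition U_inv :: "'a env_elem \<Rightarrow> 'a env_elem" where "U_inv = coset_map FS.F FS.E free_inv"

lemma U_inv_cl: "U_inv (FS.cl f) = FS.cl (free_inv f)"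
  unfolding U_inv_def FS.cl_def
proof (rule FS.QU.coset_map_apply)
  fix g assume "g \<ominus>\<^bsub>FS.F\<^esub> f \<in> FS.E"
  then have "free_inv g - free_inv f \<in> FS.E" using free_inv_E[of "g - f"] by (simp add: free_inv_diff)
  then show "FS.E +>\<^bsub>FS.F\<^esub> free_inv g = FS.E +>\<^bsub>FS.F\<^esub> free_inv f" using FS.cl_eq by (simp add: FS.cl_def)
qed simp

lemma Q_super: "super_vector_space Q"
  unfolding Q_space_def
proof (rule QQ.quotient_super[where t = U_inv])
  interpret Us: super_space FS.U by (rule super_spaceI[OF U_super])
  show "submodule (parity FS.U i) complex_ring FS.U" for i by (rule Us.parity_submodule)
  show "U_inv v \<in> I" if "v \<in> I" for v
  proof -
    have "v \<in> carrier FS.U" using that FS.U.complex_submoduleE(1)[OF I_submodule] by blast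
    then obtain f where f: "v = FS.cl f" by (auto simp: FS.U_carrier)
    then show ?thesis using free_inv_J[of f] that by (simp add: J_def U_inv_cl)
  qed
  show "U_inv v \<ominus>\<^bsub>FS.U\<^esub> koszul_sign i i \<odot>\<^bsub>FS.U\<^esub> v \<in> I" if "v \<in> parity FS.U i" for i v
    using that E_J[OF free_inv_parity] by (auto simp: FS.U_parity U_inv_cl FS.U_smult FS.U_minus J_def)
  show "\<exists>a\<in>parity FS.U 0. \<exists>b\<in>parity FS.U 1. v \<ominus>\<^bsub>FS.U\<^esub> (a \<oplus>\<^bsub>FS.U\<^esub> b) \<in> I" if v: "v \<in> carrier FS.U" for v
  proof -
    obtain f where f: "v = FS.cl f" using v by (auto simp: FS.U_carrier)
    obtain a b where ab: "a\<in>supported (word_parity L 0)" "b\<in>supported (word_parity L 1)" "f - (a + b) \<in> FS.E"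
      using free_parity_ex by blast
    then have "v \<ominus>\<^bsub>FS.U\<^esub> (FS.cl a \<oplus>\<^bsub>FS.U\<^esub> FS.cl b) \<in> I"
      using E_J[OF ab(3)] by (simp add: f FS.U_add FS.U_minus J_def)
    then show ?thesis using ab FS.U_parity by blast
  qed
qed (auto simp: FS.U_carrier U_inv_cl FS.U_add FS.U_smult free_inv_add free_inv_scale)

sublocale Qs: super_space Q by (rule super_spaceI[OF Q_super])

definition Q_inv :: "'a env_elem set \<Rightarrow> 'a env_elem set" where "Q_inv = coset_map FS.U I U_inv"

lemma Q_inv_qc: "Q_inv (qc f) = qc (free_inv f)"
  unfolding Q_inv_def qc_def
proof (subst QQ.coset_map_apply)
  fix w assume "w \<in> carrier FS.U" "w \<ominus>\<^bsub>FS.U\<^esub> FS.cl f \<in> I"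
  then obtain g where g: "w = FS.cl g" "g - f \<in> J" by (auto simp: FS.U_carrier FS.U_minus J_def)
  have "free_inv g - free_inv f \<in> J" using free_inv_J[OF g(2)] by (simp add: free_inv_diff)
  then show "I +>\<^bsub>FS.U\<^esub> U_inv w = I +>\<^bsub>FS.U\<^esub> U_inv (FS.cl f)"
    using qc_eq unfolding g U_inv_cl by (simp add: qc_def)
qed (simp_all add: U_inv_cl)

lemma parity_inv_Q: "parity_inv Q (qc f) = qc (free_inv f)"
proof -
  have "Q_inv (qc f) = parity_inv Q (qc f)"
  proof (rule Qs.parity_inv_unique)
    show "Q_inv w = koszul_sign i i \<odot>\<^bsub>Q\<^esub> w" if "w \<in> parity Q i" for i w
    proof -
      obtain f where f: "w = qc f" "f \<in> supported (word_parity L i)" using \<open>w \<in> parity Q i\<close> by (auto simp: Q_parity)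
      show ?thesis unfolding f(1) Q_inv_qc Q_smult qc_eq by (rule E_J[OF free_inv_parity[OF f(2)]])
    qed
  qed (auto simp: Q_carrier Q_inv_qc Q_add free_inv_add)
  then show ?thesis by (simp add: Q_inv_qc)
qed

text \<open>The even part of \<open>f\<close> is \<open>(f + free_inv f) / 2\<close> modulo the enveloping ideal, and \<open>Wf\<close> is stable under \<open>free_inv\<close>.\<close>

lemma W_split:
  assumes "a \<in> carrier W"
  shows "\<exists>a0\<in>parity W 0. \<exists>a1\<in>parity W 1. a = a0 \<oplus>\<^bsub>Q\<^esub> a1"
proof -
  obtain f where f: "a = qc f" "f \<in> Wf" using assms by (auto simp: W_carrier)
  obtain f0 f1 where ab: "f0 \<in> supported (word_parity L 0)" "f1 \<in> supported (word_parity L 1)" "f - (f0 + f1) \<in> FS.E"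
    using free_parity_ex by blast
  note Wr = pm.subspace_add[OF Wf_subspace] pm.subspace_scale[OF Wf_subspace] pm.subspace_diff[OF Wf_subspace]
  have i: "free_inv f0 - f0 \<in> FS.E" "free_inv f1 + f1 \<in> FS.E"
    using free_inv_parity[OF ab(1)] free_inv_parity[OF ab(2)] by (simp_all add: pm.scale_minus_left)
  have "free_inv (f - (f0 + f1)) \<in> FS.E" by (rule free_inv_E[OF ab(3)])
  then have 1: "(f - (f0 + f1)) + free_inv (f - (f0 + f1)) + (free_inv f0 - f0) + (free_inv f1 + f1) \<in> FS.E"
    by (intro FS.E(2)[OF FS.E(2)[OF FS.E(2)[OF ab(3)]]] i)
  have "(f + free_inv f) - scale_pm 2 f0 = (f - (f0 + f1)) + free_inv (f - (f0 + f1)) + (free_inv f0 - f0) + (free_inv f1 + f1)"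
    using pm.scale_left_distrib[of 1 1 f0] by (simp add: free_inv_diff free_inv_add)
  then have 2: "(f + free_inv f) - scale_pm 2 f0 \<in> Wf" using 1 J_in_Wf E_J by metis
  have "scale_pm 2 f0 = (f + free_inv f) - ((f + free_inv f) - scale_pm 2 f0)" by simp
  also have "\<dots> \<in> Wf" by (rule Wr(3)[OF Wr(1)[OF f(2) free_inv_Wf[OF f(2)]] 2])
  finally have "scale_pm (1/2) (scale_pm 2 f0) \<in> Wf" by (rule Wr(2))
  then have f0: "f0 \<in> Wf" by simp
  have "f1 = f - f0 - (f - (f0 + f1))" by simp
  also have "\<dots> \<in> Wf" by (rule Wr(3)[OF Wr(3)[OF f(2) f0] J_in_Wf[OF E_J[OF ab(3)]]])
  finally have f1: "f1 \<in> Wf" .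
  have "a = qc f0 \<oplus>\<^bsub>Q\<^esub> qc f1" using E_J[OF ab(3)] by (simp add: f Q_add qc_eq)
  moreover have "qc f0 \<in> parity W 0" "qc f1 \<in> parity W 1" using f0 f1 ab by (auto simp: Q_parity W_carrier)
  ultimately show ?thesis by blast
qed

end

section \<open>The module Q and the Whittaker functor\<close>

lemma (in complex_module) complex_module_sub:
  assumes H: "submodule H complex_ring M"
    and N: "carrier N = H" "\<And>v w. v \<oplus>\<^bsub>N\<^esub> w = v \<oplus> w" "\<zero>\<^bsub>N\<^esub> = \<zero>" "\<And>c v. c \<odot>\<^bsub>N\<^esub> v = c \<odot> v"
  shows "complex_module N"
  unfolding complex_module_def
proof (rule moduleI[OF cring_complex_ring])
  note E = complex_submoduleE[OF H]
  have [simp]: "v \<in> H \<Longrightarrow> v \<in> carrier M" for v using E(1) by auto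
  show "abelian_group N"
  proof (rule abelian_groupI)
    fix v assume "v \<in> carrier N"
    then show "\<exists>w\<in>carrier N. w \<oplus>\<^bsub>N\<^esub> v = \<zero>\<^bsub>N\<^esub>"
      using E(4)[of v "-1"] by (intro bexI[of _ "(-1) \<odot> v"]) (auto simp: N)
  qed (auto simp: N E M.a_ac)
qed (use complex_submoduleE[OF H] in \<open>auto simp: N add_smult smult_add subset_iff\<close>)

lemma (in super_space) super_space_sub:
  assumes H: "submodule H complex_ring M"
    and N: "carrier N = H" "\<And>v w. v \<oplus>\<^bsub>N\<^esub> w = v \<oplus> w" "\<zero>\<^bsub>N\<^esub> = \<zero>" "\<And>c v. c \<odot>\<^bsub>N\<^esub> v = c \<odot> v"
      "\<And>i. parity N i = parity M i \<inter> H"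
    and split: "\<And>v. v \<in> H \<Longrightarrow> \<exists>a\<in>parity M 0 \<inter> H. \<exists>b\<in>parity M 1 \<inter> H. v = a \<oplus> b"
  shows "super_vector_space N"
proof -
  interpret N: complex_module N by (rule complex_module_sub[OF H N(1-4)])
  note E = complex_submoduleE[OF H]
  show ?thesis unfolding super_vector_space_def
  proof (intro conjI allI ballI)
    show "Module.module complex_ring N" using N.complex_module_axioms by (simp add: complex_module_def)
    show "submodule (parity N i) complex_ring N" for i
      by (rule N.complex_submoduleI) (auto simp: N E par)
    fix v assume "v \<in> carrier N"
    then obtain a b where ab: "a\<in>parity M 0 \<inter> H" "b\<in>parity M 1 \<inter> H" "v = a \<oplus> b" using split N by blast
    show "\<exists>!p. fst p \<in> parity N 0 \<and> snd p \<in> parity N 1 \<and> v = fst p \<oplus>\<^bsub>N\<^esub> snd p"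
    proof (rule ex1I[of _ "(a, b)"])
      fix p assume "fst p \<in> parity N 0 \<and> snd p \<in> parity N 1 \<and> v = fst p \<oplus>\<^bsub>N\<^esub> snd p"
      then have "a = fst p \<and> b = snd p" using ab by (intro parity_unique) (auto simp: N)
      then show "p = (a, b)" by (simp add: prod_eq_iff)
    qed (use ab N in auto)
  qed
qed

lemma complex_module_minus_cong:
  assumes "complex_module M" "complex_module N"
    and "\<And>v w. v \<oplus>\<^bsub>N\<^esub> w = v \<oplus>\<^bsub>M\<^esub> w" "\<And>c v. c \<odot>\<^bsub>N\<^esub> v = c \<odot>\<^bsub>M\<^esub> v"
    and "v \<in> carrier M" "w \<in> carrier M" "v \<in> carrier N" "w \<in> carrier N"
  shows "v \<ominus>\<^bsub>N\<^esub> w = v \<ominus>\<^bsub>M\<^esub> w"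
  using complex_module.minus_smult[OF assms(1,5,6)] complex_module.minus_smult[OF assms(2,7,8)] assms(3,4) by simp

lemma with_action_simps [simp]:
  "carrier (with_action V f) = carrier V" "add (with_action V f) = add V" "zero (with_action V f) = zero V"
  "smult (with_action V f) = smult V" "parity (with_action V f) = parity V" "action (with_action V f) = f"
  by (simp_all add: with_action_def)

lemma with_action_super:
  assumes "super_vector_space V"
  shows "super_vector_space (with_action V f)"
proof -
  interpret super_space V by (rule super_spaceI[OF assms])
  show ?thesis
  proof (rule super_space_sub[OF carrier_is_submodule])
    show "parity (with_action V f) i = parity V i \<inter> carrier V" for i using par_carrier by auto
    fix v assume "v \<in> carrier V"
    then obtain a b where "a \<in> parity V 0" "b \<in> parity V 1" "v = a \<oplus>\<^bsub>V\<^esub> b" by (rule parity_split)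
    then show "\<exists>a\<in>parity V 0 \<inter> carrier V. \<exists>b\<in>parity V 1 \<inter> carrier V. v = a \<oplus>\<^bsub>V\<^esub> b"
      using par_carrier by blast
  qed simp_all
qed

context whittaker_character
begin

abbreviation QM where "QM \<equiv> Q_module L \<mm> \<phi>"

lemma QM_simps [simp]: "carrier QM = carrier Q" "add QM = add Q" "zero QM = zero Q" "smult QM = smult Q" "parity QM = parity Q"
  by (simp_all add: Q_module_def Let_def)

lemma QM_super: "super_vector_space QM"
  unfolding Q_module_def Let_def by (rule with_action_super[OF Q_super])

lemma QM_action: "action QM y (qc f) = qc (letter y * f)"
proof -
  have "action QM y (qc f) = coset_map FS.U I (\<lambda>z. env_embed L y \<otimes>\<^bsub>FS.U\<^esub> z) (I +>\<^bsub>FS.U\<^esub> FS.cl f)"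
    by (simp add: Q_module_def Let_def qc_def)
  also have "\<dots> = I +>\<^bsub>FS.U\<^esub> (env_embed L y \<otimes>\<^bsub>FS.U\<^esub> FS.cl f)"
  proof (rule QQ.coset_map_apply)
    fix w assume "w \<in> carrier FS.U" "w \<ominus>\<^bsub>FS.U\<^esub> FS.cl f \<in> I"
    then obtain g where g: "w = FS.cl g" "g - f \<in> J" by (auto simp: FS.U_carrier FS.U_minus J_def)
    have "letter y * g - letter y * f \<in> J" using J_mult[OF g(2), of "letter y"] by (simp add: algebra_simps)
    then show "I +>\<^bsub>FS.U\<^esub> (env_embed L y \<otimes>\<^bsub>FS.U\<^esub> w) = I +>\<^bsub>FS.U\<^esub> (env_embed L y \<otimes>\<^bsub>FS.U\<^esub> FS.cl f)"
      using qc_eq unfolding g FS.env_embed_cl FS.U_mult by (simp add: qc_def)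
  qed simp
  finally show ?thesis by (simp add: FS.env_embed_cl FS.U_mult qc_def)
qed

lemma QM_minus: "qc f \<ominus>\<^bsub>QM\<^esub> qc g = qc (f - g)"
proof -
  have "qc f \<ominus>\<^bsub>QM\<^esub> qc g = qc f \<ominus>\<^bsub>Q\<^esub> qc g"
    by (rule complex_module_minus_cong[OF Qm.complex_module_axioms complex_moduleI[OF QM_super]]) auto
  then show ?thesis by (simp add: Q_minus)
qed

lemma QM_lie_module: "lie_module L QM"
  unfolding lie_module_def
proof (intro conjI allI ballI)
  show "super_vector_space QM" by (rule QM_super)
  fix v assume v: "v \<in> carrier QM"
  then obtain f where f: "v = qc f" by (auto simp: Q_carrier)
  show "action QM y v \<in> carrier QM" for y by (simp add: f QM_action)
  show "action QM (y + z) v = action QM y v \<oplus>\<^bsub>QM\<^esub> action QM z v" for y z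
    using E_J[OF FS.E_mult(2)[OF FS.E_letter_add[of y z], of f]] by (simp add: f QM_action Q_add qc_eq algebra_simps)
  show "action QM (lscale L c y) v = c \<odot>\<^bsub>QM\<^esub> action QM y v" for c y
    using E_J[OF FS.E_mult(2)[OF FS.E_letter_scale[of c y], of f]] by (simp add: f QM_action Q_smult qc_eq algebra_simps)
  show "action QM y (c \<odot>\<^bsub>QM\<^esub> v) = c \<odot>\<^bsub>QM\<^esub> action QM y v" for c y
    by (simp add: f QM_action Q_smult)
  show "action QM y (v \<oplus>\<^bsub>QM\<^esub> w) = action QM y v \<oplus>\<^bsub>QM\<^esub> action QM y w" if "w \<in> carrier QM" for y w
    using that by (auto simp: f Q_carrier QM_action Q_add distrib_left)
  show "action QM (bracket L y z) v = action QM y (action QM z v) \<ominus>\<^bsub>QM\<^esub> koszul_sign i j \<odot>\<^bsub>QM\<^esub> action QM z (action QM y v)"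
    if "y \<in> lparity L i" "z \<in> lparity L j" for i j y z
  proof -
    let ?r = "letter y * letter z - scale_pm (koszul_sign i j) (letter z * letter y) - letter (bracket L y z)"
    have "- (?r * f) \<in> J" using E_J[OF FS.E_mult(2)[OF FS.E_letter_bracket[OF that]]] J_rules(3)[of _ "-1"]
      by (simp add: pm.scale_minus_left)
    then show ?thesis by (simp add: f QM_action Q_smult QM_minus qc_eq algebra_simps)
  qed
next
  fix i j y v assume y: "y \<in> lparity L i" and "v \<in> parity QM j"
  then obtain f where f: "v = qc f" "f \<in> supported (word_parity L j)" by (auto simp: Q_parity)
  show "action QM y v \<in> parity QM (i + j)"
    unfolding f(1) QM_action QM_simps Q_parity by (rule imageI[OF letter_parity[OF y f(2)]])
qed

sublocale QR: lie_rep QM L by (rule lie_repI[OF QM_lie_module])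

lemma rho_QM: "free_action QM f (qc g) = qc (f * g)"
  by (induction f rule: free_induct)
     (auto simp: QR.rho_add_left QR.rho_scale_left QR.rho_letter_mult Q_add Q_smult QM_action mult.assoc distrib_right)

lemma Whit_QM: "whittaker_vectors \<mm> \<phi> QM = carrier W"
proof -
  have "qc f \<in> whittaker_vectors \<mm> \<phi> QM \<longleftrightarrow> f \<in> Wf" for f
    by (auto simp: whittaker_vectors_def QM_action Q_smult qc_eq Wf_def sh_def left_diff_distrib)
  then show ?thesis using Q_carrier by (auto simp: W_carrier whittaker_vectors_def)
qed

lemma W_carrier_Q: "a \<in> carrier W \<Longrightarrow> a \<in> carrier Q" by (auto simp: W_carrier)

end

locale character_rep = whittaker_character L \<mm> \<phi> + lie_rep M L
  for L :: "'a::ab_group_add lie_super" and \<mm> \<phi> and M :: "('a, 'm) supermodule" (structure)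
begin

sublocale lie_superalgebra_rep L M ..

abbreviation Whit :: "'m set" where "Whit \<equiv> whittaker_vectors \<mm> \<phi> M"
abbreviation WhM where "WhM \<equiv> Wh \<mm> \<phi> M"

lemma Whit_carrier: "v \<in> Whit \<Longrightarrow> v \<in> carrier M" by (simp add: whittaker_vectors_def)

lemma Whit_D: "v \<in> Whit \<Longrightarrow> z \<in> \<mm> \<Longrightarrow> action M z v = \<phi> z \<odot> v" by (simp add: whittaker_vectors_def)

lemma Whit_submodule: "submodule Whit complex_ring M"
  by (rule complex_submoduleI) (auto simp: whittaker_vectors_def act_add act_smult smult_add mult.commute)

text \<open>The annihilator of the Whittaker vectors in the free algebra is a left ideal that contains the generators of \<open>J\<close>.\<close>

lemma rho_J: "f \<in> J \<Longrightarrow> v \<in> Whit \<Longrightarrow> free_action M f v = \<zero>"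
proof -
  have "J \<subseteq> {f. \<forall>v\<in>Whit. free_action M f v = \<zero>}"
  proof (rule J_least)
    show "pm.subspace {f. \<forall>v\<in>Whit. free_action M f v = \<zero>}"
      by (rule pm.subspaceI) (auto simp: rho_add_left rho_scale_left Whit_carrier)
    show "g * f \<in> {f. \<forall>v\<in>Whit. free_action M f v = \<zero>}" if "f \<in> {f. \<forall>v\<in>Whit. free_action M f v = \<zero>}" for f g
      using that rho_smult[of \<zero> g 0] by (auto simp: rho_mult Whit_carrier)
    show "sh z \<in> {f. \<forall>v\<in>Whit. free_action M f v = \<zero>}" if "z \<in> \<mm>" for z
      using that by (auto simp: sh_def rho_diff_left rho_scale_left Whit_carrier Whit_D minus_zero_iff)
  qed (auto simp: rho_E Whit_carrier)
  then show "f \<in> J \<Longrightarrow> v \<in> Whit \<Longrightarrow> free_action M f v = \<zero>" by blast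
qed

lemma Wh_action:
  assumes "v \<in> Whit"
  shows "action WhM (qc f) v = free_action M f v"
proof -
  have "env_action M C v = free_action M f v" if C: "C \<in> qc f" for C
  proof -
    obtain g where g: "C = FS.cl g" "g - f \<in> J" using C by (auto simp: mem_qc)
    then show ?thesis using rho_J[OF g(2) assms] Whit_carrier[OF assms]
      by (simp add: env_action_cl rho_diff_left minus_zero_iff)
  qed
  then have "(\<lambda>y. env_action M y v) ` qc f = (\<lambda>y. free_action M f v) ` qc f" by (intro image_cong) auto
  moreover have "FS.cl f \<in> qc f" by (auto simp: mem_qc J_rules)
  ultimately have "(\<lambda>y. env_action M y v) ` qc f = {free_action M f v}" by (simp only: image_constant)
  then show ?thesis by (simp add: Wh_def)
qed

lemma Wh_simps [simp]: "carrier WhM = Whit" "add WhM = add M" "zero WhM = zero M" "smult WhM = smult M"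
  "parity WhM i = parity M i \<inter> Whit"
  by (simp_all add: Wh_def)

lemma rho_Whit:
  assumes "f \<in> Wf" "v \<in> Whit"
  shows "free_action M f v \<in> Whit"
proof -
  have "action M z (free_action M f v) = \<phi> z \<odot> free_action M f v" if "z \<in> \<mm>" for z
  proof -
    have "sh z * f \<in> J" using assms(1) that by (simp add: Wf_def)
    from rho_J[OF this assms(2)] show ?thesis using Whit_carrier[OF assms(2)]
      by (simp add: sh_def left_diff_distrib rho_diff_left rho_scale_left rho_letter_mult minus_zero_iff)
  qed
  then show ?thesis using Whit_carrier[OF assms(2)] by (simp add: whittaker_vectors_def)
qed

text \<open>For homogeneous \<open>z \<in> \<mm>\<close> the equation \<open>zv = \<phi>(z) v\<close> can be compared in each parity, since \<open>\<phi>(z) = 0\<close> for odd \<open>z\<close>.\<close>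

lemma Whit_split: "v \<in> Whit \<Longrightarrow> \<exists>a\<in>parity M 0 \<inter> Whit. \<exists>b\<in>parity M 1 \<inter> Whit. v = a \<oplus> b"
proof -
  assume v: "v \<in> Whit"
  obtain a b where ab: "a \<in> parity M 0" "b \<in> parity M 1" "v = a \<oplus> b" by (rule parity_split[OF Whit_carrier[OF v]])
  note c = par_carrier[OF ab(1)] par_carrier[OF ab(2)]
  have hom: "action M z a = \<phi> z \<odot> a \<and> action M z b = \<phi> z \<odot> b" if z: "z \<in> \<mm>" "z \<in> lparity L i" for z i
  proof -
    have "action M z a \<oplus> action M z b = \<phi> z \<odot> a \<oplus> \<phi> z \<odot> b"
      using Whit_D[OF v z(1)] c unfolding ab(3) by (simp add: act_add smult_add)
    moreover have "i = 1 \<Longrightarrow> \<phi> z = 0" using phi_odd z by blast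
    moreover note act_parity[OF z(2) ab(1)] act_parity[OF z(2) ab(2)]
    ultimately show ?thesis
      using parity_unique[of "action M z a" "action M z b" "\<phi> z \<odot> a" "\<phi> z \<odot> b"]
        parity_unique[of "action M z b" "action M z a" "\<zero>" "\<zero>"] ab c par
      by (cases i) (auto simp: M.a_comm)
  qed
  have "action M z a = \<phi> z \<odot> a \<and> action M z b = \<phi> z \<odot> b" if z: "z \<in> \<mm>" for z
  proof -
    obtain p q where pq: "p \<in> \<mm>" "p \<in> lparity L 0" "q \<in> \<mm>" "q \<in> lparity L 1" "z = p + q" using m_super[OF z] by blast
    then show ?thesis using hom[of p 0] hom[of q 1] c by (simp add: act_add_left phi_add add_smult)
  qed
  then have "a \<in> Whit" "b \<in> Whit" using c by (auto simp: whittaker_vectors_def)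
  then show ?thesis using ab by blast
qed

lemma Wh_super: "super_vector_space WhM"
  by (rule super_space_sub[OF Whit_submodule]) (use Whit_split in auto)

theorem Wh_superalgebra_module: "superalgebra_module W WhM"
  unfolding superalgebra_module_def
proof (intro conjI ballI allI)
  show "super_vector_space WhM" by (rule Wh_super)
next
  fix v assume v: "v \<in> carrier WhM"
  show "action WhM \<one>\<^bsub>W\<^esub> v = v" using v Whit_carrier by (simp add: Q_one Wh_action)
  fix a assume a: "a \<in> carrier W"
  then obtain f where f: "a = qc f" "f \<in> Wf" by (auto simp: W_carrier)
  show "action WhM a v \<in> carrier WhM" using f v by (simp add: Wh_action rho_Whit)
  show "action WhM (c \<odot>\<^bsub>W\<^esub> a) v = c \<odot>\<^bsub>WhM\<^esub> action WhM a v" for c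
    using f v by (simp add: Wh_action Q_smult rho_scale_left Whit_carrier)
  show "action WhM a (c \<odot>\<^bsub>WhM\<^esub> v) = c \<odot>\<^bsub>WhM\<^esub> action WhM a v" for c
    using f v complex_submoduleE(4)[OF Whit_submodule] by (simp add: Wh_action rho_smult Whit_carrier)
  show "action WhM a (v \<oplus>\<^bsub>WhM\<^esub> w) = action WhM a v \<oplus>\<^bsub>WhM\<^esub> action WhM a w" if "w \<in> carrier WhM" for w
    using f v that complex_submoduleE(3)[OF Whit_submodule] by (simp add: Wh_action rho_add Whit_carrier)
  fix b assume "b \<in> carrier W"
  then obtain g where g: "b = qc g" "g \<in> Wf" by (auto simp: W_carrier)
  show "action WhM (a \<oplus>\<^bsub>W\<^esub> b) v = action WhM a v \<oplus>\<^bsub>WhM\<^esub> action WhM b v"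
    using f g v by (simp add: Wh_action Q_add rho_add_left Whit_carrier)
  show "action WhM (a \<otimes>\<^bsub>W\<^esub> b) v = action WhM a (action WhM b v)"
    using f g v by (simp add: Wh_action Q_mult rho_mult rho_Whit Whit_carrier)
next
  fix i j a v assume a: "a \<in> parity W i" and v: "v \<in> parity WhM j"
  then obtain f where f: "a = qc f" "f \<in> supported (word_parity L i)" by (auto simp: Q_parity)
  have "f \<in> Wf" using a f(1) qc_W by simp
  then show "action WhM a v \<in> parity WhM (i + j)"
    using f v rho_parity[OF f(2)] by (simp add: Wh_action rho_Whit)
qed

end

lemma supermodule_homD:
  assumes "f \<in> supermodule_hom S M N"
  shows "v \<in> carrier M \<Longrightarrow> f v \<in> carrier N"
    "v \<in> carrier M \<Longrightarrow> w \<in> carrier M \<Longrightarrow> f (v \<oplus>\<^bsub>M\<^esub> w) = f v \<oplus>\<^bsub>N\<^esub> f w"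
    "v \<in> carrier M \<Longrightarrow> f (c \<odot>\<^bsub>M\<^esub> v) = c \<odot>\<^bsub>N\<^esub> f v"
    "v \<in> parity M i \<Longrightarrow> f v \<in> parity N i"
    "s \<in> S \<Longrightarrow> v \<in> carrier M \<Longrightarrow> f (action M s v) = action N s (f v)"
    "f \<in> extensional (carrier M)"
  using assms unfolding supermodule_hom_def PiE_def by (auto simp: image_subset_iff)

lemma supermodule_homI:
  assumes "f \<in> extensional (carrier M)" "\<And>v. v \<in> carrier M \<Longrightarrow> f v \<in> carrier N"
    "\<And>v w. v \<in> carrier M \<Longrightarrow> w \<in> carrier M \<Longrightarrow> f (v \<oplus>\<^bsub>M\<^esub> w) = f v \<oplus>\<^bsub>N\<^esub> f w"
    "\<And>c v. v \<in> carrier M \<Longrightarrow> f (c \<odot>\<^bsub>M\<^esub> v) = c \<odot>\<^bsub>N\<^esub> f v"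
    "\<And>i v. v \<in> parity M i \<Longrightarrow> f v \<in> parity N i"
    "\<And>s v. s \<in> S \<Longrightarrow> v \<in> carrier M \<Longrightarrow> f (action M s v) = action N s (f v)"
  shows "f \<in> supermodule_hom S M N"
  using assms unfolding supermodule_hom_def PiE_def by auto

lemma hom_rho:
  assumes "lie_rep M L" "lie_rep N L" "f \<in> supermodule_hom UNIV M N" "v \<in> carrier M"
  shows "f (free_action M g v) = free_action N g (f v)"
proof -
  interpret M: lie_rep M L by fact
  interpret N: lie_rep N L by fact
  note f = supermodule_homD[OF assms(3)]
  show ?thesis
    by (induction g rule: free_induct)
       (use assms(4) f in \<open>auto simp: M.rho_add_left M.rho_scale_left M.rho_letter_mult
          N.rho_add_left N.rho_scale_left N.rho_letter_mult\<close>)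
qed

context whittaker_character
begin

lemma character_repI: "lie_module L M \<Longrightarrow> character_rep L \<mm> \<phi> M"
  by (simp add: character_rep_def whittaker_character_axioms lie_repI)

lemma hom_Whit:
  assumes "lie_module L M" "lie_module L N" "f \<in> supermodule_hom UNIV M N" "v \<in> whittaker_vectors \<mm> \<phi> M"
  shows "f v \<in> whittaker_vectors \<mm> \<phi> N"
  using supermodule_homD[OF assms(3)] assms(4) unfolding whittaker_vectors_def
  by (auto, metis UNIV_I)

lemma Wh_map_hom:
  fixes M N :: "('a, 'v) supermodule"
  assumes "lie_module L M" "lie_module L N" "f \<in> supermodule_hom UNIV M N"
  shows "Wh_map \<mm> \<phi> M N f \<in> supermodule_hom (carrier W) (Wh \<mm> \<phi> M) (Wh \<mm> \<phi> N)"
proof -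
  interpret M: character_rep L \<mm> \<phi> M by (rule character_repI[OF assms(1)])
  interpret N: character_rep L \<mm> \<phi> N by (rule character_repI[OF assms(2)])
  note f = supermodule_homD[OF assms(3)]
  note sub = M.complex_submoduleE[OF M.Whit_submodule]
  note h = hom_Whit[OF assms]
  show ?thesis
  proof (rule supermodule_homI)
    fix a v assume a: "a \<in> carrier W" and v: "v \<in> carrier (Wh \<mm> \<phi> M)"
    then obtain g where g: "a = qc g" "g \<in> Wf" by (auto simp: W_carrier)
    show "Wh_map \<mm> \<phi> M N f (action (Wh \<mm> \<phi> M) a v) = action (Wh \<mm> \<phi> N) a (Wh_map \<mm> \<phi> M N f v)"
      using v g h hom_rho[OF M.lie_rep_axioms N.lie_rep_axioms assms(3)]
      by (simp add: Wh_map_def M.Wh_action N.Wh_action M.rho_Whit M.Whit_carrier)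
  qed (use f sub h M.Whit_carrier in \<open>auto simp: Wh_map_def\<close>)
qed

theorem Wh_functor:
  "supermodule_functor (WMod L \<mm> \<phi> :: ('a, 'v) supermodule \<Rightarrow> bool) UNIV (superalgebra_module W) (carrier W) (Wh \<mm> \<phi>) (Wh_map \<mm> \<phi>)"
  unfolding supermodule_functor_def
proof (intro conjI allI impI ballI)
  fix M :: "('a, 'v) supermodule" assume M: "WMod L \<mm> \<phi> M"
  then interpret M: character_rep L \<mm> \<phi> M by (intro character_repI) (simp add: WMod_def)
  show "superalgebra_module W (Wh \<mm> \<phi> M)" by (rule M.Wh_superalgebra_module)
  show "Wh_map \<mm> \<phi> M M (\<lambda>v\<in>carrier M. v) = (\<lambda>v\<in>carrier (Wh \<mm> \<phi> M). v)"
    using M.Whit_carrier by (auto simp: Wh_map_def fun_eq_iff)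
  fix N :: "('a, 'v) supermodule" assume N: "WMod L \<mm> \<phi> N"
  show "Wh_map \<mm> \<phi> M N f \<in> supermodule_hom (carrier W) (Wh \<mm> \<phi> M) (Wh \<mm> \<phi> N)"
    if "f \<in> supermodule_hom UNIV M N" for f
    using Wh_map_hom[OF _ _ that] M N by (simp add: WMod_def)
  fix P :: "('a, 'v) supermodule" and f g assume f: "f \<in> supermodule_hom UNIV M N"
  show "Wh_map \<mm> \<phi> M P (compose (carrier M) g f) =
    compose (carrier (Wh \<mm> \<phi> M)) (Wh_map \<mm> \<phi> N P g) (Wh_map \<mm> \<phi> M N f)"
    using M.Whit_carrier hom_Whit[OF _ _ f] M N by (auto simp: Wh_map_def fun_eq_iff compose_def WMod_def)
qed

end

section \<open>The tensor product over W\<close>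

context whittaker_character
begin

lemma Q_mult_closed: "q \<in> carrier Q \<Longrightarrow> a \<in> carrier W \<Longrightarrow> q \<otimes>\<^bsub>Q\<^esub> a \<in> carrier Q"
  by (auto simp: Q_carrier W_carrier Q_mult)

lemma Q_act_mult: "q \<in> carrier Q \<Longrightarrow> a \<in> carrier W \<Longrightarrow> action QM y (q \<otimes>\<^bsub>Q\<^esub> a) = action QM y q \<otimes>\<^bsub>Q\<^esub> a"
  by (auto simp: Q_carrier W_carrier Q_mult QM_action mult.assoc)

lemma parity_inv_Q_mult:
  "q \<in> carrier Q \<Longrightarrow> a \<in> carrier W \<Longrightarrow> parity_inv Q (q \<otimes>\<^bsub>Q\<^esub> a) = parity_inv Q q \<otimes>\<^bsub>Q\<^esub> parity_inv Q a"
  by (auto simp: Q_carrier W_carrier Q_mult parity_inv_Q free_inv_mult free_inv_Wf)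

lemma parity_inv_W: "a \<in> carrier W \<Longrightarrow> parity_inv Q a \<in> carrier W"
  by (auto simp: W_carrier parity_inv_Q free_inv_Wf)

end

locale W_rep = whittaker_character L \<mm> \<phi> + super_space N
  for L :: "'a::ab_group_add lie_super" and \<mm> \<phi> and N :: "('a env_elem set, 'n) supermodule" (structure) +
  assumes W_rep: "superalgebra_module (W_algebra L \<mm> \<phi>) N"
begin

lemma Wact_closed: "a \<in> carrier W \<Longrightarrow> v \<in> carrier N \<Longrightarrow> action N a v \<in> carrier N"
  and Wact_add_left: "a \<in> carrier W \<Longrightarrow> b \<in> carrier W \<Longrightarrow> v \<in> carrier N \<Longrightarrow> action N (a \<oplus>\<^bsub>Q\<^esub> b) v = action N a v \<oplus> action N b v"
  and Wact_smult_left: "a \<in> carrier W \<Longrightarrow> v \<in> carrier N \<Longrightarrow> action N (c \<odot>\<^bsub>Q\<^esub> a) v = c \<odot> action N a v"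
  and Wact_add: "a \<in> carrier W \<Longrightarrow> v \<in> carrier N \<Longrightarrow> w \<in> carrier N \<Longrightarrow> action N a (v \<oplus> w) = action N a v \<oplus> action N a w"
  and Wact_smult: "a \<in> carrier W \<Longrightarrow> v \<in> carrier N \<Longrightarrow> action N a (c \<odot> v) = c \<odot> action N a v"
  and Wact_parity: "a \<in> parity W i \<Longrightarrow> v \<in> parity N j \<Longrightarrow> action N a v \<in> parity N (i + j)"
  and Wact_one: "v \<in> carrier N \<Longrightarrow> action N \<one>\<^bsub>Q\<^esub> v = v"
  and Wact_mult: "a \<in> carrier W \<Longrightarrow> b \<in> carrier W \<Longrightarrow> v \<in> carrier N \<Longrightarrow> action N (a \<otimes>\<^bsub>Q\<^esub> b) v = action N a (action N b v)"
  using W_rep unfolding superalgebra_module_def W_simps by auto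

lemma parity_inv_Wact:
  assumes "a \<in> carrier W" "v \<in> carrier N"
  shows "parity_inv N (action N a v) = action N (parity_inv Q a) (parity_inv N v)"
proof -
  obtain b c where a: "b \<in> parity W 0" "c \<in> parity W 1" "a = b \<oplus>\<^bsub>Q\<^esub> c" using W_split[OF assms(1)] by blast
  obtain p q where v: "p \<in> parity N 0" "q \<in> parity N 1" "v = p \<oplus> q" by (rule parity_split[OF assms(2)])
  note k = par_carrier[OF v(1)] par_carrier[OF v(2)]
  have bc: "b \<in> carrier W" "c \<in> carrier W" "b \<in> parity Q 0" "c \<in> parity Q 1" using a by auto
  have W: "(-1) \<odot>\<^bsub>Q\<^esub> c \<in> carrier W" using bc(2) pm.subspace_scale[OF Wf_subspace, of _ "-1"]
    by (auto simp: W_carrier Q_smult intro!: imageI simp del: pm.scale_minus_left)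
  have cl: "action N b p \<in> carrier N" "action N b q \<in> carrier N" "action N c p \<in> carrier N" "action N c q \<in> carrier N"
    using Wact_closed bc k by auto
  have e: "action N a v = (action N b p \<oplus> action N c q) \<oplus> (action N b q \<oplus> action N c p)"
    unfolding a(3) v(3) using bc k cl by (simp add: Wact_add_left Wact_add M.a_ac)
  have 0: "action N b p \<oplus> action N c q \<in> parity N 0"
    using par(3)[of _ 0] Wact_parity[OF a(1) v(1)] Wact_parity[OF a(2) v(2)] by simp
  have 1: "action N b q \<oplus> action N c p \<in> parity N 1"
    using par(3)[of _ 1] Wact_parity[OF a(1) v(2)] Wact_parity[OF a(2) v(1)] by simp
  have "parity_inv N (action N a v) = (action N b p \<oplus> action N c q) \<ominus> (action N b q \<oplus> action N c p)"
    unfolding e by (rule parity_inv_eq[OF 0 1])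
  also have "\<dots> = action N (b \<oplus>\<^bsub>Q\<^esub> (-1) \<odot>\<^bsub>Q\<^esub> c) (p \<oplus> (-1) \<odot> q)"
    using bc k cl W by (simp add: Wact_add_left Wact_smult_left Wact_add Wact_smult minus_smult smult_add M.a_ac)
  also have "b \<oplus>\<^bsub>Q\<^esub> (-1) \<odot>\<^bsub>Q\<^esub> c = parity_inv Q a"
    unfolding a(3) using Qs.parity_inv_eq[OF bc(3,4)] Qm.minus_smult bc W_carrier_Q by simp
  also have "p \<oplus> (-1) \<odot> q = parity_inv N v"
    unfolding v(3) using parity_inv_eq[OF v(1,2)] minus_smult k by simp
  finally show ?thesis .
qed

abbreviation S where "S \<equiv> carrier Q \<times> carrier N"
abbreviation Fr where "Fr \<equiv> free_superspace Q N"
abbreviation Ker where "Ker \<equiv> Q_tensor_kernel L \<mm> \<phi> N"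
abbreviation TN where "TN \<equiv> Q_tensor L \<mm> \<phi> N"

definition pairs :: "bit \<Rightarrow> ('a env_elem set \<times> 'n) set" where
  "pairs i = (\<Union>j. parity Q j \<times> parity N (i - j))"

lemma Fr_simps [simp]: "carrier Fr = supported S" "f \<oplus>\<^bsub>Fr\<^esub> g = f + g" "\<zero>\<^bsub>Fr\<^esub> = 0" "c \<odot>\<^bsub>Fr\<^esub> f = scale_pm c f"
  "parity Fr i = supported (pairs i)"
  by (simp_all add: free_superspace_def supported_def pairs_def)

lemmas supp = pm.subspace_0[OF supported_subspace] pm.subspace_add[OF supported_subspace]
  pm.subspace_scale[OF supported_subspace] pm.subspace_diff[OF supported_subspace] pm.subspace_neg[OF supported_subspace]

sublocale Fr: complex_module Fr
  unfolding complex_module_def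
proof (rule moduleI[OF cring_complex_ring])
  show "abelian_group Fr"
    by (rule abelian_groupI) (auto simp: algebra_simps supp intro!: bexI[of _ "- _"])
qed (auto simp: pm.scale_left_distrib pm.scale_right_distrib supp)

lemma Fr_minus [simp]: "f \<in> supported S \<Longrightarrow> g \<in> supported S \<Longrightarrow> f \<ominus>\<^bsub>Fr\<^esub> g = f - g"
  by (simp add: Fr.minus_smult pm.scale_minus_left)

abbreviation rels where "rels \<equiv> tensor_relations W Q (mult Q) N"
abbreviation e where "e q n \<equiv> Poly_Mapping.single (q, n) (1::complex)"

lemma rels_supported: "rels \<subseteq> supported S"
  unfolding tensor_relations_def Let_def
  by (auto intro!: supp single_supported simp: Q_mult_closed Wact_closed simp del: scale_pm_single)

lemma Ker_def': "Ker = \<Inter>{K. submodule K complex_ring Fr \<and> rels \<subseteq> K}"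
  by (simp add: Q_tensor_kernel_def Let_def generated_subspace_def)

lemma Ker_submodule: "submodule Ker complex_ring Fr"
  unfolding Ker_def' by (rule Fr.generated_subspace_submodule) (use rels_supported in simp)

lemma Ker_subspace: "pm.subspace Ker"
  by (rule pm.subspaceI) (use Fr.complex_submoduleE[OF Ker_submodule] in auto)

lemmas Ker_rules = pm.subspace_0[OF Ker_subspace] pm.subspace_add[OF Ker_subspace] pm.subspace_scale[OF Ker_subspace]
  pm.subspace_diff[OF Ker_subspace]

lemma rels_Ker: "rels \<subseteq> Ker" unfolding Ker_def' by blast

lemma Ker_rels:
  "q \<in> carrier Q \<Longrightarrow> q' \<in> carrier Q \<Longrightarrow> n \<in> carrier N \<Longrightarrow> e (q \<oplus>\<^bsub>Q\<^esub> q') n - e q n - e q' n \<in> Ker"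
  "q \<in> carrier Q \<Longrightarrow> n \<in> carrier N \<Longrightarrow> n' \<in> carrier N \<Longrightarrow> e q (n \<oplus> n') - e q n - e q n' \<in> Ker"
  "q \<in> carrier Q \<Longrightarrow> n \<in> carrier N \<Longrightarrow> e (c \<odot>\<^bsub>Q\<^esub> q) n - scale_pm c (e q n) \<in> Ker"
  "q \<in> carrier Q \<Longrightarrow> n \<in> carrier N \<Longrightarrow> e q (c \<odot> n) - scale_pm c (e q n) \<in> Ker"
  "q \<in> carrier Q \<Longrightarrow> a \<in> carrier W \<Longrightarrow> n \<in> carrier N \<Longrightarrow> e (q \<otimes>\<^bsub>Q\<^esub> a) n - e q (action N a n) \<in> Ker"
  by (rule subsetD[OF rels_Ker], unfold tensor_relations_def Let_def, blast)+

lemma Ker_least: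
  assumes "pm.subspace T"
    "\<And>q q' n. q \<in> carrier Q \<Longrightarrow> q' \<in> carrier Q \<Longrightarrow> n \<in> carrier N \<Longrightarrow> e (q \<oplus>\<^bsub>Q\<^esub> q') n - e q n - e q' n \<in> T"
    "\<And>q n n'. q \<in> carrier Q \<Longrightarrow> n \<in> carrier N \<Longrightarrow> n' \<in> carrier N \<Longrightarrow> e q (n \<oplus> n') - e q n - e q n' \<in> T"
    "\<And>c q n. q \<in> carrier Q \<Longrightarrow> n \<in> carrier N \<Longrightarrow> e (c \<odot>\<^bsub>Q\<^esub> q) n - scale_pm c (e q n) \<in> T"
    "\<And>c q n. q \<in> carrier Q \<Longrightarrow> n \<in> carrier N \<Longrightarrow> e q (c \<odot> n) - scale_pm c (e q n) \<in> T"
    "\<And>q a n. q \<in> carrier Q \<Longrightarrow> a \<in> carrier W \<Longrightarrow> n \<in> carrier N \<Longrightarrow> e (q \<otimes>\<^bsub>Q\<^esub> a) n - e q (action N a n) \<in> T"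
  shows "Ker \<subseteq> T"
proof -
  have "submodule (T \<inter> supported S) complex_ring Fr"
    by (rule Fr.complex_submoduleI) (auto simp: supp pm.subspace_0[OF assms(1)] pm.subspace_add[OF assms(1)] pm.subspace_scale[OF assms(1)])
  moreover have "rels \<subseteq> T" unfolding tensor_relations_def Let_def using assms(2-6) by auto
  then have "rels \<subseteq> T \<inter> supported S" using rels_supported by blast
  ultimately show ?thesis unfolding Ker_def' by blast
qed

sublocale QT: quotient_module Fr Ker
  by (intro quotient_module.intro quotient_module_axioms.intro Fr.complex_module_axioms Ker_submodule)

definition tc :: "('a env_elem set \<times> 'n \<Rightarrow>\<^sub>0 complex) \<Rightarrow> ('a, 'n) Q_tensor_elem" where "tc f = Ker +>\<^bsub>Fr\<^esub> f"
abbreviation t :: "'a env_elem set \<Rightarrow> 'n \<Rightarrow> ('a, 'n) Q_tensor_elem" where "t q n \<equiv> tc (e q n)"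

lemma TN_def': "TN = with_action (quotient_superspace Fr Ker)
        (\<lambda>y. coset_map Fr Ker (push_forward (\<lambda>(q, n). (action QM y q, n))))"
  by (simp add: Q_tensor_def Let_def)

lemma tc_eq: "f \<in> supported S \<Longrightarrow> g \<in> supported S \<Longrightarrow> tc f = tc g \<longleftrightarrow> f - g \<in> Ker"
  unfolding tc_def by (simp add: QT.coset_eq)

lemma T_carrier: "carrier TN = tc ` supported S"
  by (simp add: TN_def' QT.quotient_carrier tc_def[abs_def])

lemma T_add: "f \<in> supported S \<Longrightarrow> g \<in> supported S \<Longrightarrow> tc f \<oplus>\<^bsub>TN\<^esub> tc g = tc (f + g)"
  using QT.quotient_add[of f g] by (simp add: TN_def' tc_def)

lemma T_smult: "f \<in> supported S \<Longrightarrow> c \<odot>\<^bsub>TN\<^esub> tc f = tc (scale_pm c f)"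
  using QT.quotient_smult[of f c] by (simp add: TN_def' tc_def)

lemma T_zero: "\<zero>\<^bsub>TN\<^esub> = tc 0"
  using QT.quotient_zero QT.coset_zero by (simp add: TN_def' tc_def)

lemma T_parity: "parity TN i = tc ` supported (pairs i)"
  by (simp add: TN_def' QT.quotient_parity tc_def[abs_def])

sublocale T: complex_module TN
proof -
  interpret q: complex_module "quotient_superspace Fr Ker" by (rule QT.quotient_is_module)
  show "complex_module TN"
    by (rule q.complex_module_sub[OF q.carrier_is_submodule]) (simp_all add: TN_def')
qed

lemma t_closed [simp]: "q \<in> carrier Q \<Longrightarrow> n \<in> carrier N \<Longrightarrow> t q n \<in> carrier TN"
  by (auto simp: T_carrier)

lemma t_add_left: "q \<in> carrier Q \<Longrightarrow> q' \<in> carrier Q \<Longrightarrow> n \<in> carrier N \<Longrightarrow> t (q \<oplus>\<^bsub>Q\<^esub> q') n = t q n \<oplus>\<^bsub>TN\<^esub> t q' n"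
  using Ker_rels(1)[of q q' n] by (simp add: T_add tc_eq supp diff_diff_add)

lemma t_add_right: "q \<in> carrier Q \<Longrightarrow> n \<in> carrier N \<Longrightarrow> n' \<in> carrier N \<Longrightarrow> t q (n \<oplus> n') = t q n \<oplus>\<^bsub>TN\<^esub> t q n'"
  using Ker_rels(2)[of q n n'] by (simp add: T_add tc_eq supp diff_diff_add)

lemma t_smult_left: "q \<in> carrier Q \<Longrightarrow> n \<in> carrier N \<Longrightarrow> t (c \<odot>\<^bsub>Q\<^esub> q) n = c \<odot>\<^bsub>TN\<^esub> t q n"
  using Ker_rels(3)[of q n c] by (simp add: T_smult tc_eq supp)

lemma t_smult_right: "q \<in> carrier Q \<Longrightarrow> n \<in> carrier N \<Longrightarrow> t q (c \<odot> n) = c \<odot>\<^bsub>TN\<^esub> t q n"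
  using Ker_rels(4)[of q n c] by (simp add: T_smult tc_eq supp)

lemma t_balanced: "q \<in> carrier Q \<Longrightarrow> a \<in> carrier W \<Longrightarrow> n \<in> carrier N \<Longrightarrow> t (q \<otimes>\<^bsub>Q\<^esub> a) n = t q (action N a n)"
  using Ker_rels(5)[of q a n] by (simp add: tc_eq Q_mult_closed Wact_closed)

lemma supported_submodule:
  assumes H: "submodule H complex_ring TN" and f: "f \<in> supported A" "A \<subseteq> S" "\<And>q n. (q, n) \<in> A \<Longrightarrow> t q n \<in> H"
  shows "tc f \<in> H"
proof -
  note E = T.complex_submoduleE[OF H]
  have sub: "g \<in> supported A \<Longrightarrow> g \<in> supported S" for g using f(2) by (auto simp: supported_def)
  show ?thesis using f(1)
  proof (induction f rule: supported_induct)
    case zero then show ?case using E(2) by (simp add: T_zero)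
  next
    case (single k c)
    then have "tc (Poly_Mapping.single k c) = c \<odot>\<^bsub>TN\<^esub> t (fst k) (snd k)" using f(2) by (subst T_smult) auto
    then show ?case using E(4) f(3)[of "fst k" "snd k"] single by simp
  next
    case (add f g)
    then show ?case using E(3)[OF add(3,4)] sub by (simp add: T_add)
  qed
qed

lemma T_generated:
  assumes "submodule H complex_ring TN" "\<And>q n. q \<in> carrier Q \<Longrightarrow> n \<in> carrier N \<Longrightarrow> t q n \<in> H"
  shows "carrier TN \<subseteq> H"
  using supported_submodule[OF assms(1) _ subset_refl] assms(2) by (auto simp: T_carrier)

lemma T_parity_generated:
  assumes "submodule H complex_ring TN" "\<And>j q n. q \<in> parity Q j \<Longrightarrow> n \<in> parity N (i - j) \<Longrightarrow> t q n \<in> H"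
  shows "parity TN i \<subseteq> H"
proof -
  have "pairs i \<subseteq> S" using Qs.par_carrier par_carrier by (auto simp: pairs_def)
  then have "tc f \<in> H" if "f \<in> supported (pairs i)" for f
    by (rule supported_submodule[OF assms(1) that]) (use assms(2) in \<open>unfold pairs_def, blast\<close>)
  then show ?thesis by (auto simp: T_parity)
qed

lemma t_parity: "q \<in> parity Q i \<Longrightarrow> n \<in> parity N j \<Longrightarrow> t q n \<in> parity TN (i + j)"
proof -
  assume "q \<in> parity Q i" "n \<in> parity N j"
  moreover have "i + j - i = j" by (cases i; cases j) simp_all
  ultimately have "(q, n) \<in> pairs (i + j)" unfolding pairs_def by (intro UN_I[of i]) auto
  then show ?thesis by (auto simp: T_parity)
qed

text \<open>Pure tensors span the tensor product.\<close>

lemma T_ext: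
  assumes P: "complex_module P"
    and f: "\<And>v. v \<in> carrier TN \<Longrightarrow> f v \<in> carrier P" "\<And>v w. v \<in> carrier TN \<Longrightarrow> w \<in> carrier TN \<Longrightarrow> f (v \<oplus>\<^bsub>TN\<^esub> w) = f v \<oplus>\<^bsub>P\<^esub> f w"
      "\<And>c v. v \<in> carrier TN \<Longrightarrow> f (c \<odot>\<^bsub>TN\<^esub> v) = c \<odot>\<^bsub>P\<^esub> f v"
    and g: "\<And>v. v \<in> carrier TN \<Longrightarrow> g v \<in> carrier P" "\<And>v w. v \<in> carrier TN \<Longrightarrow> w \<in> carrier TN \<Longrightarrow> g (v \<oplus>\<^bsub>TN\<^esub> w) = g v \<oplus>\<^bsub>P\<^esub> g w"
      "\<And>c v. v \<in> carrier TN \<Longrightarrow> g (c \<odot>\<^bsub>TN\<^esub> v) = c \<odot>\<^bsub>P\<^esub> g v"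
    and eq: "\<And>q n. q \<in> carrier Q \<Longrightarrow> n \<in> carrier N \<Longrightarrow> f (t q n) = g (t q n)"
    and v: "v \<in> carrier TN"
  shows "f v = g v"
proof -
  interpret P: complex_module P by (rule P)
  have "submodule {v \<in> carrier TN. f v = g v} complex_ring TN"
  proof (rule T.complex_submoduleI)
    have "f \<zero>\<^bsub>TN\<^esub> = \<zero>\<^bsub>P\<^esub>" using f(3)[of "\<zero>\<^bsub>TN\<^esub>" 0] f(1) by simp
    moreover have "g \<zero>\<^bsub>TN\<^esub> = \<zero>\<^bsub>P\<^esub>" using g(3)[of "\<zero>\<^bsub>TN\<^esub>" 0] g(1) by simp
    ultimately show "\<zero>\<^bsub>TN\<^esub> \<in> {v \<in> carrier TN. f v = g v}" by simp
  qed (auto simp: f g)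
  from T_generated[OF this] eq v show ?thesis by auto
qed

text \<open>The universal property: balanced bilinear maps factor through the tensor product.\<close>

lemma tensor_universal:
  assumes P: "complex_module P"
    and B: "\<And>q n. q \<in> carrier Q \<Longrightarrow> n \<in> carrier N \<Longrightarrow> B q n \<in> carrier P"
    "\<And>q q' n. q \<in> carrier Q \<Longrightarrow> q' \<in> carrier Q \<Longrightarrow> n \<in> carrier N \<Longrightarrow> B (q \<oplus>\<^bsub>Q\<^esub> q') n = B q n \<oplus>\<^bsub>P\<^esub> B q' n"
    "\<And>q n n'. q \<in> carrier Q \<Longrightarrow> n \<in> carrier N \<Longrightarrow> n' \<in> carrier N \<Longrightarrow> B q (n \<oplus> n') = B q n \<oplus>\<^bsub>P\<^esub> B q n'"
    "\<And>c q n. q \<in> carrier Q \<Longrightarrow> n \<in> carrier N \<Longrightarrow> B (c \<odot>\<^bsub>Q\<^esub> q) n = c \<odot>\<^bsub>P\<^esub> B q n"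
    "\<And>c q n. q \<in> carrier Q \<Longrightarrow> n \<in> carrier N \<Longrightarrow> B q (c \<odot> n) = c \<odot>\<^bsub>P\<^esub> B q n"
    "\<And>q a n. q \<in> carrier Q \<Longrightarrow> a \<in> carrier W \<Longrightarrow> n \<in> carrier N \<Longrightarrow> B (q \<otimes>\<^bsub>Q\<^esub> a) n = B q (action N a n)"
  shows "\<exists>h. (\<forall>v\<in>carrier TN. h v \<in> carrier P) \<and>
     (\<forall>v\<in>carrier TN. \<forall>w\<in>carrier TN. h (v \<oplus>\<^bsub>TN\<^esub> w) = h v \<oplus>\<^bsub>P\<^esub> h w) \<and>
     (\<forall>c. \<forall>v\<in>carrier TN. h (c \<odot>\<^bsub>TN\<^esub> v) = c \<odot>\<^bsub>P\<^esub> h v) \<and>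
     (\<forall>q\<in>carrier Q. \<forall>n\<in>carrier N. h (t q n) = B q n)"
proof -
  interpret P: complex_module P by (rule P)
  define b where "b = (\<lambda>(q, n). B q n)"
  let ?l = "lin_ext P b"
  have b: "b (q, n) = B q n" for q n by (simp add: b_def)
  have c: "\<And>k. k \<in> S \<Longrightarrow> b k \<in> carrier P" using B(1) by (auto simp: b_def)
  have add: "?l (f + g) = ?l f \<oplus>\<^bsub>P\<^esub> ?l g" and diff: "?l (f - g) = ?l f \<ominus>\<^bsub>P\<^esub> ?l g"
    if "f \<in> supported S" "g \<in> supported S" for f g
    using P.lin_ext_add[OF that c] P.lin_ext_diff[OF that c] by auto
  have sc: "?l (scale_pm k f) = k \<odot>\<^bsub>P\<^esub> ?l f" and cl: "?l f \<in> carrier P" if "f \<in> supported S" for f k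
    using P.lin_ext_scale[OF that c] P.lin_ext_closed[OF that c] by auto
  have sg: "?l (e q n) = B q n" if "q \<in> carrier Q" "n \<in> carrier N" for q n
    using P.lin_ext_single[of b "(q, n)" 1] B(1)[OF that] by (simp add: b)
  have "Ker \<subseteq> {f \<in> supported S. ?l f = \<zero>\<^bsub>P\<^esub>}"
  proof (rule Ker_least)
    show "pm.subspace {f \<in> supported S. ?l f = \<zero>\<^bsub>P\<^esub>}" by (rule pm.subspaceI) (auto simp: supp add sc)
  qed (simp_all add: diff_diff_add add sc diff supp sg B Q_mult_closed Wact_closed P.minus_zero_iff del: scale_pm_single)
  then have K0: "\<And>f. f \<in> Ker \<Longrightarrow> ?l f = \<zero>\<^bsub>P\<^esub>" by blast
  define h where "h C = ?l (SOME f. f \<in> supported S \<and> tc f = C)" for C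
  have h: "h (tc f) = ?l f" if f: "f \<in> supported S" for f
  proof -
    define g where "g = (SOME g. g \<in> supported S \<and> tc g = tc f)"
    have "g \<in> supported S \<and> tc g = tc f" unfolding g_def by (rule someI[of _ f]) (use f in simp)
    then have g: "g \<in> supported S" "g - f \<in> Ker" using tc_eq f by auto
    have "?l g = ?l f" using K0[OF g(2)] diff[OF g(1) f] P.minus_zero_iff[OF cl[OF g(1)] cl[OF f]] by simp
    then show ?thesis by (simp add: h_def g_def)
  qed
  show ?thesis
    by (rule exI[of _ h]) (auto simp: T_carrier h T_add T_smult add sc cl supp sg)
qed

end

context whittaker_character
begin

text \<open>The element \<open>b\<close> in place of \<open>a\<close> allows maps that twist the action of \<open>W\<close>: the parity involution of \<open>Q \<otimes> N\<close> is
obtained with \<open>b\<close> the image of \<open>a\<close> under the involution of \<open>W\<close>, the functor and the action of \<open>\<aa>\<close> with \<open>b = a\<close>.\<close>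

lemma push_Ker:
  assumes "W_rep L \<mm> \<phi> N" "W_rep L \<mm> \<phi> N'"
    and \<alpha>: "\<And>q. q \<in> carrier Q \<Longrightarrow> \<alpha> q \<in> carrier Q" "\<And>q q'. q \<in> carrier Q \<Longrightarrow> q' \<in> carrier Q \<Longrightarrow> \<alpha> (q \<oplus>\<^bsub>Q\<^esub> q') = \<alpha> q \<oplus>\<^bsub>Q\<^esub> \<alpha> q'"
      "\<And>c q. q \<in> carrier Q \<Longrightarrow> \<alpha> (c \<odot>\<^bsub>Q\<^esub> q) = c \<odot>\<^bsub>Q\<^esub> \<alpha> q"
    and \<beta>: "\<And>n. n \<in> carrier N \<Longrightarrow> \<beta> n \<in> carrier N'" "\<And>n n'. n \<in> carrier N \<Longrightarrow> n' \<in> carrier N \<Longrightarrow> \<beta> (n \<oplus>\<^bsub>N\<^esub> n') = \<beta> n \<oplus>\<^bsub>N'\<^esub> \<beta> n'"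
      "\<And>c n. n \<in> carrier N \<Longrightarrow> \<beta> (c \<odot>\<^bsub>N\<^esub> n) = c \<odot>\<^bsub>N'\<^esub> \<beta> n"
    and bal: "\<And>q a n. q \<in> carrier Q \<Longrightarrow> a \<in> carrier W \<Longrightarrow> n \<in> carrier N \<Longrightarrow>
      \<exists>b\<in>carrier W. \<alpha> (q \<otimes>\<^bsub>Q\<^esub> a) = \<alpha> q \<otimes>\<^bsub>Q\<^esub> b \<and> \<beta> (action N a n) = action N' b (\<beta> n)"
    and f: "f \<in> Q_tensor_kernel L \<mm> \<phi> N"
  shows "push_forward (\<lambda>(q, n). (\<alpha> q, \<beta> n)) f \<in> Q_tensor_kernel L \<mm> \<phi> N'"
proof -
  interpret N: W_rep L \<mm> \<phi> N by fact
  interpret N': W_rep L \<mm> \<phi> N' by fact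
  let ?h = "\<lambda>(q, n). (\<alpha> q, \<beta> n)"
  have "N.Ker \<subseteq> {f. push_forward ?h f \<in> N'.Ker}"
  proof (rule N.Ker_least)
    show "pm.subspace {f. push_forward ?h f \<in> N'.Ker}"
      by (rule pm.subspaceI) (auto simp: push_forward_add push_forward_scale N'.Ker_rules)
    fix q a n assume q: "q \<in> carrier Q" "a \<in> carrier W" "n \<in> carrier N"
    from bal[OF this] obtain b where b: "b \<in> carrier W" "\<alpha> (q \<otimes>\<^bsub>Q\<^esub> a) = \<alpha> q \<otimes>\<^bsub>Q\<^esub> b"
      "\<beta> (action N a n) = action N' b (\<beta> n)" by blast
    show "N.e (q \<otimes>\<^bsub>Q\<^esub> a) n - N.e q (action N a n) \<in> {f. push_forward ?h f \<in> N'.Ker}"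
      using N'.Ker_rels(5)[OF \<alpha>(1) _ \<beta>(1)] q b by (simp add: push_forward_diff)
  qed (use N'.Ker_rels \<alpha> \<beta> in \<open>simp_all add: push_forward_diff push_forward_scale del: scale_pm_single\<close>)
  then show ?thesis using f by blast
qed

lemma tensor_coset_map:
  assumes "W_rep L \<mm> \<phi> N" "W_rep L \<mm> \<phi> N'"
    and \<alpha>: "\<And>q. q \<in> carrier Q \<Longrightarrow> \<alpha> q \<in> carrier Q" "\<And>q q'. q \<in> carrier Q \<Longrightarrow> q' \<in> carrier Q \<Longrightarrow> \<alpha> (q \<oplus>\<^bsub>Q\<^esub> q') = \<alpha> q \<oplus>\<^bsub>Q\<^esub> \<alpha> q'"
      "\<And>c q. q \<in> carrier Q \<Longrightarrow> \<alpha> (c \<odot>\<^bsub>Q\<^esub> q) = c \<odot>\<^bsub>Q\<^esub> \<alpha> q"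
    and \<beta>: "\<And>n. n \<in> carrier N \<Longrightarrow> \<beta> n \<in> carrier N'" "\<And>n n'. n \<in> carrier N \<Longrightarrow> n' \<in> carrier N \<Longrightarrow> \<beta> (n \<oplus>\<^bsub>N\<^esub> n') = \<beta> n \<oplus>\<^bsub>N'\<^esub> \<beta> n'"
      "\<And>c n. n \<in> carrier N \<Longrightarrow> \<beta> (c \<odot>\<^bsub>N\<^esub> n) = c \<odot>\<^bsub>N'\<^esub> \<beta> n"
    and bal: "\<And>q a n. q \<in> carrier Q \<Longrightarrow> a \<in> carrier W \<Longrightarrow> n \<in> carrier N \<Longrightarrow>
      \<exists>b\<in>carrier W. \<alpha> (q \<otimes>\<^bsub>Q\<^esub> a) = \<alpha> q \<otimes>\<^bsub>Q\<^esub> b \<and> \<beta> (action N a n) = action N' b (\<beta> n)"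
    and f: "f \<in> supported (carrier Q \<times> carrier N)"
  shows "coset_map (free_superspace Q N') (Q_tensor_kernel L \<mm> \<phi> N') (push_forward (\<lambda>(q, n). (\<alpha> q, \<beta> n))) (W_rep.tc L \<mm> \<phi> N f) =
     W_rep.tc L \<mm> \<phi> N' (push_forward (\<lambda>(q, n). (\<alpha> q, \<beta> n)) f)"
proof -
  interpret N: W_rep L \<mm> \<phi> N by fact
  interpret N': W_rep L \<mm> \<phi> N' by fact
  let ?h = "\<lambda>(q, n). (\<alpha> q, \<beta> n)"
  have s: "push_forward ?h g \<in> supported N'.S" if "g \<in> supported N.S" for g
    by (rule push_forward_supported[OF that]) (use \<alpha> \<beta> in auto)
  show ?thesis unfolding N.tc_def N'.tc_def
  proof (rule N.QT.coset_map_apply)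
    fix g assume g: "g \<in> carrier N.Fr" "g \<ominus>\<^bsub>N.Fr\<^esub> f \<in> N.Ker"
    have gf: "g - f \<in> N.Ker" using f g by simp
    have "push_forward ?h (g - f) \<in> N'.Ker"
      by (rule push_Ker[OF assms(1,2) _ _ _ _ _ _ _ gf]) (fact \<alpha> \<beta> bal)+
    then show "N'.Ker +>\<^bsub>N'.Fr\<^esub> push_forward ?h g = N'.Ker +>\<^bsub>N'.Fr\<^esub> push_forward ?h f"
      using N'.tc_eq[OF s s] g f by (simp add: push_forward_diff N'.tc_def)
  qed (use f in simp)
qed

end

context W_rep begin

lemma W_rep_self: "W_rep L \<mm> \<phi> N" by (rule W_rep_axioms)

lemma T_act:
  assumes "f \<in> supported S"
  shows "action TN y (tc f) = tc (push_forward (\<lambda>(q, n). (action QM y q, n)) f)"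
  unfolding TN_def' with_action_simps
  by (rule tensor_coset_map[OF W_rep_self W_rep_self _ _ _ _ _ _ _ assms])
     (use QR.act_closed QR.act_add QR.act_smult Q_act_mult in auto)

lemma push_act_supported: "f \<in> supported S \<Longrightarrow> push_forward (\<lambda>(q, n). (action QM y q, n)) f \<in> supported S"
  by (erule push_forward_supported) (use QR.act_closed in auto)

lemma T_act_closed: "v \<in> carrier TN \<Longrightarrow> action TN y v \<in> carrier TN"
  using push_act_supported by (auto simp: T_carrier T_act)

lemma T_act_add: "v \<in> carrier TN \<Longrightarrow> w \<in> carrier TN \<Longrightarrow> action TN y (v \<oplus>\<^bsub>TN\<^esub> w) = action TN y v \<oplus>\<^bsub>TN\<^esub> action TN y w"
  using push_act_supported by (auto simp: T_carrier T_act T_add supp push_forward_add)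

lemma T_act_smult: "v \<in> carrier TN \<Longrightarrow> action TN y (c \<odot>\<^bsub>TN\<^esub> v) = c \<odot>\<^bsub>TN\<^esub> action TN y v"
  using push_act_supported by (auto simp: T_carrier T_act T_smult supp push_forward_scale)

lemma T_act_t: "q \<in> carrier Q \<Longrightarrow> n \<in> carrier N \<Longrightarrow> action TN y (t q n) = t (action QM y q) n"
  by (simp add: T_act)

end

context W_rep begin

lemma pairs_S: "pairs i \<subseteq> S" using Qs.par_carrier par_carrier by (auto simp: pairs_def)

lemma pairs_supported: "f \<in> supported (pairs i) \<Longrightarrow> f \<in> supported S"
  using pairs_S[of i] by (auto simp: supported_def)

lemma tc_single: "q \<in> carrier Q \<Longrightarrow> n \<in> carrier N \<Longrightarrow> tc (Poly_Mapping.single (q, n) c) = c \<odot>\<^bsub>TN\<^esub> t q n"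
  by (subst T_smult) simp_all

lemma t_smult_both: "q \<in> carrier Q \<Longrightarrow> n \<in> carrier N \<Longrightarrow> t (a \<odot>\<^bsub>Q\<^esub> q) (b \<odot> n) = (a * b) \<odot>\<^bsub>TN\<^esub> t q n"
  by (simp add: t_smult_left t_smult_right mult.commute)

lemma T_parity_submodule: "submodule (parity TN i) complex_ring TN"
proof (rule T.complex_submoduleI)
  show "parity TN i \<subseteq> carrier TN" using pairs_supported by (auto simp: T_parity T_carrier)
  show "\<zero>\<^bsub>TN\<^esub> \<in> parity TN i" by (auto simp: T_parity T_zero supp)
  show "v \<oplus>\<^bsub>TN\<^esub> w \<in> parity TN i" if "v \<in> parity TN i" "w \<in> parity TN i" for v w
    using that pairs_supported by (auto simp: T_parity T_add intro!: imageI supp)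
  show "c \<odot>\<^bsub>TN\<^esub> v \<in> parity TN i" if "v \<in> parity TN i" for c v
    using that pairs_supported by (auto simp: T_parity T_smult intro!: imageI supp)
qed

lemma T_split: "v \<in> carrier TN \<Longrightarrow> \<exists>a\<in>parity TN 0. \<exists>b\<in>parity TN 1. v = a \<oplus>\<^bsub>TN\<^esub> b"
proof -
  note P = T.complex_submoduleE[OF T_parity_submodule]
  have Pc: "a \<in> parity TN i \<Longrightarrow> a \<in> carrier TN" for a i using P(1) by auto
  let ?H = "{v \<in> carrier TN. \<exists>a\<in>parity TN 0. \<exists>b\<in>parity TN 1. v = a \<oplus>\<^bsub>TN\<^esub> b}"
  have "carrier TN \<subseteq> ?H"
  proof (rule T_generated)
    show "submodule ?H complex_ring TN"
    proof (rule T.complex_submoduleI)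
      show "\<zero>\<^bsub>TN\<^esub> \<in> ?H" using P(2) by (auto intro!: bexI[of _ "\<zero>\<^bsub>TN\<^esub>"])
    next
      fix v w assume "v \<in> ?H" "w \<in> ?H"
      then obtain a b a' b' where *: "a \<in> parity TN 0" "b \<in> parity TN 1" "v = a \<oplus>\<^bsub>TN\<^esub> b"
        "a' \<in> parity TN 0" "b' \<in> parity TN 1" "w = a' \<oplus>\<^bsub>TN\<^esub> b'" by blast
      have "v \<oplus>\<^bsub>TN\<^esub> w = (a \<oplus>\<^bsub>TN\<^esub> a') \<oplus>\<^bsub>TN\<^esub> (b \<oplus>\<^bsub>TN\<^esub> b')"
        using * Pc by (simp add: T.M.a_ac)
      then show "v \<oplus>\<^bsub>TN\<^esub> w \<in> ?H" using * P(3) Pc by (metis (mono_tags, lifting) T.M.a_closed mem_Collect_eq)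
    next
      fix c v assume "v \<in> ?H"
      then obtain a b where *: "a \<in> parity TN 0" "b \<in> parity TN 1" "v = a \<oplus>\<^bsub>TN\<^esub> b" by blast
      have "c \<odot>\<^bsub>TN\<^esub> v = c \<odot>\<^bsub>TN\<^esub> a \<oplus>\<^bsub>TN\<^esub> c \<odot>\<^bsub>TN\<^esub> b" using * Pc T.smult_add by simp
      then show "c \<odot>\<^bsub>TN\<^esub> v \<in> ?H" using * P(4) Pc by (metis (mono_tags, lifting) T.M.a_closed mem_Collect_eq)
    qed auto
    fix q n assume q: "q \<in> carrier Q" and n: "n \<in> carrier N"
    obtain q0 q1 where qq: "q0 \<in> parity Q 0" "q1 \<in> parity Q 1" "q = q0 \<oplus>\<^bsub>Q\<^esub> q1" by (rule Qs.parity_split[OF q])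
    obtain n0 n1 where nn: "n0 \<in> parity N 0" "n1 \<in> parity N 1" "n = n0 \<oplus> n1" by (rule parity_split[OF n])
    note c = Qs.par_carrier[OF qq(1)] Qs.par_carrier[OF qq(2)] par_carrier[OF nn(1)] par_carrier[OF nn(2)]
    have 1: "t q n = (t q0 n0 \<oplus>\<^bsub>TN\<^esub> t q1 n1) \<oplus>\<^bsub>TN\<^esub> (t q0 n1 \<oplus>\<^bsub>TN\<^esub> t q1 n0)"
      unfolding qq(3) nn(3) using c by (simp add: t_add_left t_add_right T.M.a_ac)
    have "t q0 n0 \<oplus>\<^bsub>TN\<^esub> t q1 n1 \<in> parity TN 0"
      using P(3)[of _ 0] t_parity[OF qq(1) nn(1)] t_parity[OF qq(2) nn(2)] by simp
    moreover have "t q0 n1 \<oplus>\<^bsub>TN\<^esub> t q1 n0 \<in> parity TN 1"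
      using P(3)[of _ 1] t_parity[OF qq(1) nn(2)] t_parity[OF qq(2) nn(1)] by simp
    ultimately show "t q n \<in> ?H" using 1 t_closed[OF q n] by blast
  qed
  then show "v \<in> carrier TN \<Longrightarrow> \<exists>a\<in>parity TN 0. \<exists>b\<in>parity TN 1. v = a \<oplus>\<^bsub>TN\<^esub> b" by blast
qed

text \<open>A lift of the parity involution of \<open>Q \<otimes> N\<close> to formal combinations of pairs.\<close>

definition pinv where "pinv = push_forward (\<lambda>(q, n). (parity_inv Q q, parity_inv N n))"

lemma pinv_supported: "f \<in> supported S \<Longrightarrow> pinv f \<in> supported S"
  unfolding pinv_def by (erule push_forward_supported) (use Qs.parity_inv_closed parity_inv_closed in auto)

lemma pinv_parity:
  assumes "f \<in> supported (pairs i)"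
  shows "tc (pinv f) = koszul_sign i i \<odot>\<^bsub>TN\<^esub> tc f"
  using assms
proof (induction f rule: supported_induct)
  case zero
  show ?case using T.smult_zero by (simp add: pinv_def T_zero[symmetric])
next
  case (single k c)
  then obtain j where k: "fst k \<in> parity Q j" "snd k \<in> parity N (i - j)" by (auto simp: pairs_def)
  note kc = Qs.par_carrier[OF k(1)] par_carrier[OF k(2)]
  have ks: "koszul_sign i i = koszul_sign j j * koszul_sign (i - j) (i - j)"
    using koszul_sign_diag_add[of j "i - j"] by (cases i; cases j) simp_all
  have pk: "pinv (Poly_Mapping.single k c) =
    Poly_Mapping.single (koszul_sign j j \<odot>\<^bsub>Q\<^esub> fst k, koszul_sign (i - j) (i - j) \<odot> snd k) c"
    using Qs.parity_inv_parity[OF k(1)] parity_inv_parity[OF k(2)] by (simp add: pinv_def case_prod_unfold)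
  have "tc (pinv (Poly_Mapping.single k c)) = c \<odot>\<^bsub>TN\<^esub> (koszul_sign i i \<odot>\<^bsub>TN\<^esub> t (fst k) (snd k))"
  proof -
    note kc' = Qm.smult_mem[OF kc(1), of "koszul_sign j j"] smult_mem[OF kc(2), of "koszul_sign (i - j) (i - j)"]
    show ?thesis using tc_single[OF kc', of c] t_smult_both[OF kc] pk by (simp only: ks)
  qed
  also have "\<dots> = koszul_sign i i \<odot>\<^bsub>TN\<^esub> tc (Poly_Mapping.single k c)"
    using tc_single[OF kc, of c] T.smult_smult[OF t_closed[OF kc]] by (simp add: mult.commute)
  finally show ?case .
next
  case (add f g)
  have "tc (pinv (f + g)) = tc (pinv f) \<oplus>\<^bsub>TN\<^esub> tc (pinv g)"
    using T_add[OF pinv_supported pinv_supported, of f g] add(1,2) pairs_supported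
    by (simp add: pinv_def push_forward_add)
  also have "\<dots> = koszul_sign i i \<odot>\<^bsub>TN\<^esub> tc (f + g)"
  proof -
    have s: "f \<in> supported S" "g \<in> supported S" using add pairs_supported by auto
    then have "tc f \<in> carrier TN" "tc g \<in> carrier TN" by (auto simp: T_carrier)
    then show ?thesis using add(3,4) by (simp only: T.smult_add T_add[OF s, symmetric])
  qed
  finally show ?case .
qed

lemma T_super: "super_vector_space TN"
  unfolding TN_def'
proof (rule with_action_super, rule QT.quotient_super[where t = pinv])
  show "submodule (parity Fr i) complex_ring Fr" for i
    by (rule Fr.complex_submoduleI) (use pairs_supported in \<open>auto simp: supp\<close>)
  show "pinv v \<in> Ker" if "v \<in> Ker" for v
    unfolding pinv_def
  proof (rule push_Ker[OF W_rep_self W_rep_self])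
    fix q a n assume "q \<in> carrier Q" "a \<in> carrier W" "n \<in> carrier N"
    then show "\<exists>b\<in>carrier W. parity_inv Q (q \<otimes>\<^bsub>Q\<^esub> a) = parity_inv Q q \<otimes>\<^bsub>Q\<^esub> b \<and>
        parity_inv N (action N a n) = action N b (parity_inv N n)"
      using parity_inv_Wact parity_inv_Q_mult parity_inv_W by (intro bexI[of _ "parity_inv Q a"]) auto
  qed (use that Qs.parity_inv_closed Qs.parity_inv_add Qs.parity_inv_smult parity_inv_closed parity_inv_add parity_inv_smult in auto)
  fix v
  show "pinv v \<ominus>\<^bsub>Fr\<^esub> koszul_sign i i \<odot>\<^bsub>Fr\<^esub> v \<in> Ker" if "v \<in> parity Fr i" for i
    using that pinv_parity[of v i] pairs_supported[of v i] pinv_supported[of v]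
      tc_eq[of "pinv v" "scale_pm (koszul_sign i i) v"] by (simp add: T_smult supp)
  show "\<exists>a\<in>parity Fr 0. \<exists>b\<in>parity Fr 1. v \<ominus>\<^bsub>Fr\<^esub> (a \<oplus>\<^bsub>Fr\<^esub> b) \<in> Ker" if v: "v \<in> carrier Fr"
  proof -
    have "tc v \<in> carrier TN" using v by (simp add: T_carrier)
    from T_split[OF this] obtain a b where ab: "a \<in> supported (pairs 0)" "b \<in> supported (pairs 1)" "tc v = tc a \<oplus>\<^bsub>TN\<^esub> tc b"
      by (auto simp: T_parity)
    then have "v - (a + b) \<in> Ker" using v tc_eq[of v "a + b"] pairs_supported by (simp add: T_add supp)
    then show ?thesis using ab v pairs_supported by (auto simp: supp)
  qed
  show "pinv v \<in> carrier Fr" if "v \<in> carrier Fr" using that pinv_supported by simp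
qed (simp_all add: pinv_def push_forward_add push_forward_scale)

lemma T_lie_module: "lie_module L TN"
  unfolding lie_module_def
proof (intro conjI allI ballI)
  show "super_vector_space TN" by (rule T_super)
next
  fix v assume v: "v \<in> carrier TN"
  show "action TN y v \<in> carrier TN" for y using v by (rule T_act_closed)
  show "action TN y (c \<odot>\<^bsub>TN\<^esub> v) = c \<odot>\<^bsub>TN\<^esub> action TN y v" for y c using v by (rule T_act_smult)
  show "action TN y (v \<oplus>\<^bsub>TN\<^esub> w) = action TN y v \<oplus>\<^bsub>TN\<^esub> action TN y w" if "w \<in> carrier TN" for y w
    using v that by (rule T_act_add)
  show "action TN (y + z) v = action TN y v \<oplus>\<^bsub>TN\<^esub> action TN z v" for y z
    by (rule T_ext[OF T.complex_module_axioms _ _ _ _ _ _ _ v])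
       (use QR.act_closed in \<open>auto simp: T_act_closed T_act_add T_act_smult T_act_t QR.act_add_left t_add_left T.smult_add T.M.a_ac\<close>)
  show "action TN (lscale L c y) v = c \<odot>\<^bsub>TN\<^esub> action TN y v" for c y
    by (rule T_ext[OF T.complex_module_axioms _ _ _ _ _ _ _ v])
       (use QR.act_closed in \<open>auto simp: T_act_closed T_act_add T_act_smult T_act_t QR.act_scale_left t_smult_left T.smult_add mult.commute\<close>)
  show "action TN (bracket L y z) v =
      action TN y (action TN z v) \<ominus>\<^bsub>TN\<^esub> koszul_sign i j \<odot>\<^bsub>TN\<^esub> action TN z (action TN y v)"
    if yz: "y \<in> lparity L i" "z \<in> lparity L j" for i j y z
  proof (rule T_ext[OF T.complex_module_axioms _ _ _ _ _ _ _ v])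
    fix q n assume q: "q \<in> carrier Q" and n: "n \<in> carrier N"
    have c: "action QM y q \<in> carrier Q" "action QM z q \<in> carrier Q" "action QM y (action QM z q) \<in> carrier Q"
      "action QM z (action QM y q) \<in> carrier Q" using QR.act_closed q by auto
    have "action QM (bracket L y z) q = action QM y (action QM z q) \<oplus>\<^bsub>Q\<^esub> (- koszul_sign i j) \<odot>\<^bsub>Q\<^esub> action QM z (action QM y q)"
      using QR.act_bracket[OF yz, of q] QR.minus_smult c q by simp
    then show "action TN (bracket L y z) (t q n) =
      action TN y (action TN z (t q n)) \<ominus>\<^bsub>TN\<^esub> koszul_sign i j \<odot>\<^bsub>TN\<^esub> action TN z (action TN y (t q n))"
      using q n c by (simp add: T_act_t t_add_left t_smult_left T.minus_smult)
  qed (auto simp: T_act_closed T_act_add T_act_smult T.minus_smult T.smult_add T.M.a_ac mult.commute mult.left_commute)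
next
  fix i j y v assume y: "y \<in> lparity L i" and v: "v \<in> parity TN j"
  note P = T.complex_submoduleE[OF T_parity_submodule]
  have "parity TN j \<subseteq> {v \<in> carrier TN. action TN y v \<in> parity TN (i + j)}"
  proof (rule T_parity_generated)
    show "submodule {v \<in> carrier TN. action TN y v \<in> parity TN (i + j)} complex_ring TN"
      using T_act_smult[of "\<zero>\<^bsub>TN\<^esub>" y 0] T_act_closed
      by (intro T.complex_submoduleI) (auto simp: T_act_add T_act_smult P)
    fix k q n assume q: "q \<in> parity Q k" and n: "n \<in> parity N (j - k)"
    have "t (action QM y q) n \<in> parity TN ((i + k) + (j - k))"
      by (rule t_parity[OF _ n]) (use QR.act_parity[OF y, of q k] q in simp)
    moreover have "(i + k) + (j - k) = i + j" by (cases i; cases j; cases k) simp_all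
    ultimately have "t (action QM y q) n \<in> parity TN (i + j)" by metis
    then show "t q n \<in> {v \<in> carrier TN. action TN y v \<in> parity TN (i + j)}"
      using q n Qs.par_carrier par_carrier by (simp add: T_act_t)
  qed
  then show "action TN y v \<in> parity TN (i + j)" using v by blast
qed

sublocale TR: character_rep L \<mm> \<phi> TN
  by (rule character_repI[OF T_lie_module])

lemma rho_t: "n \<in> carrier N \<Longrightarrow> free_action TN f (t (qc g) n) = t (qc (f * g)) n"
  by (induction f rule: free_induct)
     (auto simp: TR.rho_add_left TR.rho_scale_left TR.rho_letter_mult Q_add[symmetric] Q_smult[symmetric]
       t_add_left t_smult_left T_act_t QM_action mult.assoc distrib_right)

lemma t_Whit:
  assumes "a \<in> carrier W" "n \<in> carrier N"
  shows "t a n \<in> TR.Whit"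
proof -
  have a: "a \<in> whittaker_vectors \<mm> \<phi> QM" using assms by (simp add: Whit_QM)
  then have "action TN z (t a n) = \<phi> z \<odot>\<^bsub>TN\<^esub> t a n" if "z \<in> \<mm>" for z
    using that assms(2) by (simp add: whittaker_vectors_def T_act_t t_smult_left)
  then show ?thesis using assms W_carrier_Q by (simp add: whittaker_vectors_def)
qed

lemma one_W: "qc 1 \<in> carrier W" using Wf_one by (simp add: qc_W)

lemma t_W: "a \<in> carrier W \<Longrightarrow> n \<in> carrier N \<Longrightarrow> t a n = t (qc 1) (action N a n)"
proof -
  assume a: "a \<in> carrier W" and n: "n \<in> carrier N"
  obtain f where f: "a = qc f" "f \<in> Wf" using a by (auto simp: W_carrier)
  have "qc 1 \<otimes>\<^bsub>Q\<^esub> a = a" using Q_mult[OF f(2), of 1] f(1) by simp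
  then show ?thesis using t_balanced[OF qc_carrier[of 1] a n] by simp
qed

text \<open>\<open>Q\<close> is generated by \<open>1\<close>, and \<open>1 \<otimes> n\<close> is a Whittaker vector.\<close>

lemma T_stable_generated:
  assumes "submodule H complex_ring TN" "TR.Whit \<subseteq> H" "\<And>y v. v \<in> H \<Longrightarrow> action TN y v \<in> H"
  shows "carrier TN \<subseteq> H"
proof (rule T_generated[OF assms(1)])
  fix q n assume q: "q \<in> carrier Q" and n: "n \<in> carrier N"
  then obtain f where f: "q = qc f" by (auto simp: Q_carrier)
  have "t (qc 1) n \<in> H" using t_Whit[OF one_W n] assms(2) by blast
  from TR.rho_stable[OF assms(1,3) this, of f] show "t q n \<in> H" using rho_t[OF n, of f 1] f by simp
qed

end

section \<open>The tensor functor\<close>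

context whittaker_character
begin

lemma W_repI: "superalgebra_module W N \<Longrightarrow> W_rep L \<mm> \<phi> N"
  by (simp add: W_rep_def W_rep_axioms_def whittaker_character_axioms super_spaceI superalgebra_module_def)

context
  fixes N N' :: "('a env_elem set, 'w) supermodule" and g
  assumes N: "superalgebra_module W N" and N': "superalgebra_module W N'"
    and g: "g \<in> supermodule_hom (carrier W) N N'"
begin

interpretation N: W_rep L \<mm> \<phi> N by (rule W_repI[OF N])
interpretation N': W_rep L \<mm> \<phi> N' by (rule W_repI[OF N'])

lemma g_supported: "f \<in> supported N.S \<Longrightarrow> push_forward (\<lambda>(q, n). (q, g n)) f \<in> supported N'.S"
  by (erule push_forward_supported) (use supermodule_homD[OF g] in auto)

lemma tmap_tc:
  assumes f: "f \<in> supported N.S"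
  shows "Q_tensor_map L \<mm> \<phi> N N' g (N.tc f) = N'.tc (push_forward (\<lambda>(q, n). (q, g n)) f)"
proof -
  have "coset_map N'.Fr N'.Ker (push_forward (\<lambda>(q, n). (q, g n))) (N.tc f) = N'.tc (push_forward (\<lambda>(q, n). (q, g n)) f)"
    by (rule tensor_coset_map[OF N.W_rep_self N'.W_rep_self _ _ _ _ _ _ _ f])
       (use supermodule_homD[OF g] in auto)
  then show ?thesis using f by (simp add: Q_tensor_map_def N.T_carrier)
qed

lemma tmap_t: "q \<in> carrier Q \<Longrightarrow> n \<in> carrier N \<Longrightarrow> Q_tensor_map L \<mm> \<phi> N N' g (N.t q n) = N'.t q (g n)"
  by (simp add: tmap_tc)

lemma tmap_hom: "Q_tensor_map L \<mm> \<phi> N N' g \<in> supermodule_hom UNIV N.TN N'.TN"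
proof (rule supermodule_homI)
  show "Q_tensor_map L \<mm> \<phi> N N' g \<in> extensional (carrier N.TN)" by (simp add: Q_tensor_map_def)
next
  fix v assume v: "v \<in> carrier N.TN"
  then obtain f where f: "v = N.tc f" "f \<in> supported N.S" by (auto simp: N.T_carrier)
  show "Q_tensor_map L \<mm> \<phi> N N' g v \<in> carrier N'.TN"
    using f g_supported by (simp add: tmap_tc N'.T_carrier)
  show "Q_tensor_map L \<mm> \<phi> N N' g (c \<odot>\<^bsub>N.TN\<^esub> v) = c \<odot>\<^bsub>N'.TN\<^esub> Q_tensor_map L \<mm> \<phi> N N' g v" for c
    using f g_supported by (simp add: tmap_tc N.T_smult N'.T_smult N.supp push_forward_scale)
  show "Q_tensor_map L \<mm> \<phi> N N' g (action N.TN s v) = action N'.TN s (Q_tensor_map L \<mm> \<phi> N N' g v)" for s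
    using f g_supported N.push_act_supported[OF f(2)]
    by (simp add: tmap_tc N.T_act N'.T_act push_forward_compose case_prod_unfold)
  fix w assume "w \<in> carrier N.TN"
  then obtain h where h: "w = N.tc h" "h \<in> supported N.S" by (auto simp: N.T_carrier)
  show "Q_tensor_map L \<mm> \<phi> N N' g (v \<oplus>\<^bsub>N.TN\<^esub> w) = Q_tensor_map L \<mm> \<phi> N N' g v \<oplus>\<^bsub>N'.TN\<^esub> Q_tensor_map L \<mm> \<phi> N N' g w"
    using f h g_supported by (simp add: tmap_tc N.T_add N'.T_add N.supp push_forward_add)
next
  fix i v assume "v \<in> parity N.TN i"
  then obtain f where f: "v = N.tc f" "f \<in> supported (N.pairs i)" by (auto simp: N.T_parity)
  have "push_forward (\<lambda>(q, n). (q, g n)) f \<in> supported (N'.pairs i)"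
    by (rule push_forward_supported[OF f(2)])
       (use supermodule_homD(4)[OF g] in \<open>unfold N.pairs_def N'.pairs_def, auto\<close>)
  then show "Q_tensor_map L \<mm> \<phi> N N' g v \<in> parity N'.TN i"
    using f N.pairs_supported by (simp add: tmap_tc N'.T_parity)
qed

end

lemma tmap_id:
  assumes "superalgebra_module W N"
  shows "Q_tensor_map L \<mm> \<phi> N N (\<lambda>v\<in>carrier N. v) = (\<lambda>v\<in>carrier (Q_tensor L \<mm> \<phi> N). v)"
proof -
  interpret N: W_rep L \<mm> \<phi> N by (rule W_repI[OF assms])
  have hom: "(\<lambda>v\<in>carrier N. v) \<in> supermodule_hom (carrier W) N N"
    by (rule supermodule_homI) (auto simp: N.Wact_closed N.par_carrier)
  have "Q_tensor_map L \<mm> \<phi> N N (\<lambda>v\<in>carrier N. v) (N.tc f) = N.tc f" if f: "f \<in> supported N.S" for f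
  proof -
    have "push_forward (\<lambda>(q, n). (q, (\<lambda>v\<in>carrier N. v) n)) f = push_forward (\<lambda>k. k) f"
      by (rule push_forward_cong[OF f]) auto
    then show ?thesis using tmap_tc[OF assms assms hom f] by (simp add: push_forward_id)
  qed
  then show ?thesis by (auto simp: fun_eq_iff N.T_carrier Q_tensor_map_def)
qed

lemma tmap_compose:
  assumes N: "superalgebra_module W N" and N': "superalgebra_module W N'" and P: "superalgebra_module W P"
    and f: "f \<in> supermodule_hom (carrier W) N N'" and g: "g \<in> supermodule_hom (carrier W) N' P"
  shows "Q_tensor_map L \<mm> \<phi> N P (compose (carrier N) g f) =
    compose (carrier (Q_tensor L \<mm> \<phi> N)) (Q_tensor_map L \<mm> \<phi> N' P g) (Q_tensor_map L \<mm> \<phi> N N' f)"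
proof -
  interpret N: W_rep L \<mm> \<phi> N by (rule W_repI[OF N])
  interpret N': W_rep L \<mm> \<phi> N' by (rule W_repI[OF N'])
  interpret P: W_rep L \<mm> \<phi> P by (rule W_repI[OF P])
  note fD = supermodule_homD[OF f] and gD = supermodule_homD[OF g]
  have gf: "compose (carrier N) g f \<in> supermodule_hom (carrier W) N P"
    by (rule supermodule_homI) (auto simp: fD gD compose_def N.Wact_closed N.par_carrier)
  have "Q_tensor_map L \<mm> \<phi> N P (compose (carrier N) g f) (N.tc k) =
    Q_tensor_map L \<mm> \<phi> N' P g (Q_tensor_map L \<mm> \<phi> N N' f (N.tc k))" if k: "k \<in> supported N.S" for k
  proof -
    have "push_forward (\<lambda>(q, n). (q, compose (carrier N) g f n)) k = push_forward (\<lambda>(q, n). (q, g (f n))) k"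
      by (rule push_forward_cong[OF k]) (auto simp: compose_def)
    then show ?thesis
      using tmap_tc[OF N P gf k] tmap_tc[OF N N' f k] tmap_tc[OF N' P g g_supported[OF N N' f k]]
      by (simp add: push_forward_compose case_prod_unfold)
  qed
  then show ?thesis by (auto simp: fun_eq_iff N.T_carrier Q_tensor_map_def compose_def)
qed

end

section \<open>The projection from Q to W\<close>

context whittaker_datum
begin

lemma whittaker_repI: "lie_module L M \<Longrightarrow> whittaker_rep L gr \<mm> \<phi> order u x d par M"
  by (simp add: whittaker_rep_def whittaker_datum_axioms lie_repI)

lemma Q_tensor_WMod:
  assumes "superalgebra_module W N"
  shows "WMod L \<mm> \<phi> (Q_tensor L \<mm> \<phi> N)"
proof -
  interpret N: W_rep L \<mm> \<phi> N by (rule W_repI[OF assms])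
  interpret T: whittaker_rep L gr \<mm> \<phi> order u x d par N.TN by (rule whittaker_repI[OF N.T_lie_module])
  show ?thesis by (rule T.generated_WMod) (rule N.T_stable_generated)
qed

theorem Q_tensor_functor:
  "supermodule_functor (superalgebra_module W :: ('a env_elem set, 'w) supermodule \<Rightarrow> bool) (carrier W)
     (WMod L \<mm> \<phi>) UNIV (Q_tensor L \<mm> \<phi>) (Q_tensor_map L \<mm> \<phi>)"
  unfolding supermodule_functor_def
  using Q_tensor_WMod tmap_hom tmap_id tmap_compose by blast

sublocale QW: whittaker_rep L gr \<mm> \<phi> order u x d par QM
  by (rule whittaker_repI[OF QM_lie_module])

lemma Q_WMod: "WMod L \<mm> \<phi> QM"
proof (rule QW.generated_WMod)
  fix H assume H: "submodule H complex_ring QM" "whittaker_vectors \<mm> \<phi> QM \<subseteq> H" "\<And>y v. v \<in> H \<Longrightarrow> action QM y v \<in> H"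
  have one: "qc 1 \<in> H" using H(2) Wf_one by (auto simp: Whit_QM qc_W)
  have "qc f \<in> H" for f using QR.rho_stable[OF H(1,3) one, of f] by (simp add: rho_QM)
  then show "carrier QM \<subseteq> H" by (auto simp: Q_carrier)
qed

abbreviation Q_pos where "Q_pos \<equiv> QW.Pos (carrier W)"

lemma Q_decomposition: "q \<in> carrier Q \<Longrightarrow> \<exists>w\<in>carrier W. \<exists>z\<in>Q_pos. q = w \<oplus>\<^bsub>Q\<^esub> z"
  using QW.Whit_decomposition[OF Q_WMod, of q] by (simp add: Whit_QM)

lemma Q_disjoint: "q \<in> carrier W \<Longrightarrow> q \<in> Q_pos \<Longrightarrow> q = \<zero>\<^bsub>Q\<^esub>"
  using QW.Whit_Pos_disjoint[of q] by (simp add: Whit_QM)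

lemma Q_pos_submodule: "submodule Q_pos complex_ring QM"
  by (rule QW.Pos_submodule) (use W_carrier_Q in auto)

lemma W_submodule: "submodule (carrier W) complex_ring QM"
proof -
  interpret c: character_rep L \<mm> \<phi> QM by (rule character_repI[OF QM_lie_module])
  show ?thesis using c.Whit_submodule by (simp add: Whit_QM)
qed

text \<open>The projection \<open>Q \<rightarrow> W\<close> along \<open>Q\<^sub>+\<close>.\<close>

definition Q_proj :: "'a env_elem set \<Rightarrow> 'a env_elem set" where
  "Q_proj q = (THE w. w \<in> carrier W \<and> (\<exists>z\<in>Q_pos. q = w \<oplus>\<^bsub>Q\<^esub> z))"

lemmas Wsub = QR.complex_submoduleE[OF W_submodule, simplified]
lemmas Psub = QR.complex_submoduleE[OF Q_pos_submodule, simplified]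

lemma Q_proj_eq:
  assumes "w \<in> carrier W" "z \<in> Q_pos"
  shows "Q_proj (w \<oplus>\<^bsub>Q\<^esub> z) = w"
  unfolding Q_proj_def
proof (rule the_equality)
  fix w' assume "w' \<in> carrier W \<and> (\<exists>z'\<in>Q_pos. w \<oplus>\<^bsub>Q\<^esub> z = w' \<oplus>\<^bsub>Q\<^esub> z')"
  then obtain z' where *: "w' \<in> carrier W" "z' \<in> Q_pos" "w \<oplus>\<^bsub>Q\<^esub> z = w' \<oplus>\<^bsub>Q\<^esub> z'" by blast
  have c: "w \<in> carrier Q" "w' \<in> carrier Q" "z \<in> carrier Q" "z' \<in> carrier Q" using assms * Wsub(1) Psub(1) by auto
  let ?a = "w' \<oplus>\<^bsub>Q\<^esub> (-1) \<odot>\<^bsub>Q\<^esub> w"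
  have "?a = (w' \<oplus>\<^bsub>Q\<^esub> z') \<oplus>\<^bsub>Q\<^esub> ((-1) \<odot>\<^bsub>Q\<^esub> w \<oplus>\<^bsub>Q\<^esub> (-1) \<odot>\<^bsub>Q\<^esub> z')"
  proof -
    have "(w' \<oplus>\<^bsub>Q\<^esub> z') \<oplus>\<^bsub>Q\<^esub> ((-1) \<odot>\<^bsub>Q\<^esub> w \<oplus>\<^bsub>Q\<^esub> (-1) \<odot>\<^bsub>Q\<^esub> z') =
      (w' \<oplus>\<^bsub>Q\<^esub> (-1) \<odot>\<^bsub>Q\<^esub> w) \<oplus>\<^bsub>Q\<^esub> (z' \<oplus>\<^bsub>Q\<^esub> (-1) \<odot>\<^bsub>Q\<^esub> z')"
      using c by (simp add: Qm.M.a_ac del: Qm.cancel_smult Qm.cancel_smult_left)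
    then show ?thesis using c by simp
  qed
  also have "\<dots> = (w \<oplus>\<^bsub>Q\<^esub> z) \<oplus>\<^bsub>Q\<^esub> ((-1) \<odot>\<^bsub>Q\<^esub> w \<oplus>\<^bsub>Q\<^esub> (-1) \<odot>\<^bsub>Q\<^esub> z')" by (simp only: *(3))
  also have "\<dots> = z \<oplus>\<^bsub>Q\<^esub> (-1) \<odot>\<^bsub>Q\<^esub> z'"
  proof -
    have "(w \<oplus>\<^bsub>Q\<^esub> z) \<oplus>\<^bsub>Q\<^esub> ((-1) \<odot>\<^bsub>Q\<^esub> w \<oplus>\<^bsub>Q\<^esub> (-1) \<odot>\<^bsub>Q\<^esub> z') =
      (w \<oplus>\<^bsub>Q\<^esub> (-1) \<odot>\<^bsub>Q\<^esub> w) \<oplus>\<^bsub>Q\<^esub> (z \<oplus>\<^bsub>Q\<^esub> (-1) \<odot>\<^bsub>Q\<^esub> z')"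
      using c by (simp add: Qm.M.a_ac del: Qm.cancel_smult Qm.cancel_smult_left)
    then show ?thesis using c by simp
  qed
  finally have e: "?a = z \<oplus>\<^bsub>Q\<^esub> (-1) \<odot>\<^bsub>Q\<^esub> z'" .
  have "?a \<in> Q_pos" unfolding e by (rule Psub(3)[OF assms(2) Psub(4)[OF *(2)]])
  moreover have "?a \<in> carrier W" by (rule Wsub(3)[OF *(1) Wsub(4)[OF assms(1)]])
  ultimately have "?a = \<zero>\<^bsub>Q\<^esub>" using Q_disjoint by blast
  then have "w' \<ominus>\<^bsub>Q\<^esub> w = \<zero>\<^bsub>Q\<^esub>" using Qm.minus_smult c by simp
  then show "w' = w" using Qm.minus_zero_iff c by simp
qed (use assms in auto)

lemma Q_proj_split:
  assumes "q \<in> carrier Q"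
  obtains w z where "w \<in> carrier W" "z \<in> Q_pos" "q = w \<oplus>\<^bsub>Q\<^esub> z" "Q_proj q = w"
  using Q_decomposition[OF assms] Q_proj_eq by blast

text \<open>Right multiplication by \<open>a \<in> W\<close> commutes with the action of \<open>\<aa>\<close> and preserves \<open>W\<close>, hence also \<open>Q\<^sub>+\<close>.\<close>

lemma Q_pos_mult:
  assumes "z \<in> Q_pos" "a \<in> carrier W"
  shows "z \<otimes>\<^bsub>Q\<^esub> a \<in> Q_pos"
proof -
  obtain g where g: "a = qc g" "g \<in> Wf" using assms(2) by (auto simp: W_carrier)
  have add: "(p \<oplus>\<^bsub>Q\<^esub> q) \<otimes>\<^bsub>Q\<^esub> a = p \<otimes>\<^bsub>Q\<^esub> a \<oplus>\<^bsub>Q\<^esub> q \<otimes>\<^bsub>Q\<^esub> a" and sc: "(c \<odot>\<^bsub>Q\<^esub> p) \<otimes>\<^bsub>Q\<^esub> a = c \<odot>\<^bsub>Q\<^esub> (p \<otimes>\<^bsub>Q\<^esub> a)"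
    if "p \<in> carrier Q" "q \<in> carrier Q" for p q c
    using that g by (auto simp: Q_carrier Q_add Q_smult Q_mult distrib_right)
  let ?H = "{q \<in> carrier Q. q \<otimes>\<^bsub>Q\<^esub> a \<in> Q_pos}"
  have "Q_pos \<subseteq> ?H"
  proof (rule QW.Pos_least)
    have "\<zero>\<^bsub>Q\<^esub> \<otimes>\<^bsub>Q\<^esub> a = \<zero>\<^bsub>Q\<^esub>" using g by (simp add: Q_zero Q_mult)
    then show "submodule ?H complex_ring QM"
      by (intro QR.complex_submoduleI) (auto simp: Psub add sc)
    fix w s assume w: "w \<in> ordered_words par order" "w \<noteq> []" "s \<in> carrier W"
    have sa: "s \<otimes>\<^bsub>Q\<^esub> a \<in> carrier W" using w(3) g by (auto simp: W_carrier Q_mult Wf_mult)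
    have s: "s \<in> carrier Q" using w(3) W_carrier_Q by blast
    have cl: "foldr (\<lambda>k. action QM (x k)) w s \<in> carrier Q" for w
      using QW.foldr_closed[of s w] s by simp
    have "foldr (\<lambda>k. action QM (x k)) w s \<otimes>\<^bsub>Q\<^esub> a = foldr (\<lambda>k. action QM (x k)) w (s \<otimes>\<^bsub>Q\<^esub> a)" for w
      by (induction w) (simp_all add: Q_act_mult[OF cl assms(2), symmetric])
    then show "foldr (\<lambda>k. action QM (x k)) w s \<in> ?H" using QW.Pos_base[OF w(1,2) sa] cl by simp
  qed
  then show ?thesis using assms(1) by blast
qed

lemma Q_proj_linear:
  assumes "p \<in> carrier Q"
  shows "Q_proj p \<in> carrier W"
    "q \<in> carrier Q \<Longrightarrow> Q_proj (p \<oplus>\<^bsub>Q\<^esub> q) = Q_proj p \<oplus>\<^bsub>Q\<^esub> Q_proj q"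
    "Q_proj (c \<odot>\<^bsub>Q\<^esub> p) = c \<odot>\<^bsub>Q\<^esub> Q_proj p"
    "a \<in> carrier W \<Longrightarrow> Q_proj (p \<otimes>\<^bsub>Q\<^esub> a) = Q_proj p \<otimes>\<^bsub>Q\<^esub> a"
proof -
  obtain w z where p: "w \<in> carrier W" "z \<in> Q_pos" "p = w \<oplus>\<^bsub>Q\<^esub> z" "Q_proj p = w" by (rule Q_proj_split[OF assms])
  have c: "w \<in> carrier Q" "z \<in> carrier Q" using p Wsub(1) Psub(1) by auto
  show "Q_proj p \<in> carrier W" using p by simp
  show "Q_proj (c \<odot>\<^bsub>Q\<^esub> p) = c \<odot>\<^bsub>Q\<^esub> Q_proj p"
    unfolding p(4) using p c Q_proj_eq[OF Wsub(4) Psub(4), of w z c c] by (simp add: Qm.smult_add)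
  show "Q_proj (p \<oplus>\<^bsub>Q\<^esub> q) = Q_proj p \<oplus>\<^bsub>Q\<^esub> Q_proj q" if "q \<in> carrier Q"
  proof -
    note qQ = that
    obtain w' z' where q: "w' \<in> carrier W" "z' \<in> Q_pos" "q = w' \<oplus>\<^bsub>Q\<^esub> z'" "Q_proj q = w'" by (rule Q_proj_split[OF qQ])
    have c': "w' \<in> carrier Q" "z' \<in> carrier Q" using q Wsub(1) Psub(1) by auto
    have "p \<oplus>\<^bsub>Q\<^esub> q = (w \<oplus>\<^bsub>Q\<^esub> w') \<oplus>\<^bsub>Q\<^esub> (z \<oplus>\<^bsub>Q\<^esub> z')" using p q c c' by (simp add: Qm.M.a_ac)
    then show ?thesis using Q_proj_eq[OF Wsub(3)[OF p(1) q(1)] Psub(3)[OF p(2) q(2)]] p q by simp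
  qed
  show "Q_proj (p \<otimes>\<^bsub>Q\<^esub> a) = Q_proj p \<otimes>\<^bsub>Q\<^esub> a" if a: "a \<in> carrier W"
  proof -
    have "p \<otimes>\<^bsub>Q\<^esub> a = (w \<otimes>\<^bsub>Q\<^esub> a) \<oplus>\<^bsub>Q\<^esub> (z \<otimes>\<^bsub>Q\<^esub> a)"
      using p c a by (auto simp: Q_carrier W_carrier Q_mult Q_add distrib_right)
    moreover have "w \<otimes>\<^bsub>Q\<^esub> a \<in> carrier W" using p(1) a by (auto simp: W_carrier Q_mult Wf_mult)
    ultimately show ?thesis using Q_proj_eq[OF _ Q_pos_mult[OF p(2) a]] p by simp
  qed
qed

lemma Q_proj_one: "Q_proj (qc 1) = qc 1"
  using Q_proj_eq[of "qc 1" "\<zero>\<^bsub>Q\<^esub>"] Wf_one Psub(2) by (simp add: qc_W)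

section \<open>The unit\<close>

context
  fixes N :: "('a env_elem set, 'w) supermodule"
  assumes N: "superalgebra_module W N"
begin

interpretation N: W_rep L \<mm> \<phi> N by (rule W_repI[OF N])
interpretation T: whittaker_rep L gr \<mm> \<phi> order u x d par N.TN by (rule whittaker_repI[OF N.T_lie_module])

text \<open>The projection \<open>Q \<rightarrow> W\<close> induces a map \<open>Q \<otimes> N \<rightarrow> W \<otimes> N = N\<close> that sends \<open>1 \<otimes> n\<close> to \<open>n\<close>.\<close>

lemma unit_injective:
  assumes "n \<in> carrier N" "n' \<in> carrier N" "N.t (qc 1) n = N.t (qc 1) n'"
  shows "n = n'"
proof -
  have "\<exists>h. (\<forall>v\<in>carrier N.TN. h v \<in> carrier N) \<and>
     (\<forall>v\<in>carrier N.TN. \<forall>w\<in>carrier N.TN. h (v \<oplus>\<^bsub>N.TN\<^esub> w) = h v \<oplus>\<^bsub>N\<^esub> h w) \<and>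
     (\<forall>c. \<forall>v\<in>carrier N.TN. h (c \<odot>\<^bsub>N.TN\<^esub> v) = c \<odot>\<^bsub>N\<^esub> h v) \<and>
     (\<forall>q\<in>carrier Q. \<forall>n\<in>carrier N. h (N.t q n) = action N (Q_proj q) n)"
    by (rule N.tensor_universal[OF N.complex_module_axioms])
       (simp_all add: Q_proj_linear N.Wact_closed N.Wact_add N.Wact_add_left N.Wact_smult N.Wact_smult_left N.Wact_mult)
  then obtain h where h: "\<forall>q\<in>carrier Q. \<forall>n\<in>carrier N. h (N.t q n) = action N (Q_proj q) n" by blast
  have "h (N.t (qc 1) k) = k" if "k \<in> carrier N" for k
    using h that N.Wact_one by (simp add: Q_proj_one Q_one)
  then show ?thesis using assms by metis
qed

lemma T_pos_t: "z \<in> Q_pos \<Longrightarrow> n \<in> carrier N \<Longrightarrow> N.t z n \<in> T.Pos T.Whit"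
proof -
  assume n: "n \<in> carrier N"
  have "T.Whit \<subseteq> carrier N.TN" using T.Whit_carrier by blast
  note PE = N.T.complex_submoduleE[OF T.Pos_submodule[OF this]]
  let ?H = "{q \<in> carrier Q. N.t q n \<in> T.Pos T.Whit}"
  have "Q_pos \<subseteq> ?H"
  proof (rule QW.Pos_least)
    have "N.t \<zero>\<^bsub>Q\<^esub> n = \<zero>\<^bsub>N.TN\<^esub>" using N.t_smult_left[of "\<zero>\<^bsub>Q\<^esub>" n 0] n by simp
    then show "submodule ?H complex_ring QM"
      using n PE by (intro QR.complex_submoduleI) (auto simp: N.t_add_left N.t_smult_left)
    fix w s assume w: "w \<in> ordered_words par order" "w \<noteq> []" "s \<in> carrier W"
    have cl: "foldr (\<lambda>k. action QM (x k)) w s \<in> carrier Q" for w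
      using QW.foldr_closed[of s w] W_carrier_Q[OF w(3)] by simp
    have "foldr (\<lambda>k. action N.TN (x k)) w (N.t s n) = N.t (foldr (\<lambda>k. action QM (x k)) w s) n" for w
      by (induction w) (simp_all add: N.T_act_t[OF cl n])
    then show "foldr (\<lambda>k. action QM (x k)) w s \<in> ?H"
      using T.Pos_base[OF w(1,2) N.t_Whit[OF w(3) n]] cl by simp
  qed
  then show "z \<in> Q_pos \<Longrightarrow> N.t z n \<in> T.Pos T.Whit" by blast
qed

text \<open>Every \<open>v\<close> is congruent to some \<open>1 \<otimes> n\<close> modulo \<open>(Q \<otimes> N)\<^sub>+\<close>.  If \<open>v\<close> is a Whittaker vector, then so is the difference, which is therefore \<open>0\<close>.\<close>

lemma unit_surjective:
  assumes v: "v \<in> T.Whit"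
  shows "\<exists>n\<in>carrier N. v = N.t (qc 1) n"
proof -
  have "T.Whit \<subseteq> carrier N.TN" using T.Whit_carrier by blast
  note PE = N.T.complex_submoduleE[OF T.Pos_submodule[OF this]]
  have Pc: "z \<in> T.Pos T.Whit \<Longrightarrow> z \<in> carrier N.TN" for z using PE(1) by auto
  let ?H = "{v \<in> carrier N.TN. \<exists>n\<in>carrier N. \<exists>z\<in>T.Pos T.Whit. v = N.t (qc 1) n \<oplus>\<^bsub>N.TN\<^esub> z}"
  have "carrier N.TN \<subseteq> ?H"
  proof (rule N.T_generated)
    show "submodule ?H complex_ring N.TN"
    proof (rule N.T.complex_submoduleI)
      have "N.t (qc 1) \<zero>\<^bsub>N\<^esub> = \<zero>\<^bsub>N.TN\<^esub>" using N.t_smult_right[of "qc 1" "\<zero>\<^bsub>N\<^esub>" 0] by simp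
      then have "\<zero>\<^bsub>N.TN\<^esub> = N.t (qc 1) \<zero>\<^bsub>N\<^esub> \<oplus>\<^bsub>N.TN\<^esub> \<zero>\<^bsub>N.TN\<^esub>" by simp
      then show "\<zero>\<^bsub>N.TN\<^esub> \<in> ?H" using PE(2) N.M.zero_closed N.T.M.zero_closed by blast
    next
      fix v w assume "v \<in> ?H" "w \<in> ?H"
      then obtain n z n' z' where *: "n \<in> carrier N" "z \<in> T.Pos T.Whit" "v = N.t (qc 1) n \<oplus>\<^bsub>N.TN\<^esub> z"
        "n' \<in> carrier N" "z' \<in> T.Pos T.Whit" "w = N.t (qc 1) n' \<oplus>\<^bsub>N.TN\<^esub> z'" by blast
      have "v \<oplus>\<^bsub>N.TN\<^esub> w = N.t (qc 1) (n \<oplus>\<^bsub>N\<^esub> n') \<oplus>\<^bsub>N.TN\<^esub> (z \<oplus>\<^bsub>N.TN\<^esub> z')"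
        using * Pc by (simp add: N.t_add_right N.T.M.a_ac)
      moreover have "v \<oplus>\<^bsub>N.TN\<^esub> w \<in> carrier N.TN" using * Pc by simp
      ultimately show "v \<oplus>\<^bsub>N.TN\<^esub> w \<in> ?H" using *(1,4) PE(3)[OF *(2,5)] by blast
    next
      fix c v assume "v \<in> ?H"
      then obtain n z where *: "n \<in> carrier N" "z \<in> T.Pos T.Whit" "v = N.t (qc 1) n \<oplus>\<^bsub>N.TN\<^esub> z" by blast
      have "c \<odot>\<^bsub>N.TN\<^esub> v = N.t (qc 1) (c \<odot>\<^bsub>N\<^esub> n) \<oplus>\<^bsub>N.TN\<^esub> c \<odot>\<^bsub>N.TN\<^esub> z"
        using * Pc by (simp add: N.t_smult_right N.T.smult_add)
      moreover have "c \<odot>\<^bsub>N.TN\<^esub> v \<in> carrier N.TN" using * Pc by simp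
      moreover have "c \<odot>\<^bsub>N\<^esub> n \<in> carrier N" using * by simp
      ultimately show "c \<odot>\<^bsub>N.TN\<^esub> v \<in> ?H" using PE(4)[OF *(2), of c] by blast
    qed auto
    fix q n assume q: "q \<in> carrier Q" and n: "n \<in> carrier N"
    obtain w z where wz: "w \<in> carrier W" "z \<in> Q_pos" "q = w \<oplus>\<^bsub>Q\<^esub> z" using Q_decomposition[OF q] by blast
    have c: "w \<in> carrier Q" "z \<in> carrier Q" using wz Wsub(1) Psub(1) by auto
    have "N.t q n = N.t (qc 1) (action N w n) \<oplus>\<^bsub>N.TN\<^esub> N.t z n"
      unfolding wz(3) N.t_add_left[OF c n] using N.t_W[OF wz(1) n] by simp
    then show "N.t q n \<in> ?H" using N.Wact_closed[OF wz(1) n] T_pos_t[OF wz(2) n] N.t_closed[OF q n] by blast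
  qed
  then obtain n z where nz: "n \<in> carrier N" "z \<in> T.Pos T.Whit" "v = N.t (qc 1) n \<oplus>\<^bsub>N.TN\<^esub> z"
    using T.Whit_carrier[OF v] by blast
  have t: "N.t (qc 1) n \<in> T.Whit" by (rule N.t_Whit[OF N.one_W nz(1)])
  have "z = v \<oplus>\<^bsub>N.TN\<^esub> (-1) \<odot>\<^bsub>N.TN\<^esub> N.t (qc 1) n"
  proof -
    have "v \<oplus>\<^bsub>N.TN\<^esub> (-1) \<odot>\<^bsub>N.TN\<^esub> N.t (qc 1) n = (N.t (qc 1) n \<oplus>\<^bsub>N.TN\<^esub> (-1) \<odot>\<^bsub>N.TN\<^esub> N.t (qc 1) n) \<oplus>\<^bsub>N.TN\<^esub> z"
      unfolding nz(3) using nz Pc by (simp add: N.T.M.a_ac del: N.T.cancel_smult N.T.cancel_smult_left)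
    then show ?thesis using nz Pc by simp
  qed
  also have "\<dots> \<in> T.Whit"
    using N.T.complex_submoduleE(3,4)[OF N.TR.Whit_submodule] v t by blast
  finally have "z = \<zero>\<^bsub>N.TN\<^esub>" using T.Whit_Pos_disjoint nz(2) by blast
  then show ?thesis using nz by auto
qed

lemma unit_iso: "(\<lambda>n\<in>carrier N. N.t (qc 1) n) \<in> supermodule_iso (carrier W) N (Wh \<mm> \<phi> N.TN)"
proof -
  have one0: "qc 1 \<in> parity Q 0"
    unfolding Q_parity by (rule imageI) (auto simp: supported_def word_parity_def zero_word_def)
  have tW: "n \<in> carrier N \<Longrightarrow> N.t (qc 1) n \<in> N.TR.Whit" for n by (rule N.t_Whit[OF N.one_W])
  have hom: "(\<lambda>n\<in>carrier N. N.t (qc 1) n) \<in> supermodule_hom (carrier W) N (Wh \<mm> \<phi> N.TN)"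
  proof (rule supermodule_homI)
    fix a n assume a: "a \<in> carrier W" and n: "n \<in> carrier N"
    obtain f where f: "a = qc f" using a by (auto simp: W_carrier)
    have "action (Wh \<mm> \<phi> N.TN) a (N.t (qc 1) n) = N.t a n"
      using N.TR.Wh_action[OF tW[OF n], of f] N.rho_t[OF n, of f 1] f by simp
    then show "(\<lambda>n\<in>carrier N. N.t (qc 1) n) (action N a n) = action (Wh \<mm> \<phi> N.TN) a ((\<lambda>n\<in>carrier N. N.t (qc 1) n) n)"
      using n a N.Wact_closed N.t_W by simp
  next
    fix i n assume n: "n \<in> parity N i"
    have "N.t (qc 1) n \<in> parity N.TN i" using N.t_parity[OF one0 n] by (simp only: add_0_left)
    then show "(\<lambda>n\<in>carrier N. N.t (qc 1) n) n \<in> parity (Wh \<mm> \<phi> N.TN) i"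
      using N.par_carrier[OF n] tW by simp
  qed (use tW in \<open>auto simp: N.t_add_right N.t_smult_right\<close>)
  moreover have "bij_betw (\<lambda>n\<in>carrier N. N.t (qc 1) n) (carrier N) (carrier (Wh \<mm> \<phi> N.TN))"
    unfolding bij_betw_def
  proof
    show "inj_on (\<lambda>n\<in>carrier N. N.t (qc 1) n) (carrier N)" using unit_injective by (auto intro!: inj_onI)
    show "(\<lambda>n\<in>carrier N. N.t (qc 1) n) ` carrier N = carrier (Wh \<mm> \<phi> N.TN)"
      using unit_surjective tW by auto
  qed
  ultimately show ?thesis by (simp add: supermodule_iso_def)
qed

end

theorem unit_nat_iso:
  "nat_iso_identity (superalgebra_module W :: ('a env_elem set, 'w) supermodule \<Rightarrow> bool) (carrier W)
     (\<lambda>N. Wh \<mm> \<phi> (Q_tensor L \<mm> \<phi> N))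
     (\<lambda>N N' g. Wh_map \<mm> \<phi> (Q_tensor L \<mm> \<phi> N) (Q_tensor L \<mm> \<phi> N') (Q_tensor_map L \<mm> \<phi> N N' g))"
  unfolding nat_iso_identity_def
proof (rule exI[of _ "\<lambda>N. \<lambda>n\<in>carrier N. W_rep.tc L \<mm> \<phi> N (Poly_Mapping.single (qc 1, n) 1)"], intro conjI allI impI ballI)
  fix N :: "('a env_elem set, 'w) supermodule" assume N: "superalgebra_module W N"
  show "(\<lambda>n\<in>carrier N. W_rep.tc L \<mm> \<phi> N (Poly_Mapping.single (qc 1, n) 1)) \<in> supermodule_iso (carrier W) N (Wh \<mm> \<phi> (Q_tensor L \<mm> \<phi> N))"
    by (rule unit_iso[OF N])
  fix N' :: "('a env_elem set, 'w) supermodule" and g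
  assume N': "superalgebra_module W N'" and g: "g \<in> supermodule_hom (carrier W) N N'"
  interpret N: W_rep L \<mm> \<phi> N by (rule W_repI[OF N])
  interpret N': W_rep L \<mm> \<phi> N' by (rule W_repI[OF N'])
  show "compose (carrier N) (\<lambda>n\<in>carrier N'. N'.t (qc 1) n) g =
    compose (carrier N) (Wh_map \<mm> \<phi> N.TN N'.TN (Q_tensor_map L \<mm> \<phi> N N' g)) (\<lambda>n\<in>carrier N. N.t (qc 1) n)"
    using N.t_Whit[OF N.one_W] supermodule_homD(1)[OF g] tmap_t[OF N N' g]
    by (auto simp: compose_def fun_eq_iff Wh_map_def)
qed

section \<open>The counit\<close>

context
  fixes M :: "('a, 'v) supermodule"
  assumes M: "WMod L \<mm> \<phi> M"
begin

lemma WMod_lie_module: "lie_module L M" using M by (simp add: WMod_def)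

interpretation C: character_rep L \<mm> \<phi> M by (rule character_repI[OF WMod_lie_module])
interpretation M: whittaker_rep L gr \<mm> \<phi> order u x d par M by (rule whittaker_repI[OF WMod_lie_module])
interpretation N: W_rep L \<mm> \<phi> "Wh \<mm> \<phi> M" by (rule W_repI[OF C.Wh_superalgebra_module])
interpretation T: whittaker_rep L gr \<mm> \<phi> order u x d par N.TN by (rule whittaker_repI[OF N.T_lie_module])

text \<open>The counit is the map \<open>pr(y) \<otimes> v \<mapsto> yv\<close>; on pure tensors it is the action used for \<open>Wh(M)\<close>, extended from \<open>W\<close> to \<open>Q\<close>.\<close>

definition counit_spec :: "(('a, 'v) Q_tensor_elem \<Rightarrow> 'v) \<Rightarrow> bool" where
  "counit_spec h \<longleftrightarrow> (\<forall>v\<in>carrier N.TN. h v \<in> carrier M) \<and>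
     (\<forall>v\<in>carrier N.TN. \<forall>w\<in>carrier N.TN. h (v \<oplus>\<^bsub>N.TN\<^esub> w) = h v \<oplus>\<^bsub>M\<^esub> h w) \<and>
     (\<forall>c. \<forall>v\<in>carrier N.TN. h (c \<odot>\<^bsub>N.TN\<^esub> v) = c \<odot>\<^bsub>M\<^esub> h v) \<and>
     (\<forall>q\<in>carrier Q. \<forall>n\<in>C.Whit. h (N.t q n) = action (Wh \<mm> \<phi> M) q n)"

lemma counit_ex: "\<exists>h. counit_spec h"
proof -
  note rules = C.Wh_action C.Whit_carrier C.rho_add_left C.rho_scale_left C.rho_add C.rho_smult C.rho_mult C.rho_Whit
    C.complex_submoduleE(3,4)[OF C.Whit_submodule] Q_add Q_smult Q_mult
  show ?thesis unfolding counit_spec_def C.Wh_simps(1)[symmetric]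
    by (rule N.tensor_universal[OF C.complex_module_axioms])
       (auto simp: Q_carrier W_carrier rules simp del: C.Wh_simps(1) simp: C.Wh_simps(1))
qed

definition counit where "counit = (SOME h. counit_spec h)"

lemma counit:
  "v \<in> carrier N.TN \<Longrightarrow> counit v \<in> carrier M"
  "v \<in> carrier N.TN \<Longrightarrow> w \<in> carrier N.TN \<Longrightarrow> counit (v \<oplus>\<^bsub>N.TN\<^esub> w) = counit v \<oplus>\<^bsub>M\<^esub> counit w"
  "v \<in> carrier N.TN \<Longrightarrow> counit (c \<odot>\<^bsub>N.TN\<^esub> v) = c \<odot>\<^bsub>M\<^esub> counit v"
  "n \<in> C.Whit \<Longrightarrow> counit (N.t (qc f) n) = free_action M f n"
  using someI_ex[OF counit_ex] unfolding counit_def[symmetric] by (auto simp: counit_spec_def C.Wh_action)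

lemma counit_zero: "counit \<zero>\<^bsub>N.TN\<^esub> = \<zero>\<^bsub>M\<^esub>"
  using counit(3)[of "\<zero>\<^bsub>N.TN\<^esub>" 0] counit(1)[of "\<zero>\<^bsub>N.TN\<^esub>"] by simp

lemma counit_act: "v \<in> carrier N.TN \<Longrightarrow> counit (action N.TN y v) = action M y (counit v)"
proof (rule N.T_ext[OF C.complex_module_axioms])
  fix q n assume q: "q \<in> carrier Q" and n: "n \<in> carrier (Wh \<mm> \<phi> M)"
  obtain f where f: "q = qc f" using q by (auto simp: Q_carrier)
  show "counit (action N.TN y (N.t q n)) = action M y (counit (N.t q n))"
    using n by (simp add: f N.T_act_t QM_action counit C.rho_letter_mult C.Whit_carrier)
qed (auto simp: counit N.T_act_closed N.T_act_add N.T_act_smult C.act_add C.act_smult)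

lemma counit_one: "n \<in> C.Whit \<Longrightarrow> counit (N.t (qc 1) n) = n"
  by (simp add: counit C.Whit_carrier)

lemma counit_parity: "v \<in> parity N.TN i \<Longrightarrow> counit v \<in> parity M i"
proof -
  have "parity N.TN i \<subseteq> {v \<in> carrier N.TN. counit v \<in> parity M i}"
  proof (rule N.T_parity_generated)
    show "submodule {v \<in> carrier N.TN. counit v \<in> parity M i} complex_ring N.TN"
      by (rule N.T.complex_submoduleI) (auto simp: counit counit_zero C.par)
    fix j q n assume q: "q \<in> parity Q j" and n: "n \<in> parity (Wh \<mm> \<phi> M) (i - j)"
    obtain f where f: "q = qc f" "f \<in> supported (word_parity L j)" using q by (auto simp: Q_parity)
    have "free_action M f n \<in> parity M (j + (i - j))" by (rule C.rho_parity[OF f(2)]) (use n in simp)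
    moreover have "j + (i - j) = i" by (cases i; cases j) simp_all
    ultimately have "free_action M f n \<in> parity M i" by metis
    then show "N.t q n \<in> {v \<in> carrier N.TN. counit v \<in> parity M i}" using f n by (simp add: counit)
  qed
  then show "v \<in> parity N.TN i \<Longrightarrow> counit v \<in> parity M i" by blast
qed

text \<open>A Whittaker vector of the kernel has the form \<open>1 \<otimes> n\<close> and is mapped to \<open>n\<close>, so it is zero; hence the kernel is zero.\<close>

lemma counit_injective:
  assumes v: "v \<in> carrier N.TN" and w: "w \<in> carrier N.TN" and eq: "counit v = counit w"
  shows "v = w"
proof -
  let ?Z = "{v \<in> carrier N.TN. counit v = \<zero>\<^bsub>M\<^esub>}"
  let ?a = "v \<ominus>\<^bsub>N.TN\<^esub> w"
  have "counit ?a = \<zero>\<^bsub>M\<^esub>"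
    using v w eq counit(1)[OF w] by (simp add: N.T.minus_smult counit)
  then have "?a \<in> ?Z" using v w by simp
  then have "?a = \<zero>\<^bsub>N.TN\<^esub>"
  proof (rule T.submodule_meets_Whit[OF Q_tensor_WMod[OF C.Wh_superalgebra_module], rotated 3])
    show "submodule ?Z complex_ring N.TN"
      by (rule N.T.complex_submoduleI) (auto simp: counit counit_zero)
    show "action N.TN y z \<in> ?Z" if "z \<in> ?Z" for y z
      using that by (simp add: N.T_act_closed counit_act)
    fix z assume z: "z \<in> ?Z" "z \<in> T.Whit"
    obtain n where n: "n \<in> carrier (Wh \<mm> \<phi> M)" "z = N.t (qc 1) n"
      using unit_surjective[OF C.Wh_superalgebra_module z(2)] by blast
    have "n = \<zero>\<^bsub>Wh \<mm> \<phi> M\<^esub>" using z(1) n counit_one by simp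
    then show "z = \<zero>\<^bsub>N.TN\<^esub>" using n N.t_smult_right[of "qc 1" n 0] N.smult_zero by simp
  qed
  then show ?thesis using v w N.T.minus_zero_iff by simp
qed

lemma counit_surjective: "carrier M \<subseteq> counit ` carrier N.TN"
proof -
  let ?R = "counit ` carrier N.TN"
  have sub: "submodule ?R complex_ring M"
  proof (rule C.complex_submoduleI)
    show "\<zero>\<^bsub>M\<^esub> \<in> ?R" using counit_zero by (intro image_eqI[of _ _ "\<zero>\<^bsub>N.TN\<^esub>"]) simp_all
    fix v w assume "v \<in> ?R" "w \<in> ?R"
    then obtain s t where "v = counit s" "w = counit t" "s \<in> carrier N.TN" "t \<in> carrier N.TN" by blast
    then show "v \<oplus>\<^bsub>M\<^esub> w \<in> ?R" by (intro image_eqI[of _ _ "s \<oplus>\<^bsub>N.TN\<^esub> t"]) (simp_all add: counit)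
  next
    fix c v assume "v \<in> ?R"
    then obtain s where "v = counit s" "s \<in> carrier N.TN" by blast
    then show "c \<odot>\<^bsub>M\<^esub> v \<in> ?R" by (intro image_eqI[of _ _ "c \<odot>\<^bsub>N.TN\<^esub> s"]) (simp_all add: counit)
  qed (auto simp: counit)
  have wh: "n \<in> ?R" if "n \<in> M.Whit" for n
    using that counit_one[OF that] by (intro image_eqI[of _ _ "N.t (qc 1) n"]) simp_all
  have act: "action M y v \<in> ?R" if "v \<in> ?R" for y v
  proof -
    obtain s where "v = counit s" "s \<in> carrier N.TN" using \<open>v \<in> ?R\<close> by blast
    then show ?thesis by (intro image_eqI[of _ _ "action N.TN y s"]) (simp_all add: counit_act N.T_act_closed)
  qed
  have "M.Pos M.Whit \<subseteq> ?R"
  proof (rule M.Pos_least[OF sub])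
    fix w s assume "s \<in> M.Whit"
    then show "foldr (\<lambda>k. action M (x k)) w s \<in> ?R" by (induction w) (simp_all add: wh act)
  qed
  show ?thesis
  proof
    fix v assume "v \<in> carrier M"
    from M.Whit_decomposition[OF M this] obtain w z where "w \<in> M.Whit" "z \<in> M.Pos M.Whit" "v = w \<oplus>\<^bsub>M\<^esub> z" by blast
    then show "v \<in> ?R" using C.complex_submoduleE(3)[OF sub wh, of w z] \<open>M.Pos M.Whit \<subseteq> ?R\<close> by auto
  qed
qed

definition counit_inv where "counit_inv = (\<lambda>v\<in>carrier M. inv_into (carrier N.TN) counit v)"

lemma counit_inv:
  "v \<in> carrier M \<Longrightarrow> counit_inv v \<in> carrier N.TN" "v \<in> carrier M \<Longrightarrow> counit (counit_inv v) = v"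
  "t \<in> carrier N.TN \<Longrightarrow> counit_inv (counit t) = t"
proof -
  show 1: "v \<in> carrier M \<Longrightarrow> counit_inv v \<in> carrier N.TN" for v
    using counit_surjective by (auto simp: counit_inv_def intro!: inv_into_into)
  show 2: "v \<in> carrier M \<Longrightarrow> counit (counit_inv v) = v" for v
    using counit_surjective by (auto simp: counit_inv_def intro!: f_inv_into_f)
  show "t \<in> carrier N.TN \<Longrightarrow> counit_inv (counit t) = t"
    using counit_injective[OF 1[of "counit t"] _ 2[of "counit t"]] counit(1) by simp
qed

lemma counit_inv_eq: "t \<in> carrier N.TN \<Longrightarrow> counit t = v \<Longrightarrow> counit_inv v = t"
  using counit_inv(3) by blast

lemma counit_inv_iso: "counit_inv \<in> supermodule_iso UNIV M N.TN"
proof -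
  have hom: "counit_inv \<in> supermodule_hom UNIV M N.TN"
  proof (rule supermodule_homI)
    show "counit_inv \<in> extensional (carrier M)" by (simp add: counit_inv_def)
    fix v assume v: "v \<in> carrier M"
    show "counit_inv v \<in> carrier N.TN" using counit_inv v by simp
    show "counit_inv (c \<odot>\<^bsub>M\<^esub> v) = c \<odot>\<^bsub>N.TN\<^esub> counit_inv v" for c
      by (rule counit_inv_eq) (simp_all add: counit counit_inv v)
    show "counit_inv (action M y v) = action N.TN y (counit_inv v)" for y
      by (rule counit_inv_eq) (simp_all add: counit_act counit_inv v N.T_act_closed)
    fix w assume w: "w \<in> carrier M"
    show "counit_inv (v \<oplus>\<^bsub>M\<^esub> w) = counit_inv v \<oplus>\<^bsub>N.TN\<^esub> counit_inv w"
      by (rule counit_inv_eq) (simp_all add: counit counit_inv v w)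
  next
    fix i v assume v: "v \<in> parity M i"
    have vc: "v \<in> carrier M" using C.par_carrier[OF v] .
    obtain a b where ab: "a \<in> parity N.TN 0" "b \<in> parity N.TN 1" "counit_inv v = a \<oplus>\<^bsub>N.TN\<^esub> b"
      using N.T_split[OF counit_inv(1)[OF vc]] by blast
    have c: "a \<in> carrier N.TN" "b \<in> carrier N.TN" using ab N.TR.par_carrier by auto
    \<comment> \<open>The component of the wrong parity is mapped to \<open>0\<close>, hence is \<open>0\<close> itself.\<close>
    have e: "v = counit a \<oplus>\<^bsub>M\<^esub> counit b" using counit_inv(2)[OF vc] ab(3) c by (simp add: counit)
    have z: "counit k = \<zero>\<^bsub>M\<^esub> \<Longrightarrow> k \<in> carrier N.TN \<Longrightarrow> k = \<zero>\<^bsub>N.TN\<^esub>" for k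
      using counit_injective[of k "\<zero>\<^bsub>N.TN\<^esub>"] counit_zero by simp
    show "counit_inv v \<in> parity N.TN i"
    proof (cases i)
      case zero
      have "counit a = v \<and> counit b = \<zero>\<^bsub>M\<^esub>"
      proof (rule C.parity_unique[OF counit_parity[OF ab(1)] counit_parity[OF ab(2)]])
        show "counit a \<oplus>\<^bsub>M\<^esub> counit b = v \<oplus>\<^bsub>M\<^esub> \<zero>\<^bsub>M\<^esub>" unfolding e[symmetric] using vc by simp
      qed (use v zero C.par(2) in auto)
      then have "b = \<zero>\<^bsub>N.TN\<^esub>" using z c(2) by blast
      then show ?thesis using ab(1,3) zero c by simp
    next
      case one
      have "counit a = \<zero>\<^bsub>M\<^esub> \<and> counit b = v"
      proof (rule C.parity_unique[OF counit_parity[OF ab(1)] counit_parity[OF ab(2)]])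
        show "counit a \<oplus>\<^bsub>M\<^esub> counit b = \<zero>\<^bsub>M\<^esub> \<oplus>\<^bsub>M\<^esub> v" unfolding e[symmetric] using vc by simp
      qed (use v one C.par(2) in auto)
      then have "a = \<zero>\<^bsub>N.TN\<^esub>" using z c(1) by blast
      then show ?thesis using ab(2,3) one c by simp
    qed
  qed
  moreover have "bij_betw counit_inv (carrier M) (carrier N.TN)"
    by (rule bij_betw_byWitness[of _ counit]) (auto simp: counit_inv counit)
  ultimately show ?thesis by (simp add: supermodule_iso_def)
qed

end

theorem counit_nat_iso:
  "nat_iso_identity (WMod L \<mm> \<phi> :: ('a, 'v) supermodule \<Rightarrow> bool) UNIV
     (\<lambda>M. Q_tensor L \<mm> \<phi> (Wh \<mm> \<phi> M))
     (\<lambda>M M' f. Q_tensor_map L \<mm> \<phi> (Wh \<mm> \<phi> M) (Wh \<mm> \<phi> M') (Wh_map \<mm> \<phi> M M' f))"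
  unfolding nat_iso_identity_def
proof (rule exI[of _ counit_inv], intro conjI allI impI ballI)
  fix M :: "('a, 'v) supermodule" assume M: "WMod L \<mm> \<phi> M"
  show "counit_inv M \<in> supermodule_iso UNIV M (Q_tensor L \<mm> \<phi> (Wh \<mm> \<phi> M))" by (rule counit_inv_iso[OF M])
  fix M' :: "('a, 'v) supermodule" and f
  assume M': "WMod L \<mm> \<phi> M'" and f: "f \<in> supermodule_hom UNIV M M'"
  note mod = WMod_lie_module[OF M] WMod_lie_module[OF M']
  interpret C: character_rep L \<mm> \<phi> M by (rule character_repI[OF mod(1)])
  interpret C': character_rep L \<mm> \<phi> M' by (rule character_repI[OF mod(2)])
  interpret N: W_rep L \<mm> \<phi> "Wh \<mm> \<phi> M" by (rule W_repI[OF C.Wh_superalgebra_module])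
  interpret N': W_rep L \<mm> \<phi> "Wh \<mm> \<phi> M'" by (rule W_repI[OF C'.Wh_superalgebra_module])
  let ?g = "Wh_map \<mm> \<phi> M M' f"
  let ?F = "Q_tensor_map L \<mm> \<phi> (Wh \<mm> \<phi> M) (Wh \<mm> \<phi> M') ?g"
  have g: "?g \<in> supermodule_hom (carrier W) (Wh \<mm> \<phi> M) (Wh \<mm> \<phi> M')" by (rule Wh_map_hom[OF mod f])
  note F = supermodule_homD[OF tmap_hom[OF C.Wh_superalgebra_module C'.Wh_superalgebra_module g]]
  have eq: "counit M' (?F t) = f (counit M t)" if t: "t \<in> carrier N.TN" for t
  proof (rule N.T_ext[OF C'.complex_module_axioms _ _ _ _ _ _ _ t])
    fix q n assume q: "q \<in> carrier Q" and n: "n \<in> carrier (Wh \<mm> \<phi> M)"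
    obtain k where k: "q = qc k" using q by (auto simp: Q_carrier)
    have "?F (N.t q n) = N'.t q (f n)"
      using tmap_t[OF C.Wh_superalgebra_module C'.Wh_superalgebra_module g q n] n by (simp add: Wh_map_def)
    then show "counit M' (?F (N.t q n)) = f (counit M (N.t q n))"
      using n hom_Whit[OF mod f] k hom_rho[OF C.lie_rep_axioms C'.lie_rep_axioms f]
      by (simp add: counit(4)[OF M] counit(4)[OF M'] C.Whit_carrier)
  qed (auto simp: F counit[OF M] counit[OF M'] supermodule_homD[OF f])
  have "counit_inv M' (f v) = ?F (counit_inv M v)" if v: "v \<in> carrier M" for v
    by (rule counit_inv_eq[OF M']) (simp_all add: F counit_inv[OF M] v eq)
  then show "compose (carrier M) (counit_inv M') f = compose (carrier M) ?F (counit_inv M)"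
    by (simp add: compose_def fun_eq_iff)
qed

end

section \<open>Homogeneous components\<close>

context Z_graded_lie_superalgebra
begin

definition component :: "'a \<Rightarrow> int \<Rightarrow> 'a" where
  "component z = (THE c. (\<forall>k. c k \<in> gr k) \<and> finite {k. c k \<noteq> 0} \<and> z = (\<Sum>k\<in>{k. c k \<noteq> 0}. c k))"

lemmas gr_rules = lie.subspace_0[OF gr_subspace] lie.subspace_add[OF gr_subspace] lie.subspace_scale[OF gr_subspace]

lemma component:
  "component z k \<in> gr k" "finite {k. component z k \<noteq> 0}" "z = (\<Sum>k\<in>{k. component z k \<noteq> 0}. component z k)"
  using theI'[OF gr_decomposition[of z]] unfolding component_def[symmetric] by blast+

lemma component_eq:
  assumes "\<And>k. c k \<in> gr k" "finite A" "\<And>k. k \<notin> A \<Longrightarrow> c k = 0" "z = (\<Sum>k\<in>A. c k)"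
  shows "component z = c"
  unfolding component_def
proof (rule the1_equality[OF gr_decomposition])
  have s: "{k. c k \<noteq> 0} \<subseteq> A" using assms(3) by blast
  have "(\<Sum>k\<in>{k. c k \<noteq> 0}. c k) = (\<Sum>k\<in>A. c k)" by (rule sum.mono_neutral_left[OF assms(2) s]) auto
  then show "(\<forall>k. c k \<in> gr k) \<and> finite {k. c k \<noteq> 0} \<and> z = (\<Sum>k\<in>{k. c k \<noteq> 0}. c k)"
    using assms(1,4) finite_subset[OF s assms(2)] by simp
qed

lemma component_add: "component (y + z) k = component y k + component z k"
proof -
  let ?A = "{k. component y k \<noteq> 0} \<union> {k. component z k \<noteq> 0}"
  have fin: "finite ?A" using component(2) by simp
  have sup: "v = (\<Sum>k\<in>?A. component v k)" if "{k. component v k \<noteq> 0} \<subseteq> ?A" for v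
    by (rule trans[OF component(3)[of v] sum.mono_neutral_left[OF fin that]]) auto
  have "y + z = (\<Sum>k\<in>?A. component y k) + (\<Sum>k\<in>?A. component z k)"
    by (rule arg_cong2[OF sup sup, of _ _ plus]) auto
  then have "y + z = (\<Sum>k\<in>?A. component y k + component z k)" by (simp only: sum.distrib)
  then have "component (y + z) = (\<lambda>k. component y k + component z k)"
    by (intro component_eq[OF _ fin]) (auto intro: gr_rules component)
  then show ?thesis by simp
qed

lemma component_scale: "component (lscale L c z) k = lscale L c (component z k)"
proof -
  have "lscale L c z = (\<Sum>k\<in>{k. component z k \<noteq> 0}. lscale L c (component z k))"
    by (subst component(3)[of z]) (rule lie.scale_sum_right)
  then have "component (lscale L c z) = (\<lambda>k. lscale L c (component z k))"
    by (intro component_eq[OF _ component(2)[of z]]) (auto intro: gr_rules component)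
  then show ?thesis by simp
qed

lemma component_gr: "z \<in> gr k \<Longrightarrow> component z l = (if l = k then z else 0)"
proof -
  assume "z \<in> gr k"
  then have "component z = (\<lambda>l. if l = k then z else 0)"
    by (intro component_eq[of _ "{k}"]) (auto simp: gr_rules)
  then show ?thesis by simp
qed

lemma component_zero [simp]: "component 0 k = 0"
  using component_scale[of 0 0 k] by simp

lemma component_gr_upto: "z \<in> gr_upto L gr k \<Longrightarrow> k < l \<Longrightarrow> component z l = 0"
proof -
  assume z: "z \<in> gr_upto L gr k" and l: "k < l"
  have "lie.subspace {z. component z l = 0}"
    by (rule lie.subspaceI) (auto simp: component_add component_scale)
  then have "z \<in> {z. component z l = 0}"
    by (rule lie.span_subspace_induct[OF z[unfolded gr_upto_def]]) (use l in \<open>auto simp: component_gr\<close>)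
  then show ?thesis by simp
qed

lemma gr_le_gr_upto: "z \<in> gr i \<Longrightarrow> i \<le> k \<Longrightarrow> z \<in> gr_upto L gr k"
  unfolding gr_upto_def by (intro lie.span_base) auto

text \<open>Taking the component of degree \<open>k\<close> of a combination of homogeneous elements keeps exactly the terms of that degree.\<close>

lemma homogeneous_span:
  assumes "z \<in> gr k" "z \<in> lspan L (b ` I)" "\<And>i. i \<in> I \<Longrightarrow> b i \<in> gr (e i)"
  shows "z \<in> lspan L (b ` {i \<in> I. e i = k})"
proof -
  let ?T = "{z. component z k \<in> lspan L (b ` {i \<in> I. e i = k})}"
  have T: "lie.subspace ?T"
    by (rule lie.subspaceI) (auto simp: component_add component_scale lie.span_zero intro: lie.span_add lie.span_scale)
  have "v \<in> ?T" if "v \<in> b ` I" for v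
  proof -
    from that obtain i where i: "i \<in> I" "v = b i" by blast
    show ?thesis
    proof (cases "e i = k")
      case True
      then have "v \<in> lspan L (b ` {i \<in> I. e i = k})" using i by (intro lie.span_base) blast
      then show ?thesis using component_gr[OF assms(3)[OF i(1)], of k] True i by simp
    next
      case False
      then show ?thesis using component_gr[OF assms(3)[OF i(1)], of k] i lie.span_zero by simp
    qed
  qed
  from lie.span_subspace_induct[OF assms(2) T this] have "z \<in> ?T" .
  then show ?thesis using component_gr[OF assms(1)] by simp
qed

end

theorem theorem19:
  fixes L :: "'a::ab_group_add lie_super"
    and gr :: "int \<Rightarrow> 'a set"
    and \<mm> :: "'a set"
    and \<phi> :: "'a \<Rightarrow> complex"
    and m m' :: nat
    and u x :: "nat \<Rightarrow> 'a"
    and d :: "nat \<Rightarrow> int"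
  assumes "\<mm> = gr_upto L gr (-1)"
    and "Z_graded_lie_superalgebra L gr"
    and "finite_dimensional L"
    and "lie_character L \<mm> \<phi>"
    and "m' \<le> m"
    and "inj_on u {1..m}"
    and "\<not> module.dependent (lscale L) (u ` {1..m})"
    and "lspan L (u ` {1..m}) = \<mm>"
    and "\<And>s. s \<in> {1..m} \<Longrightarrow> u s \<in> gr (- d s)"
    and "\<And>s. s \<in> {1..m'} \<Longrightarrow> u s \<in> lparity L 0"
    and "\<And>s. s \<in> {m'+1..m} \<Longrightarrow> u s \<in> lparity L 1"
    and "\<And>s. s \<in> {1..m} \<Longrightarrow> x s \<in> gr (-1 + d s)"
    and "\<And>s. s \<in> {1..m'} \<Longrightarrow> x s \<in> lparity L 0"
    and "\<And>s. s \<in> {m'+1..m} \<Longrightarrow> x s \<in> lparity L 1"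
    and "\<And>i. i \<in> {1..m} \<Longrightarrow>
           bracket L (u i) (x i) \<in> \<mm> \<inter> gr (-1) \<and> \<phi> (bracket L (u i) (x i)) = 1"
    and "\<And>i j. i \<in> {1..m} \<Longrightarrow> j \<in> {1..m} \<Longrightarrow> i \<noteq> j \<Longrightarrow>
           bracket L (u i) (x j) \<in> \<mm> \<inter> gr (-1) \<Longrightarrow> \<phi> (bracket L (u i) (x j)) = 0"
    and "\<And>z. z \<in> gr_upto L gr (-2) \<Longrightarrow> \<phi> z = 0"
  shows
    "supermodule_functor
       (WMod L \<mm> \<phi> :: ('a, 'v) supermodule \<Rightarrow> bool) UNIV
       (superalgebra_module (W_algebra L \<mm> \<phi>)) (carrier (W_algebra L \<mm> \<phi>))
       (Wh \<mm> \<phi>) (Wh_map \<mm> \<phi>) \<and>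
     supermodule_functor
       (superalgebra_module (W_algebra L \<mm> \<phi>) :: ('a env_elem set, 'w) supermodule \<Rightarrow> bool)
       (carrier (W_algebra L \<mm> \<phi>))
       (WMod L \<mm> \<phi>) UNIV
       (Q_tensor L \<mm> \<phi>) (Q_tensor_map L \<mm> \<phi>) \<and>
     nat_iso_identity
       (WMod L \<mm> \<phi> :: ('a, 'v) supermodule \<Rightarrow> bool) UNIV
       (\<lambda>M. Q_tensor L \<mm> \<phi> (Wh \<mm> \<phi> M))
       (\<lambda>M M' f. Q_tensor_map L \<mm> \<phi> (Wh \<mm> \<phi> M) (Wh \<mm> \<phi> M') (Wh_map \<mm> \<phi> M M' f)) \<and>
     nat_iso_identity
       (superalgebra_module (W_algebra L \<mm> \<phi>) :: ('a env_elem set, 'w) supermodule \<Rightarrow> bool)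
       (carrier (W_algebra L \<mm> \<phi>))
       (\<lambda>N. Wh \<mm> \<phi> (Q_tensor L \<mm> \<phi> N))
       (\<lambda>N N' g. Wh_map \<mm> \<phi> (Q_tensor L \<mm> \<phi> N) (Q_tensor L \<mm> \<phi> N')
          (Q_tensor_map L \<mm> \<phi> N N' g))"
proof -
  interpret Z: Z_graded_lie_superalgebra L gr by (rule assms(2))
  define order where "order = sort_key (\<lambda>i. - d i) [1..<Suc m]"
  define p :: "nat \<Rightarrow> bit" where "p i = (if i \<le> m' then 0 else 1)" for i
  have order: "set order = {1..m}" by (auto simp: order_def)
  have span: "\<mm> = lspan L (u ` set order)" using assms(8) order by simp
  have up: "u i \<in> lparity L (p i)" "x i \<in> lparity L (p i)" if "i \<in> {1..m}" for i
    using that assms(10,11,13,14)[of i] by (auto simp: p_def)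
  have ug: "u i \<in> gr (- d i)" if "i \<in> {1..m}" for i using assms(9)[OF that] .
  have um: "u i \<in> \<mm>" if "i \<in> {1..m}" for i
    unfolding span order by (rule Z.lie.span_base) (rule imageI[OF that])
  \<comment> \<open>Elements of \<open>\<mm>\<close> have no component in degree \<open>- d i \<ge> 0\<close>, and \<open>u i\<close> is not zero.\<close>
  have dpos: "1 \<le> d i" if i: "i \<in> {1..m}" for i
  proof (rule ccontr)
    assume "\<not> 1 \<le> d i"
    moreover have "u i \<in> gr_upto L gr (-1)" using um[OF i] assms(1) by simp
    ultimately have "u i = 0"
      using Z.component_gr_upto[of "u i" "-1" "- d i"] Z.component_gr[OF ug[OF i], of "- d i"] by simp
    then show False using assms(7) i Z.lie.dependent_zero[of "u ` {1..m}"] by (metis imageI)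
  qed
  interpret whittaker_datum L gr \<mm> \<phi> order u x d p
  proof unfold_locales
    show "lie_character L \<mm> \<phi>" by (rule assms(4))
    show msub: "Z.lie.subspace \<mm>" unfolding span by simp
    show "\<exists>a\<in>\<mm> \<inter> lparity L 0. \<exists>b\<in>\<mm> \<inter> lparity L 1. z = a + b" if "z \<in> \<mm>" for z
    proof -
      let ?T = "{z. \<exists>a\<in>\<mm> \<inter> lparity L 0. \<exists>b\<in>\<mm> \<inter> lparity L 1. z = a + b}"
      note sub = Z.lie.subspace_inter[OF msub Z.parity_subspace]
      have T: "Z.lie.subspace ?T"
      proof -
        have "?T = {a + b | a b. a \<in> \<mm> \<inter> lparity L 0 \<and> b \<in> \<mm> \<inter> lparity L 1}" by auto
        then show ?thesis using Z.lie.subspace_sums[OF sub sub] by simp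
      qed
      have "u i \<in> ?T" if i: "i \<in> {1..m}" for i
      proof -
        have m: "u i \<in> \<mm>" by (rule um[OF i])
        show ?thesis
        proof (cases "p i")
          case zero
          then show ?thesis using m up(1)[OF i] Z.lie.subspace_0[OF sub]
            by (intro CollectI bexI[of _ "u i"] bexI[of _ 0]) simp_all
        next
          case one
          then show ?thesis using m up(1)[OF i] Z.lie.subspace_0[OF sub]
            by (intro CollectI bexI[of _ 0] bexI[of _ "u i"]) simp_all
        qed
      qed
      then have gen: "v \<in> ?T" if "v \<in> u ` set order" for v using that order by (elim imageE) simp
      have "z \<in> ?T" by (rule Z.lie.span_subspace_induct[OF that[unfolded span] T gen])
      then show ?thesis by (rule CollectD)
    qed
    show "\<mm> = lspan L (u ` set order)" by (rule span)
    show "distinct order" by (simp add: order_def)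
    show "sorted_wrt (\<lambda>i j. d j \<le> d i) order"
      using sorted_sort_key[of "\<lambda>i. - d i" "[1..<Suc m]"] unfolding order_def sorted_map by simp
    fix i assume i: "i \<in> set order"
    then have i': "i \<in> {1..m}" using order by simp
    show "1 \<le> d i" by (rule dpos[OF i'])
    show "u i \<in> gr (- d i)" by (rule ug[OF i'])
    show "x i \<in> gr (d i - 1)" using assms(12)[OF i'] by (simp add: algebra_simps)
    show "u i \<in> lparity L (p i)" "x i \<in> lparity L (p i)" using up[OF i'] .
    fix j assume j: "j \<in> set order" "d i = d j"
    have "bracket L (u i) (x j) \<in> gr (-1)"
      using Z.gr_bracket[OF ug[OF i'] assms(12)[of j]] j order by simp
    then have "bracket L (u i) (x j) \<in> \<mm> \<inter> gr (-1)" using Z.gr_le_gr_upto assms(1) by auto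
    then show "\<phi> (bracket L (u i) (x j)) = (if i = j then 1 else 0)"
      using assms(15)[of i] assms(16)[of i j] i' j order by auto
  next
    fix e z assume e: "1 \<le> (e::int)" and z: "z \<in> gr (- e)"
    have "z \<in> \<mm>" using Z.gr_le_gr_upto[OF z, of "-1"] e assms(1) by simp
    then show "z \<in> lspan L (u ` {i \<in> set order. d i = e})"
      using Z.homogeneous_span[OF z, of u "set order" "\<lambda>i. - d i"] ug order span by simp
  next
    fix e z assume e: "2 \<le> (e::int)" and z: "z \<in> gr (- e)"
    then show "\<phi> z = 0" using assms(17) Z.gr_le_gr_upto[OF z, of "-2"] by simp
  qed
  show ?thesis
    by (intro conjI Wh_functor Q_tensor_functor counit_nat_iso unit_nat_iso)
qed

end
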